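(* Given $\varepsilon>0$ there exists $\alpha>0$ such that if $p=p(n)$ satisfies $1/n \leq p \leq 1-(1+\varepsilon)/n$ then $q^*(G_{n,p}) \geq \alpha \sqrt{\frac{1-p}{np}}$ with high probability.
   Context: For a graph $G=(V,E)$ with $m \geq 1$ edges, degrees $d_v$, for $A\subseteq V$ let ${\rm vol}(A)=\sum_{v\in A} d_v$ and let $e(A)$ be the number of edges with both ends in $A$. For a partition $\mathcal{A}$ of $V$, $q_{\mathcal A}(G)=\frac{1}{m}\sum_{A\in\mathcal A} e(A)-\frac{1}{4m^2}\sum_{A\in\mathcal A}{\rm vol}(A)^2$, and $q^*(G)=\max_{\mathcal A} q_{\mathcal A}(G)$; a graph with no edges has $q^*(G)=0$. The binomial random graph $G_{n,p}$ has vertex set $\{1,\dots,n\}$ and each possible edge is present independently with probability $p$. An event holds with high probability if its probability tends to $1$ as $n\to\infty$. *)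

theory Defs
  imports "HOL-Probability.Probability" "HOL-Probability.Product_PMF" "HOL-Library.Disjoint_Sets"
begin

text \<open>A finite simple graph is given by a finite vertex set \<open>V\<close> and a set \<open>E\<close> of two-element
  subsets of \<open>V\<close>.\<close>

definition all_edges :: "'a set \<Rightarrow> 'a set set" where
  "all_edges V = {e. e \<subseteq> V \<and> card e = 2}"

definition vdegree :: "'a set set \<Rightarrow> 'a \<Rightarrow> nat" where
  "vdegree E v = card {e \<in> E. v \<in> e}"

definition vol :: "'a set set \<Rightarrow> 'a set \<Rightarrow> nat" where
  "vol E A = (\<Sum>v\<in>A. vdegree E v)"

definition edges_within :: "'a set set \<Rightarrow> 'a set \<Rightarrow> nat" where
  "edges_within E A = card {e \<in> E. e \<subseteq> A}"

definition partition_modularity :: "'a set set \<Rightarrow> 'a set set \<Rightarrow> real" where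
  "partition_modularity E P =
     1 / real (card E) * (\<Sum>A\<in>P. real (edges_within E A))
     - 1 / (4 * (real (card E))\<^sup>2) * (\<Sum>A\<in>P. (real (vol E A))\<^sup>2)"

definition modularity :: "'a set \<Rightarrow> 'a set set \<Rightarrow> real" where
  "modularity V E =
     (if E = {} then 0 else Max (partition_modularity E ` {P. partition_on V P}))"

text \<open>The maximum ranges over a finite nonempty set.\<close>

lemma finite_nonempty_partition_modularity:
  assumes "finite V"
  shows "finite (partition_modularity E ` {P. partition_on V P})"
    and "partition_modularity E ` {P. partition_on V P} \<noteq> {}"
proof -
  show "finite (partition_modularity E ` {P. partition_on V P})"
    using finitely_many_partition_on[OF assms] by simp
  have "(\<lambda>x. {x}) ` V \<in> {P. partition_on V P}"
    by (simp add: partition_on_singletons)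
  then show "partition_modularity E ` {P. partition_on V P} \<noteq> {}" by blast
qed

text \<open>The law of the edge set of \<open>G\<^sub>n\<^sub>,\<^sub>p\<close>: independent \<open>p\<close>-coin flips, one per potential edge
  (entries outside \<open>all_edges {1..n}\<close> are constantly \<open>False\<close>). The library clamps the parameter of
  \<^const>\<open>bernoulli_pmf\<close> to \<open>[0,1]\<close>, so this is only meaningful for \<open>0 \<le> p \<le> 1\<close>.\<close>

definition binomial_random_graph :: "nat \<Rightarrow> real \<Rightarrow> nat set set pmf" where
  "binomial_random_graph n p =
     map_pmf (\<lambda>f. {e. f e})
       (Pi_pmf (all_edges {1..n}) False (\<lambda>_. bernoulli_pmf p))"

end

theory Submission
  imports Defs
begin

text \<open>
  A sign vector \<open>s\<close> on the vertices gives a partition into two parts whose modularity is controlled by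
  the quadratic form \<open>W = (\<Sum>e. s(e) * ([e \<in> X] - p))\<close>, \<open>s(e)\<close> being the product of the signs at the
  ends of \<open>e\<close>, and by the signed degree sum. Signs are fixed on a core; the other vertices are put
  into pairs \<open>(v, v')\<close> with opposite signs, chosen such that the edges from the pair to the core
  contribute \<open>\<bar>Z\<^sub>v\<bar>\<close> to \<open>W\<close>. As the edges between pairs are independent of this choice, their
  contribution is negligible. The variable \<open>Z\<^sub>v\<close> is the end of a lazy simple random walk, whatever
  the signs on the core are.

  If \<open>n * (1 - p)\<close> is large, take half of the vertices as core, with signs \<open>1\<close> and \<open>-1\<close> on its two
  halves. Then \<open>E \<bar>Z\<^sub>v\<bar>\<close> is of order \<open>sqrt (n * p * (1 - p))\<close>, and exchanging the two halves shows
  that the signed degree sum has mean zero, hence is negligible.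

  Otherwise the complement graph has average degree about \<open>n * (1 - p) \<ge> 1 + \<epsilon>\<close>, and bounded. Take a core of
  almost \<open>1 / (1 - p)\<close> vertices: there the complement is subcritical, so that up to boundedly many
  edges it is a forest, which is two-coloured. The core then contributes its number of vertices to
  \<open>2 * W\<close>, and every other vertex contributes \<open>E \<bar>Z\<^sub>v\<bar> > 1\<close>, so that \<open>2 * W\<close> exceeds \<open>n\<close> by a linear
  amount, which is what is needed. All failure probabilities are \<open>O(1 / n)\<close> by Chebyshev's and Markov's inequalities.
\<close>

section \<open>Expectation over a random subset\<close>

text \<open>With \<sigma> the sum of the signs, the products of the signs over all pairs of vertices
  add up to (\<sigma>^2 - n) / 2. Centring the edge indicators at p therefore leaves a deficit p n
  that 2 W has to beat, which explains the case split. For n (1 - p) at least 2500 the gain, of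
  order n sqrt(n p (1 - p)), exceeds the deficit by a factor that leaves room for crude constants.
  For bounded n (1 - p) both are linear in n, so the constants have to be right: the core only
  breaks even, and the surplus comes from E |Z| > 1 at the other vertices, of which the upper bound
  on p leaves a positive proportion. There the walk makes about 1 / (1 - p) steps and each moves
  with probability 2 p (1 - p), hence about two moves in the mean; in the limit E |Z| is the
  integral of exp(-t) I_0(t) over {0..2}, where I_0(t) = 1 + t^2 / 4 + ... is the modified Bessel
  function. Subcriticality of the core serves twice: since cycles are rare, almost every missing
  edge can be made bichromatic, and since components are small, the two colours can be
  balanced.\<close>

definition EE :: "real \<Rightarrow> 'a set \<Rightarrow> ('a set \<Rightarrow> real) \<Rightarrow> real" where
  "EE p A F = (\<Sum>X\<in>Pow A. p ^ card X * (1 - p) ^ card (A - X) * F X)"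

lemma EE_empty [simp]: "EE p {} F = F {}"
  by (simp add: EE_def)

lemma EE_insert:
  assumes "finite A" "e \<notin> A"
  shows "EE p (insert e A) F = p * EE p A (\<lambda>X. F (insert e X)) + (1 - p) * EE p A F"
proof -
  have "inj_on (insert e) (Pow A)" using assms(2) by (auto simp: inj_on_def)
  have dis: "Pow A \<inter> insert e ` Pow A = {}" using assms(2) by auto
  have "EE p (insert e A) F = (\<Sum>X\<in>Pow A. p ^ card X * (1 - p) ^ card (insert e A - X) * F X)
     + (\<Sum>X\<in>insert e ` Pow A. p ^ card X * (1 - p) ^ card (insert e A - X) * F X)"
    unfolding EE_def Pow_insert using assms dis by (subst sum.union_disjoint) auto
  also have "(\<Sum>X\<in>insert e ` Pow A. p ^ card X * (1 - p) ^ card (insert e A - X) * F X)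
    = (\<Sum>X\<in>Pow A. p ^ card (insert e X) * (1 - p) ^ card (insert e A - insert e X) * F (insert e X))"
    by (subst sum.reindex) (use \<open>inj_on _ _\<close> in auto)
  also have "\<dots> = (\<Sum>X\<in>Pow A. p * (p ^ card X * (1 - p) ^ card (A - X) * F (insert e X)))"
  proof (rule sum.cong)
    fix X assume "X \<in> Pow A"
    then have "card (insert e X) = Suc (card X)" "insert e A - insert e X = A - X"
      using assms by (auto simp: card_insert_if finite_subset)
    then show "p ^ card (insert e X) * (1 - p) ^ card (insert e A - insert e X) * F (insert e X)
      = p * (p ^ card X * (1 - p) ^ card (A - X) * F (insert e X))" by simp
  qed simp
  also have "(\<Sum>X\<in>Pow A. p ^ card X * (1 - p) ^ card (insert e A - X) * F X)
     = (\<Sum>X\<in>Pow A. (1 - p) * (p ^ card X * (1 - p) ^ card (A - X) * F X))"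
  proof (rule sum.cong)
    fix X assume "X \<in> Pow A"
    then have "insert e A - X = insert e (A - X)" using assms by auto
    then have "card (insert e A - X) = Suc (card (A - X))" using assms by simp
    then show "p ^ card X * (1 - p) ^ card (insert e A - X) * F X
       = (1 - p) * (p ^ card X * (1 - p) ^ card (A - X) * F X)" by simp
  qed simp
  finally show ?thesis unfolding EE_def by (simp add: sum_distrib_left)
qed

lemma EE_cong: "(\<And>X. X \<subseteq> A \<Longrightarrow> F X = G X) \<Longrightarrow> EE p A F = EE p A G"
  unfolding EE_def by (rule sum.cong) auto

lemma EE_mono:
  assumes "0 \<le> p" "p \<le> 1" "\<And>X. X \<subseteq> A \<Longrightarrow> F X \<le> G X"
  shows "EE p A F \<le> EE p A G"
  unfolding EE_def using assms by (intro sum_mono mult_left_mono) auto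

lemma EE_add: "EE p A (\<lambda>X. F X + G X) = EE p A F + EE p A G"
  unfolding EE_def by (simp add: algebra_simps sum.distrib)

lemma EE_cmult: "EE p A (\<lambda>X. c * F X) = c * EE p A F"
  unfolding EE_def by (simp add: algebra_simps sum_distrib_left)

lemma EE_minus: "EE p A (\<lambda>X. - F X) = - EE p A F"
  using EE_cmult[of p A "-1" F] by simp

lemma EE_diff: "EE p A (\<lambda>X. F X - G X) = EE p A F - EE p A G"
  using EE_add[of p A F "\<lambda>X. - G X"] by (simp add: EE_minus)

lemma EE_sum: "EE p A (\<lambda>X. \<Sum>i\<in>I. F i X) = (\<Sum>i\<in>I. EE p A (F i))"
  unfolding EE_def by (simp add: sum_distrib_left) (rule sum.swap)

lemma EE_const:
  assumes "finite A" shows "EE p A (\<lambda>_. c) = c"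
  using assms by (induction A) (auto simp: EE_insert algebra_simps)

text \<open>Fubini for independent coordinates. The expectation being a finite sum, conditioning on
  some of the edges is nothing more than splitting the ground set.\<close>

lemma EE_Un:
  assumes "finite A" "finite B" "A \<inter> B = {}"
  shows "EE p (A \<union> B) F = EE p A (\<lambda>X. EE p B (\<lambda>Y. F (X \<union> Y)))"
  using assms
proof (induction A arbitrary: F rule: finite_induct)
  case (insert e A)
  have "EE p (insert e A \<union> B) F = EE p (insert e (A \<union> B)) F" by simp
  also have "\<dots> = p * EE p (A \<union> B) (\<lambda>X. F (insert e X)) + (1 - p) * EE p (A \<union> B) F"
    using insert by (subst EE_insert) auto
  also have "\<dots> = p * EE p A (\<lambda>X. EE p B (\<lambda>Y. F (insert e (X \<union> Y)))) +
     (1 - p) * EE p A (\<lambda>X. EE p B (\<lambda>Y. F (X \<union> Y)))"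
    using insert by simp
  finally show ?case using insert by (simp add: EE_insert)
qed simp

lemma EE_restrict:
  assumes "finite A" "B \<subseteq> A"
  shows "EE p A (\<lambda>X. F (X \<inter> B)) = EE p B F"
proof -
  have "A = B \<union> (A - B)" using assms by auto
  then have "EE p A (\<lambda>X. F (X \<inter> B)) = EE p (B \<union> (A - B)) (\<lambda>X. F (X \<inter> B))" by simp
  also have "\<dots> = EE p B (\<lambda>X. EE p (A - B) (\<lambda>Y. F ((X \<union> Y) \<inter> B)))"
    using assms by (subst EE_Un) (auto intro: finite_subset)
  also have "\<dots> = EE p B (\<lambda>X. EE p (A - B) (\<lambda>Y. F X))"
    by (intro EE_cong arg_cong[of _ _ F]) auto
  also have "\<dots> = EE p B F" using assms by (simp add: EE_const)
  finally show ?thesis .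
qed

text \<open>Conditioning on the coordinates outside \<open>B\<close>: a bound that is uniform in
  them survives averaging. Signs that were chosen by looking at edges outside \<open>B\<close> are
  constants in the inner expectation.\<close>

lemma EE_cond_le:
  assumes "finite A" "B \<subseteq> A" "0 \<le> p" "p \<le> 1"
    and "\<And>Y. Y \<subseteq> A - B \<Longrightarrow> EE p B (\<lambda>X. F (X \<union> Y)) \<le> c"
  shows "EE p A F \<le> c"
proof -
  have "A = (A - B) \<union> B" using assms by auto
  then have "EE p A F = EE p ((A - B) \<union> B) F" by simp
  also have "\<dots> = EE p (A - B) (\<lambda>Y. EE p B (\<lambda>X. F (X \<union> Y)))"
    using assms by (subst EE_Un) (auto intro: finite_subset simp: Un_commute)
  also have "\<dots> \<le> EE p (A - B) (\<lambda>Y. c)" by (rule EE_mono) (use assms in auto)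
  also have "\<dots> = c" using assms by (simp add: EE_const)
  finally show ?thesis .
qed

lemma EE_edge_indep:
  assumes "finite A" "B \<subseteq> A" "e \<in> A" "e \<notin> B"
  shows "EE p A (\<lambda>X. of_bool (e \<in> X) * G (X \<inter> B)) = p * EE p B G"
proof -
  have A: "A = insert e (A - {e})" using assms by auto
  have "EE p A (\<lambda>X. of_bool (e \<in> X) * G (X \<inter> B))
     = EE p (insert e (A - {e})) (\<lambda>X. of_bool (e \<in> X) * G (X \<inter> B))" using A by simp
  also have "\<dots> = p * EE p (A - {e}) (\<lambda>X. G (insert e X \<inter> B)) +
     (1 - p) * EE p (A - {e}) (\<lambda>X. of_bool (e \<in> X) * G (X \<inter> B))"
    using assms by (subst EE_insert) auto
  also have "EE p (A - {e}) (\<lambda>X. of_bool (e \<in> X) * G (X \<inter> B)) = EE p (A - {e}) (\<lambda>X. 0)"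
    by (rule EE_cong) auto
  also have "EE p (A - {e}) (\<lambda>X. G (insert e X \<inter> B)) = EE p (A - {e}) (\<lambda>X. G (X \<inter> B))"
    using assms(4) by (intro EE_cong arg_cong[of _ _ G]) auto
  also have "\<dots> = EE p B G" using assms by (intro EE_restrict) auto
  finally show ?thesis using assms by (simp add: EE_const)
qed

text \<open>The non-edges form a random graph with parameter \<open>1 - p\<close>; the bounded
  regime studies that graph.\<close>

lemma EE_complement:
  assumes "finite A"
  shows "EE p A (\<lambda>X. F (A - X)) = EE (1 - p) A F"
proof -
  have "EE (1 - p) A F = (\<Sum>X\<in>(\<lambda>X. A - X) ` Pow A. (1 - p) ^ card X * p ^ card (A - X) * F X)"
  proof -
    have "(\<lambda>X. A - X) ` Pow A = Pow A"
    proof (intro equalityI subsetI)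
      fix X assume "X \<in> Pow A"
      then have "X = A - (A - X)" "A - X \<in> Pow A" by auto
      then show "X \<in> (\<lambda>X. A - X) ` Pow A" by (rule image_eqI)
    qed auto
    then show ?thesis unfolding EE_def by simp
  qed
  also have "\<dots> = (\<Sum>X\<in>Pow A. (1 - p) ^ card (A - X) * p ^ card (A - (A - X)) * F (A - X))"
    by (subst sum.reindex) (auto simp: inj_on_def)
  also have "\<dots> = EE p A (\<lambda>X. F (A - X))"
    unfolding EE_def by (rule sum.cong) (auto simp: double_diff)
  finally show ?thesis by simp
qed

text \<open>All coordinates have the same parameter, so permuting them preserves the law. This is
  the source of the symmetry arguments for the signed degree sum.\<close>

lemma EE_bij:
  assumes "bij_betw h A A"
  shows "EE p A (\<lambda>X. F (h ` X)) = EE p A F"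
proof -
  have inj: "inj_on h A" and im: "h ` A = A" using assms by (auto simp: bij_betw_def)
  have bp: "bij_betw (image h) (Pow A) (Pow A)" using assms by (rule bij_betw_Pow)
  have "EE p A F = (\<Sum>X\<in>Pow A. p ^ card (h ` X) * (1 - p) ^ card (A - h ` X) * F (h ` X))"
    unfolding EE_def by (rule sum.reindex_bij_betw[OF bp, symmetric])
  also have "\<dots> = EE p A (\<lambda>X. F (h ` X))"
    unfolding EE_def
  proof (rule sum.cong)
    fix X assume "X \<in> Pow A"
    then have "card (h ` X) = card X" "A - h ` X = h ` (A - X)"
      using inj im inj_on_image_set_diff[OF inj, of A X]
      by (auto intro!: card_image inj_on_subset[OF inj])
    moreover have "card (h ` (A - X)) = card (A - X)"
      by (intro card_image inj_on_subset[OF inj]) auto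
    ultimately show "p ^ card (h ` X) * (1 - p) ^ card (A - h ` X) * F (h ` X) =
         p ^ card X * (1 - p) ^ card (A - X) * F (h ` X)" by simp
  qed simp
  finally show ?thesis by simp
qed

text \<open>Independent centred summands are uncorrelated; independence holds because each
  \<open>F i\<close> reads only its own block of coordinates.\<close>

lemma EE_indep_sum_square:
  assumes "finite I" "\<And>i. i \<in> I \<Longrightarrow> finite (A i)" "disjoint_family_on A I"
    and "\<And>i. i \<in> I \<Longrightarrow> EE p (A i) (F i) = 0"
  shows "EE p (\<Union>i\<in>I. A i) (\<lambda>X. (\<Sum>i\<in>I. F i (X \<inter> A i))\<^sup>2) = (\<Sum>i\<in>I. EE p (A i) (\<lambda>X. (F i X)\<^sup>2))"
    (is "?goal I")
proof -
  \<comment> \<open>The vanishing mean of the partial sum is carried through the induction because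
    the cross term needs it.\<close>
  have "?goal I \<and> EE p (\<Union>i\<in>I. A i) (\<lambda>X. \<Sum>i\<in>I. F i (X \<inter> A i)) = 0"
    using assms
  proof (induction I rule: finite_induct)
    case (insert j I)
    define B where "B = (\<Union>i\<in>I. A i)"
    define S where "S X = (\<Sum>i\<in>I. F i (X \<inter> A i))" for X
    have IH: "EE p B (\<lambda>X. (S X)\<^sup>2) = (\<Sum>i\<in>I. EE p (A i) (\<lambda>X. (F i X)\<^sup>2))" "EE p B S = 0"
      using insert unfolding B_def S_def
      by (auto simp: disjoint_family_on_def)
    have dis: "A j \<inter> B = {}" "finite B" "finite (A j)"
      using insert unfolding B_def disjoint_family_on_def by fastforce+
    have U: "(\<Union>i\<in>insert j I. A i) = A j \<union> B" by (auto simp: B_def)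
    have S: "(\<Sum>i\<in>insert j I. F i ((X \<union> Y) \<inter> A i)) = F j X + S Y" if "X \<subseteq> A j" "Y \<subseteq> B" for X Y
    proof -
      have "(X \<union> Y) \<inter> A j = X" using that dis by auto
      moreover have "(X \<union> Y) \<inter> A i = Y \<inter> A i" if "i \<in> I" for i
        using that \<open>X \<subseteq> A j\<close> dis unfolding B_def by auto
      ultimately show ?thesis using insert.hyps by (simp add: S_def)
    qed
    have "EE p (A j \<union> B) (\<lambda>X. (\<Sum>i\<in>insert j I. F i (X \<inter> A i))\<^sup>2)
       = EE p (A j) (\<lambda>X. EE p B (\<lambda>Y. (F j X + S Y)\<^sup>2))"
      using dis S by (subst EE_Un) (auto intro!: EE_cong)
    also have "\<dots> = EE p (A j) (\<lambda>X. (F j X)\<^sup>2 + EE p B (\<lambda>Y. (S Y)\<^sup>2))"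
    proof (rule EE_cong)
      fix X
      have "EE p B (\<lambda>Y. (F j X + S Y)\<^sup>2) = EE p B (\<lambda>Y. ((F j X)\<^sup>2 + (S Y)\<^sup>2) + (2 * F j X) * S Y)"
        by (simp add: power2_sum)
      then show "EE p B (\<lambda>Y. (F j X + S Y)\<^sup>2) = (F j X)\<^sup>2 + EE p B (\<lambda>Y. (S Y)\<^sup>2)"
        using dis IH(2) by (simp add: EE_add EE_cmult EE_const)
    qed
    also have "\<dots> = EE p (A j) (\<lambda>X. (F j X)\<^sup>2) + EE p B (\<lambda>Y. (S Y)\<^sup>2)"
      using dis by (simp add: EE_add EE_const)
    finally have 1: "EE p (A j \<union> B) (\<lambda>X. (\<Sum>i\<in>insert j I. F i (X \<inter> A i))\<^sup>2)
       = EE p (A j) (\<lambda>X. (F j X)\<^sup>2) + EE p B (\<lambda>Y. (S Y)\<^sup>2)" .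
    have "EE p (A j \<union> B) (\<lambda>X. (\<Sum>i\<in>insert j I. F i (X \<inter> A i)))
       = EE p (A j) (\<lambda>X. EE p B (\<lambda>Y. (F j X + S Y)))"
      using dis S by (subst EE_Un) (auto intro!: EE_cong)
    also have "\<dots> = 0" using dis IH insert by (simp add: EE_add EE_const)
    finally show ?case using 1 IH insert.hyps U by simp
  qed (auto simp: EE_def)
  then show ?thesis by blast
qed

lemma EE_linear_square:
  assumes "finite B"
  shows "EE p B (\<lambda>X. (\<Sum>e\<in>B. c e * (of_bool (e \<in> X) - p))\<^sup>2) = p * (1 - p) * (\<Sum>e\<in>B. (c e)\<^sup>2)"
proof -
  have s: "EE p {e} (\<lambda>X. c e * (of_bool (e \<in> X) - p)) = 0"
    "EE p {e} (\<lambda>X. (c e * (of_bool (e \<in> X) - p))\<^sup>2) = p * (1 - p) * (c e)\<^sup>2" for e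
    by (simp_all add: EE_insert power2_eq_square algebra_simps)
  have "EE p (\<Union>e\<in>B. {e}) (\<lambda>X. (\<Sum>e\<in>B. c e * (of_bool (e \<in> X \<inter> {e}) - p))\<^sup>2)
     = (\<Sum>e\<in>B. EE p {e} (\<lambda>X. (c e * (of_bool (e \<in> X) - p))\<^sup>2))"
    using assms s by (intro EE_indep_sum_square[where F = "\<lambda>e X. c e * (of_bool (e \<in> X) - p)"])
      (auto simp: disjoint_family_on_def)
  then show ?thesis by (simp add: s sum_distrib_left)
qed

text \<open>The coefficients may depend on the coordinates outside \<open>B\<close>.\<close>

lemma EE_linear_square_le:
  assumes "finite A" "B \<subseteq> A" "0 \<le> p" "p \<le> 1"
    and "\<And>Y e. e \<in> B \<Longrightarrow> \<bar>c Y e\<bar> \<le> M"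
  shows "EE p A (\<lambda>X. (\<Sum>e\<in>B. c (X - B) e * (of_bool (e \<in> X) - p))\<^sup>2) \<le> M\<^sup>2 * card B * (p * (1 - p))"
proof (rule EE_cond_le[OF assms(1-4)])
  fix Y assume Y: "Y \<subseteq> A - B"
  have "EE p B (\<lambda>X. (\<Sum>e\<in>B. c ((X \<union> Y) - B) e * (of_bool (e \<in> X \<union> Y) - p))\<^sup>2)
      = EE p B (\<lambda>X. (\<Sum>e\<in>B. c Y e * (of_bool (e \<in> X) - p))\<^sup>2)"
  proof (intro EE_cong arg_cong[of _ _ "\<lambda>x. x\<^sup>2"] sum.cong)
    fix X e assume "X \<subseteq> B" "e \<in> B"
    then have "X \<union> Y - B = Y" "e \<notin> Y" using Y by auto
    then show "c ((X \<union> Y) - B) e * (of_bool (e \<in> X \<union> Y) - p) = c Y e * (of_bool (e \<in> X) - p)" by simp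
  qed simp
  also have "\<dots> = p * (1 - p) * (\<Sum>e\<in>B. (c Y e)\<^sup>2)"
    by (rule EE_linear_square) (use assms finite_subset in blast)
  also have "\<dots> \<le> p * (1 - p) * (\<Sum>e\<in>B. M\<^sup>2)"
  proof (intro mult_left_mono sum_mono)
    fix e assume "e \<in> B"
    from assms(5)[OF this, of Y] show "(c Y e)\<^sup>2 \<le> M\<^sup>2" by (simp add: abs_le_square_iff[symmetric])
  qed (use assms in auto)
  finally show "EE p B (\<lambda>X. (\<Sum>e\<in>B. c ((X \<union> Y) - B) e * (of_bool (e \<in> X \<union> Y) - p))\<^sup>2)
      \<le> M\<^sup>2 * card B * (p * (1 - p))" by (simp add: algebra_simps)
qed

lemma EE_markov:
  assumes "0 \<le> p" "p \<le> 1" "t > 0" "\<And>X. X \<subseteq> A \<Longrightarrow> 0 \<le> F X"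
  shows "EE p A (\<lambda>X. of_bool (t \<le> F X)) \<le> EE p A F / t"
proof -
  have "EE p A (\<lambda>X. of_bool (t \<le> F X)) \<le> EE p A (\<lambda>X. (1 / t) * F X)"
    using assms by (intro EE_mono) auto
  then show ?thesis unfolding EE_cmult by simp
qed

section \<open>Transfer to the law of the random edge set\<close>

lemma expectation_Pi_bernoulli:
  assumes "finite A" "0 \<le> p" "p \<le> 1"
  shows "measure_pmf.expectation (Pi_pmf A False (\<lambda>_. bernoulli_pmf p)) (\<lambda>f. F {e. f e}) = EE p A F"
  using assms(1)
proof (induction A arbitrary: F rule: finite_induct)
  case (insert e A)
  let ?P = "Pi_pmf A False (\<lambda>_. bernoulli_pmf p)"
  have fin: "finite (set_pmf ?P)"
    by (rule finite_subset[OF set_Pi_pmf_subset'[OF insert(1)]]) (use insert in \<open>auto intro: finite_PiE_dflt\<close>)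
  have ins: "{a. (f(e := True)) a} = insert e {a. f a}" for f :: "'a \<Rightarrow> bool" by auto
  \<comment> \<open>Coordinates outside \<open>A\<close> have the default value \<open>False\<close>
    almost surely, and \<open>e\<close> is one of them.\<close>
  have del: "measure_pmf.expectation ?P (\<lambda>f. F {a. (f(e := False)) a}) = measure_pmf.expectation ?P (\<lambda>f. F {a. f a})"
  proof (intro integral_cong_AE AE_pmfI)
    fix f assume "f \<in> set_pmf ?P"
    then have "f e = False" using set_Pi_pmf_subset[OF insert(1)] insert(2) by fast
    then have "f(e := False) = f" by (simp add: fun_upd_idem)
    then show "F {a. (f(e := False)) a} = F {a. f a}" by simp
  qed auto
  have "measure_pmf.expectation (Pi_pmf (insert e A) False (\<lambda>_. bernoulli_pmf p)) (\<lambda>f. F {e. f e})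
      = measure_pmf.expectation (bernoulli_pmf p \<bind> (\<lambda>b. map_pmf (\<lambda>f. f(e := b)) ?P)) (\<lambda>f. F {e. f e})"
    using insert by (subst Pi_pmf_insert') (auto simp: map_pmf_def)
  also have "\<dots> = measure_pmf.expectation (bernoulli_pmf p) (\<lambda>b. measure_pmf.expectation ?P (\<lambda>f. F {a. (f(e := b)) a}))"
    using fin by (subst pmf_expectation_bind[where A = UNIV])
      (auto simp: integral_measure_pmf_real[where A = UNIV] mult.commute)
  also have "\<dots> = p * measure_pmf.expectation ?P (\<lambda>f. F {a. (f(e := True)) a}) +
     (1 - p) * measure_pmf.expectation ?P (\<lambda>f. F {a. (f(e := False)) a})"
    using assms by (simp add: integral_bernoulli_pmf)
  also have "\<dots> = EE p (insert e A) F"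
    using insert.hyps insert.IH[of F] insert.IH[of "\<lambda>X. F (insert e X)"] unfolding ins del
    by (simp add: EE_insert)
  finally show ?case .
qed simp

lemma finite_all_edges: "finite V \<Longrightarrow> finite (all_edges V)"
  unfolding all_edges_def by (auto intro: finite_subset[of _ "Pow V"])

lemma prob_binomial_random_graph:
  assumes "0 \<le> p" "p \<le> 1"
  shows "measure_pmf.prob (binomial_random_graph n p) Q = EE p (all_edges {1..n}) (\<lambda>X. of_bool (X \<in> Q))"
proof -
  let ?P = "Pi_pmf (all_edges {1..n}) False (\<lambda>_. bernoulli_pmf p)"
  have "measure_pmf.prob (binomial_random_graph n p) Q = measure_pmf.prob ?P {f. {e. f e} \<in> Q}"
    unfolding binomial_random_graph_def by (simp add: measure_map_pmf vimage_def)
  also have "\<dots> = measure_pmf.expectation ?P (indicator {f. {e. f e} \<in> Q})" by simp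
  also have "\<dots> = measure_pmf.expectation ?P (\<lambda>f. indicator Q {e. f e})"
    by (intro arg_cong[of _ _ "measure_pmf.expectation ?P"]) (auto simp: indicator_def)
  also have "\<dots> = EE p (all_edges {1..n}) (indicator Q)"
    using assms by (intro expectation_Pi_bernoulli finite_all_edges) auto
  also have "(indicator Q :: _ \<Rightarrow> real) = (\<lambda>X. of_bool (X \<in> Q))" by (auto simp: indicator_def)
  finally show ?thesis .
qed

section \<open>Modularity of bipartitions\<close>

lemma all_edgesE:
  assumes "e \<in> all_edges V"
  obtains a b where "e = {a, b}" "a \<noteq> b" "a \<in> V" "b \<in> V"
  using assms unfolding all_edges_def by (auto simp: card_2_iff)

lemma all_edges_doubleton [simp]: "{a, b} \<in> all_edges V \<longleftrightarrow> a \<noteq> b \<and> a \<in> V \<and> b \<in> V"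
  unfolding all_edges_def by (auto simp: card_insert_if)

lemma all_edges_mono: "U \<subseteq> V \<Longrightarrow> all_edges U \<subseteq> all_edges V"
  unfolding all_edges_def by auto

lemma all_edges_insert:
  assumes "a \<notin> V"
  shows "all_edges (insert a V) = all_edges V \<union> (\<lambda>v. {a, v}) ` V"
    and "all_edges V \<inter> (\<lambda>v. {a, v}) ` V = {}"
    and "inj_on (\<lambda>v. {a, v}) V"
proof -
  show "all_edges (insert a V) = all_edges V \<union> (\<lambda>v. {a, v}) ` V"
  proof (intro equalityI subsetI)
    fix e assume "e \<in> all_edges (insert a V)"
    then obtain x y where "e = {x, y}" "x \<noteq> y" "x \<in> insert a V" "y \<in> insert a V" by (rule all_edgesE)
    then show "e \<in> all_edges V \<union> (\<lambda>v. {a, v}) ` V" by (auto simp: insert_commute)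
  qed (use assms all_edges_mono[of V "insert a V"] in auto)
  show "all_edges V \<inter> (\<lambda>v. {a, v}) ` V = {}" using assms by auto
  show "inj_on (\<lambda>v. {a, v}) V" using assms by (auto simp: inj_on_def doubleton_eq_iff)
qed

lemma sum_all_edges_insert:
  assumes "finite V" "a \<notin> V"
  shows "sum f (all_edges (insert a V)) = sum f (all_edges V) + (\<Sum>v\<in>V. f {a, v})"
proof -
  have "sum f (all_edges (insert a V)) = sum f (all_edges V) + sum f ((\<lambda>v. {a, v}) ` V)"
    unfolding all_edges_insert(1)[OF assms(2)]
    using assms all_edges_insert(2)[OF assms(2)] by (intro sum.union_disjoint finite_all_edges) auto
  then show ?thesis using all_edges_insert(3)[OF assms(2)] by (simp add: sum.reindex)
qed

lemma sum_all_edges_prod: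
  fixes s :: "'a \<Rightarrow> real"
  assumes "finite V"
  shows "(\<Sum>e\<in>all_edges V. \<Prod>v\<in>e. s v) = ((\<Sum>v\<in>V. s v)\<^sup>2 - (\<Sum>v\<in>V. (s v)\<^sup>2)) / 2"
  using assms
proof (induction V rule: finite_induct)
  case empty then show ?case by (auto simp: all_edges_def)
next
  case (insert a V)
  have "(\<Sum>v\<in>V. \<Prod>v\<in>{a, v}. s v) = (\<Sum>v\<in>V. s a * s v)"
  proof (rule sum.cong)
    fix v assume "v \<in> V"
    then have "a \<noteq> v" using insert by auto
    then show "(\<Prod>v\<in>{a, v}. s v) = s a * s v" by simp
  qed simp
  then show ?case using insert
    by (simp add: sum_all_edges_insert power2_sum sum_distrib_left sum_distrib_right field_simps)
qed

lemma sum_all_edges_sum: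
  fixes s :: "'a \<Rightarrow> real"
  assumes "finite V"
  shows "(\<Sum>e\<in>all_edges V. \<Sum>v\<in>e. s v) = (real (card V) - 1) * (\<Sum>v\<in>V. s v)"
  using assms
proof (induction V rule: finite_induct)
  case empty then show ?case by (auto simp: all_edges_def)
next
  case (insert a V)
  have "(\<Sum>v\<in>V. \<Sum>v\<in>{a, v}. s v) = (\<Sum>v\<in>V. s a + s v)"
  proof (rule sum.cong)
    fix v assume "v \<in> V"
    then have "a \<noteq> v" using insert by auto
    then show "(\<Sum>v\<in>{a, v}. s v) = s a + s v" by simp
  qed simp
  then show ?case using insert
    by (simp add: sum_all_edges_insert sum.distrib algebra_simps)
qed

lemma card_all_edges:
  assumes "finite V"
  shows "real (card (all_edges V)) = real (card V) * (real (card V) - 1) / 2"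
  using sum_all_edges_prod[OF assms, of "\<lambda>_. 1"] by (simp add: power2_eq_square algebra_simps)

lemma sum_vdegree:
  fixes f :: "'a \<Rightarrow> real"
  assumes "finite V" "E \<subseteq> all_edges V"
  shows "(\<Sum>v\<in>V. f v * vdegree E v) = (\<Sum>e\<in>E. \<Sum>v\<in>e. f v)"
proof -
  have fE: "finite E" using assms finite_all_edges finite_subset by blast
  have "(\<Sum>v\<in>V. f v * vdegree E v) = (\<Sum>v\<in>V. \<Sum>e\<in>E. if v \<in> e then f v else 0)"
    unfolding vdegree_def using fE
    by (intro sum.cong) (auto simp: sum.If_cases Int_def)
  also have "\<dots> = (\<Sum>e\<in>E. \<Sum>v\<in>V. if v \<in> e then f v else 0)" by (rule sum.swap)
  also have "\<dots> = (\<Sum>e\<in>E. \<Sum>v\<in>e. f v)"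
  proof (rule sum.cong)
    fix e assume "e \<in> E"
    then have "e \<subseteq> V" using assms by (auto simp: all_edges_def)
    then have "V \<inter> e = e" by auto
    then show "(\<Sum>v\<in>V. if v \<in> e then f v else 0) = (\<Sum>v\<in>e. f v)"
      using assms by (simp add: sum.If_cases Int_def[symmetric] flip: Collect_conj_eq)
  qed simp
  finally show ?thesis .
qed

text \<open>For the sign classes A and B, e(A) + e(B) = (m + w) / 2, vol(A) + vol(B) = 2 m and
  vol(A) - vol(B) = D. Hence the squared volumes add up to (4 m^2 + D^2) / 2, whose main part
  cancels the m / 2 from the edge count.\<close>

lemma modularity_ge_signs:
  fixes s :: "'a \<Rightarrow> real"
  assumes V: "finite V" and E: "E \<subseteq> all_edges V" "E \<noteq> {}"
    and s: "\<And>v. v \<in> V \<Longrightarrow> s v = 1 \<or> s v = -1"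
  defines "w \<equiv> (\<Sum>e\<in>E. \<Prod>v\<in>e. s v)" and "D \<equiv> (\<Sum>e\<in>E. \<Sum>v\<in>e. s v)" and "m \<equiv> real (card E)"
  shows "w / (2 * m) - D\<^sup>2 / (8 * m\<^sup>2) \<le> modularity V E"
proof -
  have fE: "finite E" using assms finite_all_edges finite_subset by blast
  have m: "m > 0" using fE E by (simp add: m_def card_gt_0_iff)
  define A where "A = {v \<in> V. s v = 1}"
  define B where "B = {v \<in> V. s v = -1}"
  \<comment> \<open>All signs may agree, and a partition must not contain the empty set. Removing it
    is harmless because the summands vanish on it.\<close>
  define P where "P = {A, B} - {{}}"
  have AB: "A \<union> B = V" "A \<inter> B = {}" using s by (auto simp: A_def B_def)
  have P: "partition_on V P"
    unfolding partition_on_def P_def disjoint_def using AB by auto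
  have "V \<noteq> {}" using E by (auto simp: all_edges_def)
  then have ne: "A \<noteq> B" using AB by auto
  have sumP: "(\<Sum>C\<in>P. f C) = f A + f B" if "f {} = 0" for f :: "'a set \<Rightarrow> real"
  proof -
    have "(\<Sum>C\<in>P. f C) = (\<Sum>C\<in>{A, B}. f C)"
      unfolding P_def using that by (intro sum.mono_neutral_left) auto
    then show ?thesis using ne by simp
  qed
  have edge: "of_bool (e \<subseteq> A) + of_bool (e \<subseteq> B) = (1 + (\<Prod>v\<in>e. s v)) / 2" if "e \<in> E" for e
  proof -
    have "e \<in> all_edges V" using that E by auto
    then obtain a b where "e = {a, b}" "a \<noteq> b" "a \<in> V" "b \<in> V" by (rule all_edgesE)
    then show ?thesis using s[of a] s[of b] by (auto simp: A_def B_def)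
  qed
  have ew: "real (edges_within E C) = (\<Sum>e\<in>E. of_bool (e \<subseteq> C))" for C
    unfolding edges_within_def using fE by (simp add: Int_def)
  have "real (edges_within E A) + real (edges_within E B) = (\<Sum>e\<in>E. (1 + (\<Prod>v\<in>e. s v)) / 2)"
    unfolding ew sum.distrib[symmetric] using edge by (intro sum.cong) auto
  then have "real (edges_within E A) + real (edges_within E B) = (m + w) / 2"
    by (simp add: sum_divide_distrib[symmetric] sum.distrib w_def m_def)
  then have e: "(\<Sum>C\<in>P. real (edges_within E C)) = (m + w) / 2"
  proof (subst sumP)
    have "{e \<in> E. e \<subseteq> {}} = {}" using E by (auto simp: all_edges_def)
    then show "real (edges_within E {}) = 0" unfolding edges_within_def by simp
  qed
  have "(\<Sum>v\<in>V. g v) = (\<Sum>v\<in>A. g v) + (\<Sum>v\<in>B. g v)" for g :: "'a \<Rightarrow> real"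
  proof -
    have "finite A" "finite B" using V by (auto simp: A_def B_def)
    from sum.union_disjoint[OF this AB(2), of g] show ?thesis unfolding AB(1) .
  qed
  note split = this
  have "(\<Sum>v\<in>V. 1 * real (vdegree E v)) = (\<Sum>e\<in>E. \<Sum>v\<in>e. 1)"
    by (rule sum_vdegree[OF V E(1)])
  also have "\<dots> = (\<Sum>e\<in>E. 2)" using E by (intro sum.cong) (auto simp: all_edges_def)
  finally have v1: "real (vol E A) + real (vol E B) = 2 * m" 
    using split[of "vdegree E"] by (simp add: vol_def m_def)
  have "D = (\<Sum>v\<in>V. s v * real (vdegree E v))"
    unfolding D_def by (rule sum_vdegree[OF V E(1), symmetric])
  also have "\<dots> = real (vol E A) - real (vol E B)"
    using split[of "\<lambda>v. s v * vdegree E v"] by (simp add: vol_def A_def B_def sum_negf)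
  finally have v2: "D = real (vol E A) - real (vol E B)" .
  have "(\<Sum>C\<in>P. (real (vol E C))\<^sup>2) = (real (vol E A))\<^sup>2 + (real (vol E B))\<^sup>2"
    by (rule sumP) (simp add: vol_def)
  also have "\<dots> = ((real (vol E A) + real (vol E B))\<^sup>2 + D\<^sup>2) / 2"
    unfolding v2 by (simp add: power2_eq_square algebra_simps)
  finally have v: "(\<Sum>C\<in>P. (real (vol E C))\<^sup>2) = (4 * m\<^sup>2 + D\<^sup>2) / 2" by (simp add: v1)
  have "partition_modularity E P = w / (2 * m) - D\<^sup>2 / (8 * m\<^sup>2)"
    unfolding partition_modularity_def e v using m
    by (simp add: m_def[symmetric] field_simps power2_eq_square)
  moreover have "partition_modularity E P \<le> modularity V E"
    unfolding modularity_def using E P finite_nonempty_partition_modularity[OF V, of E]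
    by (auto intro!: Max_ge)
  ultimately show ?thesis by simp
qed

lemma sum_centered:
  fixes c :: "'a set \<Rightarrow> real"
  assumes "finite V" "X \<subseteq> all_edges V"
  shows "(\<Sum>e\<in>all_edges V. c e * (of_bool (e \<in> X) - p)) = (\<Sum>e\<in>X. c e) - p * (\<Sum>e\<in>all_edges V. c e)"
proof -
  have "(\<Sum>e\<in>all_edges V. c e * of_bool (e \<in> X)) = (\<Sum>e\<in>X. c e)"
    using assms finite_all_edges[OF assms(1)]
    by (simp add: of_bool_def sum.If_cases mult.commute if_distrib Int_absorb1 cong: if_cong)
  then show ?thesis by (simp add: algebra_simps sum_subtractf sum_distrib_left)
qed

text \<open>Centring splits each form into a fluctuation, \<open>W\<close> or \<open>b\<close>, and
  a part that depends on the signs only through \<open>\<sigma>\<close>. The deficit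
  \<open>- p * n\<close> is the diagonal of the squared sum of signs.\<close>

lemma modularity_ge_centered:
  fixes s :: "'a \<Rightarrow> real" and p :: real
  assumes V: "finite V" and X: "X \<subseteq> all_edges V" "X \<noteq> {}"
    and s: "\<And>v. v \<in> V \<Longrightarrow> s v = 1 \<or> s v = -1"
  defines "W \<equiv> (\<Sum>e\<in>all_edges V. (\<Prod>v\<in>e. s v) * (of_bool (e \<in> X) - p))"
    and "b \<equiv> (\<Sum>e\<in>all_edges V. (\<Sum>v\<in>e. s v) * (of_bool (e \<in> X) - p))"
    and "m \<equiv> real (card X)" and "n \<equiv> real (card V)" and "\<sigma> \<equiv> (\<Sum>v\<in>V. s v)"
  shows "(2 * W + p * (\<sigma>\<^sup>2 - n) - (b + p * (n - 1) * \<sigma>)\<^sup>2 / (2 * m)) / (4 * m) \<le> modularity V X"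
proof -
  have fA: "finite (all_edges V)" using V finite_all_edges by blast
  then have "m > 0" using X finite_subset by (auto simp: m_def card_gt_0_iff)
  note r = sum_centered[OF V X(1)]
  have "(\<Sum>v\<in>V. (s v)\<^sup>2) = (\<Sum>v\<in>V. 1)"
  proof (rule sum.cong)
    fix v assume "v \<in> V"
    then show "(s v)\<^sup>2 = 1" using s[of v] by auto
  qed simp
  then have w: "(\<Sum>e\<in>X. \<Prod>v\<in>e. s v) = W + p * (\<sigma>\<^sup>2 - n) / 2"
    unfolding W_def r sum_all_edges_prod[OF V] by (simp add: \<sigma>_def n_def)
  have d: "(\<Sum>e\<in>X. \<Sum>v\<in>e. s v) = b + p * (n - 1) * \<sigma>"
    unfolding b_def r sum_all_edges_sum[OF V] by (simp add: \<sigma>_def n_def)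
  have "(2 * W + p * (\<sigma>\<^sup>2 - n) - (b + p * (n - 1) * \<sigma>)\<^sup>2 / (2 * m)) / (4 * m)
     = (W + p * (\<sigma>\<^sup>2 - n) / 2) / (2 * m) - (b + p * (n - 1) * \<sigma>)\<^sup>2 / (8 * m\<^sup>2)"
    using \<open>m > 0\<close> by (simp add: field_simps power2_eq_square)
  also have "\<dots> \<le> modularity V X"
    using modularity_ge_signs[OF V X, of s] s unfolding w d m_def by blast
  finally show ?thesis .
qed

section \<open>Lazy random walk\<close>

definition walk_step :: "real \<Rightarrow> (real \<Rightarrow> real) \<Rightarrow> real \<Rightarrow> real" where
  "walk_step r f z = (1 - r) * f z + r / 2 * (f (z + 1) + f (z - 1))"

text \<open>\<open>walk r N f z\<close> is the expectation of \<open>f\<close> at the end of an \<open>N\<close>-step random walk started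
  at \<open>z\<close>, each step of which is \<open>1\<close> or \<open>-1\<close> with probability \<open>r / 2\<close> each.\<close>

definition walk :: "real \<Rightarrow> nat \<Rightarrow> (real \<Rightarrow> real) \<Rightarrow> real \<Rightarrow> real" where
  "walk r N = walk_step r ^^ N"

lemma walk_0 [simp]: "walk r 0 f = f"
  by (simp add: walk_def)

lemma walk_Suc: "walk r (Suc N) f = walk_step r (walk r N f)"
  by (simp add: walk_def)

text \<open>Here the last step is split off and acts on the test function, whereas
  \<open>walk_Suc\<close> splits off the first. This is the form for recursions in the number of
  steps with a fixed starting point.\<close>

lemma walk_Suc': "walk r (Suc N) f = walk r N (walk_step r f)"
  by (simp add: walk_def funpow_Suc_right del: funpow.simps)

lemma walk_mono:
  assumes "0 \<le> r" "r \<le> 1" "\<And>z. f z \<le> g z"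
  shows "walk r N f z \<le> walk r N g z"
  using assms(3)
proof (induction N arbitrary: f g z)
  case (Suc N)
  have "walk_step r f z \<le> walk_step r g z" for z
    unfolding walk_step_def using assms Suc.prems by (intro add_mono mult_left_mono) auto
  then show ?case unfolding walk_Suc' by (intro Suc.IH)
qed simp

lemma walk_linear: "walk r N (\<lambda>z. a * f z + b * g z) z = a * walk r N f z + b * walk r N g z"
  by (induction N arbitrary: z) (simp_all add: walk_Suc walk_step_def algebra_simps)

lemma walk_const: "walk r N (\<lambda>_. c) z = c"
  by (induction N arbitrary: z) (simp_all add: walk_Suc walk_step_def algebra_simps)

lemma walk_square: "walk r N (\<lambda>z. z\<^sup>2) z = z\<^sup>2 + N * r"
  by (induction N arbitrary: z) (simp_all add: walk_Suc walk_step_def power2_eq_square algebra_simps)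

lemma walk_fourth: "walk r N (\<lambda>z. z ^ 4) z = z ^ 4 + N * r * (6 * z\<^sup>2 + 1) + 3 * N * (real N - 1) * r\<^sup>2"
proof (induction N arbitrary: z)
  case (Suc N)
  show ?case unfolding walk_Suc walk_step_def Suc.IH
    by (simp add: power2_eq_square power4_eq_xxxx field_simps)
qed simp

text \<open>With y = |x| / t this is y (y - 1)^2 (y + 2) >= 0. The polynomial touches |x| at |x| = t
  and turns a second moment and a bound on the fourth into a lower bound for the first absolute
  moment.\<close>

lemma abs_ge_fourth:
  fixes x t :: real
  assumes "t > 0"
  shows "(3 * x\<^sup>2 / t - x ^ 4 / t ^ 3) / 2 \<le> \<bar>x\<bar>"
proof -
  define y where "y = \<bar>x\<bar> / t"
  have y: "y \<ge> 0" "x\<^sup>2 = t\<^sup>2 * y\<^sup>2" "x ^ 4 = t ^ 4 * y ^ 4"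
    using assms by (auto simp: y_def power_divide power_even_abs)
  have "0 \<le> y * ((y - 1)\<^sup>2 * (y + 2))" using y by (intro mult_nonneg_nonneg) auto
  also have "\<dots> = y ^ 4 - 3 * y\<^sup>2 + 2 * y" by (simp add: power2_eq_square power4_eq_xxxx algebra_simps)
  finally have "(3 * y\<^sup>2 - y ^ 4) / 2 \<le> y" by simp
  then have "t * ((3 * y\<^sup>2 - y ^ 4) / 2) \<le> t * y" using assms by (intro mult_left_mono) auto
  also have "t * y = \<bar>x\<bar>" using assms by (simp add: y_def)
  also have "t * ((3 * y\<^sup>2 - y ^ 4) / 2) = (3 * x\<^sup>2 / t - x ^ 4 / t ^ 3) / 2"
    unfolding y using assms by (simp add: field_simps power2_eq_square power3_eq_cube power4_eq_xxxx)
  finally show ?thesis .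
qed

text \<open>Fourth moment method. Variance at least 1/4 makes the fourth moment, at most
  \<open>V + 3 * V\<^sup>2\<close>, at most \<open>7 * V\<^sup>2\<close>, which is the origin of the
  7.\<close>

lemma walk_abs_ge_sqrt:
  assumes "0 \<le> r" "r \<le> 1" "N * r \<ge> 1 / 4"
  shows "sqrt (N * r / 7) \<le> walk r N abs 0"
proof -
  define V where "V = N * r"
  \<comment> \<open>This value maximises \<open>(3 * V / t - 7 * V\<^sup>2 / t ^ 3) / 2\<close>; the
    maximum is \<open>V / t\<close>.\<close>
  define t where "t = sqrt (7 * V)"
  have V: "V \<ge> 1 / 4" using assms by (simp add: V_def)
  have t: "t > 0" "t\<^sup>2 = 7 * V" using V by (simp_all add: t_def)
  have "walk r N (\<lambda>z. z ^ 4) 0 \<le> V + 3 * V\<^sup>2"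
    unfolding walk_fourth using assms by (simp add: V_def power2_eq_square algebra_simps)
  also have "\<dots> \<le> 7 * V\<^sup>2" using V by (simp add: power2_eq_square)
  finally have 4: "walk r N (\<lambda>z. z ^ 4) 0 \<le> 7 * V\<^sup>2" .
  have "sqrt (V / 7) = V / t"
  proof (rule real_sqrt_unique)
    show "(V / t)\<^sup>2 = V / 7" using V by (simp add: power_divide t) (simp add: power2_eq_square)
  qed (use V t in auto)
  also have "V / t = 3 / (2 * t) * V + (- 1 / (2 * t ^ 3)) * (7 * V\<^sup>2)"
  proof -
    have "t ^ 3 = t * (7 * V)" using t by (simp add: power3_eq_cube power2_eq_square)
    then show ?thesis using V t(1) by (simp add: field_simps power2_eq_square)
  qed
  also have "\<dots> \<le> 3 / (2 * t) * walk r N (\<lambda>z. z\<^sup>2) 0 + (- 1 / (2 * t ^ 3)) * walk r N (\<lambda>z. z ^ 4) 0"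
    using 4 t by (intro add_mono mult_left_mono mult_left_mono_neg) (auto simp: walk_square V_def)
  also have "\<dots> = walk r N (\<lambda>z. 3 / (2 * t) * z\<^sup>2 + (- 1 / (2 * t ^ 3)) * z ^ 4) 0"
    by (rule walk_linear[symmetric])
  also have "\<dots> \<le> walk r N abs 0"
  proof (intro walk_mono assms)
    fix z :: real
    have "3 / (2 * t) * z\<^sup>2 + (- 1 / (2 * t ^ 3)) * z ^ 4 = (3 * z\<^sup>2 / t - z ^ 4 / t ^ 3) / 2"
      using t(1) by (simp add: field_simps)
    then show "3 / (2 * t) * z\<^sup>2 + (- 1 / (2 * t ^ 3)) * z ^ 4 \<le> \<bar>z\<bar>"
      using abs_ge_fourth[OF t(1), of z] by (simp only:)
  qed
  finally show ?thesis by (simp add: V_def)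
qed

text \<open>Count trajectories: 1 or -1 is reached by a single move, and 0 by no move or by two
  opposite ones. Using the factor \<open>(1 - r) ^ N\<close> instead of one power fewer per move
  only loses, and it suits the coupled recursion of the two probabilities.\<close>

lemma walk_return_ge:
  assumes "0 \<le> r" "r \<le> 1"
  shows "N * r * (1 - r) ^ N \<le> walk r N (\<lambda>z. of_bool (\<bar>z\<bar> = 1)) 0"
    and "(1 - r) ^ N * (1 + N * (real N - 1) * r\<^sup>2 / 4) \<le> walk r N (\<lambda>z. of_bool (z = 0)) 0"
proof -
  let ?a = "\<lambda>N. walk r N (\<lambda>z. of_bool (z = 0)) 0"
  let ?b = "\<lambda>N. walk r N (\<lambda>z. of_bool (\<bar>z\<bar> = 1)) 0"
  have a: "?a (Suc N) = (1 - r) * ?a N + r / 2 * ?b N" for N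
  proof -
    have "walk_step r (\<lambda>z. of_bool (z = 0)) = (\<lambda>z. (1 - r) * of_bool (z = 0) + r / 2 * of_bool (\<bar>z\<bar> = 1))"
      by (auto simp: walk_step_def fun_eq_iff)
    then show ?thesis unfolding walk_Suc' by (simp only: walk_linear)
  qed
  have b: "?b (Suc N) \<ge> (1 - r) * ?b N + r * ?a N" for N
    unfolding walk_Suc' walk_linear[symmetric]
    using assms by (intro walk_mono) (auto simp: walk_step_def)
  have nn: "?b N \<ge> 0" "?a N \<ge> 0" for N
    using walk_mono[OF assms, of "\<lambda>_. 0" "\<lambda>z. of_bool (\<bar>z\<bar> = 1)" N 0]
      walk_mono[OF assms, of "\<lambda>_. 0" "\<lambda>z. of_bool (z = 0)" N 0] by (auto simp: walk_const)
  have a1: "(1 - r) ^ N \<le> ?a N" for N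
  proof (induction N)
    case (Suc N)
    have "(1 - r) * (1 - r) ^ N \<le> (1 - r) * ?a N" using Suc assms by (intro mult_left_mono) auto
    moreover have "0 \<le> r / 2 * ?b N" using assms nn by auto
    ultimately show ?case unfolding a by simp
  qed simp
  have b1: "N * r * (1 - r) ^ N \<le> ?b N" for N
  proof (induction N)
    case (Suc N)
    have "(1 - r) * (N * r * (1 - r) ^ N) \<le> (1 - r) * ?b N" using Suc assms by (intro mult_left_mono) auto
    moreover have "r * (1 - r) ^ N \<le> r * ?a N" using assms a1 by (intro mult_left_mono) auto
    moreover have "r * ((1 - r) * (1 - r) ^ N) \<le> r * (1 * (1 - r) ^ N)"
      using assms by (intro mult_left_mono mult_right_mono) auto
    ultimately show ?case using b[of N] by (simp add: algebra_simps)
  qed (simp add: nn)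
  then show "N * r * (1 - r) ^ N \<le> ?b N" .
  show "(1 - r) ^ N * (1 + N * (real N - 1) * r\<^sup>2 / 4) \<le> ?a N"
  proof (induction N)
    case (Suc N)
    have "(1 - r) * ((1 - r) ^ N * (1 + N * (real N - 1) * r\<^sup>2 / 4)) \<le> (1 - r) * ?a N"
      using Suc assms by (intro mult_left_mono) auto
    moreover have "r / 2 * (N * r * (1 - r) ^ N) \<le> r / 2 * ?b N" using assms b1 by (intro mult_left_mono) auto
    moreover have "r * r * (N * ((1 - r) * (1 - r) ^ N)) \<le> r * r * (N * (1 * (1 - r) ^ N))"
      using assms by (intro mult_left_mono mult_right_mono) auto
    moreover have "(1 - r) ^ Suc N * (1 + Suc N * (real (Suc N) - 1) * r\<^sup>2 / 4)
      = (1 - r) * ((1 - r) ^ N * (1 + N * (real N - 1) * r\<^sup>2 / 4)) + r * r * (N * ((1 - r) * (1 - r) ^ N)) / 2"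
      by (simp add: field_simps power2_eq_square)
    moreover have "r * r * (N * (1 * (1 - r) ^ N)) / 2 = r / 2 * (N * r * (1 - r) ^ N)" by simp
    ultimately show ?case unfolding a by linarith
  qed simp
qed

text \<open>One step increases the expected absolute value by \<open>r\<close> times the probability of being at \<open>0\<close>.
  The bound approximates the integral over \<open>{0..y N}\<close> of \<open>exp (- t) * (1 + t\<^sup>2 / 4)\<close>, where
  \<open>1 + t\<^sup>2 / 4\<close> accounts for returns with zero or two moves; the integral exceeds \<open>1\<close> for \<open>y N = 2\<close>.\<close>

lemma walk_abs_ge:
  assumes "0 \<le> r" "r \<le> 1"
  defines "y \<equiv> \<lambda>N. real N * r"
  shows "3 / 2 - (1 - r) ^ N * (3 / 2 + y N / 2 + (y N)\<^sup>2 / 4) - y N * r * (2 + 3 * y N) / 4 \<le> walk r N abs 0"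
proof (induction N)
  case 0 then show ?case by (simp add: y_def)
next
  case (Suc N)
  define u where "u = (1 - r) ^ N"
  have u: "0 \<le> u" "u \<le> 1" using assms by (auto simp: u_def power_le_one)
  have "walk r N abs 0 + r * walk r N (\<lambda>z. of_bool (z = 0)) 0 = walk r N (\<lambda>z. 1 * \<bar>z\<bar> + r * of_bool (z = 0)) 0"
    unfolding walk_linear by simp
  also have "\<dots> \<le> walk r (Suc N) abs 0"
    unfolding walk_Suc'
  proof (intro walk_mono assms)
    fix z :: real
    have "r / 2 * (2 * \<bar>z\<bar>) \<le> r / 2 * (\<bar>z + 1\<bar> + \<bar>z - 1\<bar>)" using assms by (intro mult_left_mono) auto
    then show "1 * \<bar>z\<bar> + r * of_bool (z = 0) \<le> walk_step r abs z" by (auto simp: walk_step_def algebra_simps)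
  qed
  finally have 1: "walk r N abs 0 + r * walk r N (\<lambda>z. of_bool (z = 0)) 0 \<le> walk r (Suc N) abs 0" .
  have 2: "r * (u * (1 + N * (real N - 1) * r\<^sup>2 / 4)) \<le> r * walk r N (\<lambda>z. of_bool (z = 0)) 0"
    using walk_return_ge(2)[OF assms(1,2)] assms unfolding u_def by (intro mult_left_mono) auto
  have y: "y (Suc N) = y N + r" "N * (real N - 1) * r\<^sup>2 = (y N)\<^sup>2 - y N * r" "y N \<ge> 0"
    using assms by (auto simp: y_def algebra_simps power2_eq_square)
  \<comment> \<open>Discretisation error of one step. The increment of the last summand of the claim
    dominates it, since \<open>u\<close> is at most 1.\<close>
  have "u * (r * r * (1 + r + 3 * y N) / 4) \<le> 1 * (r * r * (1 + r + 3 * y N) / 4)"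
    using u y assms by (intro mult_right_mono) auto
  also have "\<dots> \<le> y (Suc N) * r * (2 + 3 * y (Suc N)) / 4 - y N * r * (2 + 3 * y N) / 4"
  proof -
    have "0 \<le> r * r * (1 + 2 * r + 3 * y N) / 4" using y assms(1) by simp
    also have "\<dots> = y (Suc N) * r * (2 + 3 * y (Suc N)) / 4 - y N * r * (2 + 3 * y N) / 4
       - 1 * (r * r * (1 + r + 3 * y N) / 4)"
      unfolding y(1) by (simp add: field_simps)
    finally show ?thesis by simp
  qed
  finally have 3: "u * (r * r * (1 + r + 3 * y N) / 4) \<le>
     y (Suc N) * r * (2 + 3 * y (Suc N)) / 4 - y N * r * (2 + 3 * y N) / 4" .
  have "(3 / 2 - (1 - r) ^ Suc N * (3 / 2 + y (Suc N) / 2 + (y (Suc N))\<^sup>2 / 4))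
      - (3 / 2 - u * (3 / 2 + y N / 2 + (y N)\<^sup>2 / 4))
      = r * (u * (1 + N * (real N - 1) * r\<^sup>2 / 4)) + u * (r * r * (1 + r + 3 * y N) / 4)"
    unfolding y(1,2) u_def by (simp add: power2_eq_square field_simps)
  then show ?case using Suc.IH 1 2 3 by (simp add: u_def)
qed

section \<open>Subcritical random graphs\<close>

definition adj :: "'a set \<Rightarrow> 'a set set \<Rightarrow> ('a \<times> 'a) set" where
  "adj U X = {(u, v). u \<in> U \<and> v \<in> U \<and> {u, v} \<in> X}"

definition reach :: "'a set \<Rightarrow> 'a set set \<Rightarrow> 'a \<Rightarrow> 'a \<Rightarrow> bool" where
  "reach U X u v \<longleftrightarrow> (u, v) \<in> (adj U X)\<^sup>*"

lemma reach_refl [simp]: "reach U X u u"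
  by (simp add: reach_def)

lemma reach_trans: "reach U X u v \<Longrightarrow> reach U X v w \<Longrightarrow> reach U X u w"
  by (simp add: reach_def)

lemma reach_sym: "reach U X u v \<Longrightarrow> reach U X v u"
proof -
  have "sym (adj U X)" by (auto simp: sym_def adj_def insert_commute)
  then show "reach U X u v \<Longrightarrow> reach U X v u" unfolding reach_def by (meson sym_rtrancl symD)
qed

lemma reach_mono: "X \<subseteq> Y \<Longrightarrow> reach U X u v \<Longrightarrow> reach U Y u v"
  unfolding reach_def by (rule set_mp[OF rtrancl_mono]) (auto simp: adj_def)

lemma reach_edge: "{u, v} \<in> X \<Longrightarrow> u \<in> U \<Longrightarrow> v \<in> U \<Longrightarrow> reach U X u v"
  unfolding reach_def by (auto simp: adj_def)

text \<open>Connections inside \<open>U\<close> are read off the edges inside \<open>U\<close>,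
  hence are independent of the edges at other vertices. No edge is a singleton, so
  \<open>adj\<close> has no loops.\<close>

lemma reach_restrict:
  assumes "X \<subseteq> all_edges V"
  shows "reach U (X \<inter> all_edges U) = reach U X"
proof -
  have "{u} \<notin> X" for u using assms by (auto simp: all_edges_def)
  then have "adj U (X \<inter> all_edges U) = adj U X" by (auto simp: adj_def)
  then show ?thesis by (simp add: reach_def fun_eq_iff)
qed

text \<open>Decomposition at the last visit to \<open>u\<close>.\<close>

lemma reach_first_step:
  assumes "reach U X u v" "u \<noteq> v"
  shows "\<exists>w\<in>U - {u}. {u, w} \<in> X \<and> reach (U - {u}) X w v"
proof -
  have "u \<noteq> v \<longrightarrow> (\<exists>w\<in>U - {u}. {u, w} \<in> X \<and> reach (U - {u}) X w v)"
    using assms(1) unfolding reach_def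
  proof (induction rule: rtrancl_induct)
    case (step y z)
    show ?case
    proof (intro impI)
      assume "u \<noteq> z"
      have yz: "y \<in> U" "z \<in> U" "{y, z} \<in> X" using step(2) by (auto simp: adj_def)
      show "\<exists>w\<in>U - {u}. {u, w} \<in> X \<and> (w, z) \<in> (adj (U - {u}) X)\<^sup>*"
      proof (cases "y = u")
        case True
        then show ?thesis using yz \<open>u \<noteq> z\<close> by (intro bexI[of _ z]) auto
      next
        case False
        then obtain w where w: "w \<in> U - {u}" "{u, w} \<in> X" "(w, y) \<in> (adj (U - {u}) X)\<^sup>*"
          using step.IH by auto
        have "(y, z) \<in> adj (U - {u}) X" using yz False \<open>u \<noteq> z\<close> by (auto simp: adj_def)
        then show ?thesis using w by (meson rtrancl.rtrancl_into_rtrancl)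
      qed
    qed
  qed simp
  then show ?thesis using assms(2) by simp
qed

definition conn_prob :: "real \<Rightarrow> 'a set \<Rightarrow> 'a \<Rightarrow> 'a \<Rightarrow> real" where
  "conn_prob q U u v = EE q (all_edges U) (\<lambda>X. of_bool (reach U X u v))"

text \<open>Union bound over the vertex \<open>w\<close> that follows the last visit to
  \<open>u\<close>. The rest of the path avoids \<open>u\<close> and is therefore independent of the
  edge \<open>{u, w}\<close>; deleting \<open>u\<close> takes the place of counting paths.\<close>

lemma conn_prob_step:
  assumes "finite U" "u \<in> U" "u \<noteq> v" "0 \<le> q" "q \<le> 1"
  shows "conn_prob q U u v \<le> q * (\<Sum>w\<in>U - {u}. conn_prob q (U - {u}) w v)"
proof -
  let ?B = "all_edges (U - {u})"
  let ?G = "\<lambda>w Y. of_bool (reach (U - {u}) Y w v) :: real"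
  have fin: "finite (all_edges U)" using assms finite_all_edges by blast
  have "conn_prob q U u v \<le> EE q (all_edges U) (\<lambda>X. \<Sum>w\<in>U - {u}. of_bool ({u, w} \<in> X) * ?G w (X \<inter> ?B))"
    unfolding conn_prob_def
  proof (rule EE_mono[OF assms(4,5)])
    fix X assume X: "X \<subseteq> all_edges U"
    show "of_bool (reach U X u v) \<le> (\<Sum>w\<in>U - {u}. of_bool ({u, w} \<in> X) * ?G w (X \<inter> ?B))"
    proof (cases "reach U X u v")
      case True
      then obtain w where w: "w \<in> U - {u}" "{u, w} \<in> X" "reach (U - {u}) X w v"
        using reach_first_step assms(3) by metis
      have "(1::real) = of_bool ({u, w} \<in> X) * ?G w (X \<inter> ?B)"
        using w reach_restrict[OF X] by simp
      also have "\<dots> \<le> (\<Sum>w\<in>U - {u}. of_bool ({u, w} \<in> X) * ?G w (X \<inter> ?B))"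
        using assms(1) w(1) by (intro member_le_sum) auto
      finally show ?thesis by simp
    qed (auto intro!: sum_nonneg)
  qed
  also have "\<dots> = (\<Sum>w\<in>U - {u}. q * EE q ?B (?G w))"
    unfolding EE_sum using fin assms(2) by (intro sum.cong EE_edge_indep) (auto intro: all_edges_mono[THEN subsetD])
  finally show ?thesis by (simp add: conn_prob_def sum_distrib_left)
qed

lemma conn_prob_le_1:
  assumes "finite U" "0 \<le> q" "q \<le> 1"
  shows "conn_prob q U u v \<le> 1"
proof -
  have "conn_prob q U u v \<le> EE q (all_edges U) (\<lambda>_. 1)"
    unfolding conn_prob_def using assms by (intro EE_mono) auto
  then show ?thesis using assms by (simp add: EE_const finite_all_edges)
qed

text \<open>Iterating \<open>conn_prob_step\<close> gives a geometric series with ratio \<theta>.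
  The bound is the fixed point of t = 1 + \<theta> t, which closes the induction over the vertex
  set.\<close>

lemma sum_conn_prob:
  fixes q \<theta> :: real
  assumes "finite U" "u \<in> U" "0 \<le> q" "q \<le> 1" "q * card U \<le> \<theta>" "\<theta> < 1"
  shows "(\<Sum>v\<in>U. conn_prob q U u v) \<le> 1 / (1 - \<theta>)"
  using assms(1,2,5)
proof (induction U arbitrary: u rule: finite_psubset_induct)
  case (psubset U)
  let ?U = "U - {u}"
  have fin: "finite ?U" using psubset by auto
  have qU: "q * card ?U \<le> \<theta>"
  proof -
    have "real (card ?U) \<le> real (card U)" using psubset by (simp add: card_mono)
    then have "q * card ?U \<le> q * card U" using assms by (intro mult_left_mono) auto
    then show ?thesis using psubset by simp
  qed
  have "(\<Sum>v\<in>U. conn_prob q U u v) = conn_prob q U u u + (\<Sum>v\<in>?U. conn_prob q U u v)"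
    using psubset by (simp add: sum.remove)
  also have "\<dots> \<le> 1 + (\<Sum>v\<in>?U. q * (\<Sum>w\<in>?U. conn_prob q ?U w v))"
    using psubset assms by (intro add_mono sum_mono conn_prob_step conn_prob_le_1) auto
  also have "\<dots> = 1 + q * (\<Sum>w\<in>?U. \<Sum>v\<in>?U. conn_prob q ?U w v)"
    by (simp add: sum_distrib_left[symmetric]) (rule disjI2, rule sum.swap)
  also have "\<dots> \<le> 1 + q * (\<Sum>w\<in>?U. 1 / (1 - \<theta>))"
    using psubset assms qU by (intro add_left_mono mult_left_mono sum_mono psubset.IH) auto
  also have "\<dots> = 1 + (q * card ?U) / (1 - \<theta>)" by simp
  also have "\<dots> \<le> 1 + \<theta> / (1 - \<theta>)"
    using qU assms by (intro add_left_mono divide_right_mono) auto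
  also have "\<dots> = 1 / (1 - \<theta>)" using assms by (simp add: field_simps)
  finally show ?case .
qed

section \<open>Component sizes, bridges and two-colourings\<close>

definition conn_pairs :: "'a set \<Rightarrow> 'a set set \<Rightarrow> ('a \<times> 'a) set" where
  "conn_pairs U X = {(u, v) \<in> U \<times> U. reach U X u v}"

text \<open>The edges that are not bridges. If there are none, the graph is a forest; speaking of
  bridges avoids choosing a spanning forest.\<close>

definition cycle_edges :: "'a set \<Rightarrow> 'a set set \<Rightarrow> 'a set set" where
  "cycle_edges U X = {e \<in> X. \<exists>u v. e = {u, v} \<and> reach U (X - {e}) u v}"

text \<open>The number of connected pairs is the sum of the squared component sizes. It will bound
  the imbalance of the two-colouring.\<close>

lemma EE_conn_pairs:
  fixes q \<theta> :: real
  assumes "finite U" "0 \<le> q" "q \<le> 1" "q * card U \<le> \<theta>" "\<theta> < 1"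
  shows "EE q (all_edges U) (\<lambda>X. card (conn_pairs U X)) \<le> card U / (1 - \<theta>)"
proof -
  have "real (card (conn_pairs U X)) = (\<Sum>u\<in>U. \<Sum>v\<in>U. of_bool (reach U X u v))" for X
  proof -
    have "(\<Sum>u\<in>U. \<Sum>v\<in>U. of_bool (reach U X u v)) = (\<Sum>z\<in>U \<times> U. of_bool (reach U X (fst z) (snd z)) :: real)"
      by (simp add: sum.cartesian_product split_def)
    also have "\<dots> = card (U \<times> U \<inter> {z. reach U X (fst z) (snd z)})"
      using assms by simp
    also have "U \<times> U \<inter> {z. reach U X (fst z) (snd z)} = conn_pairs U X"
      by (auto simp: conn_pairs_def)
    finally show ?thesis by simp
  qed
  then have "EE q (all_edges U) (\<lambda>X. card (conn_pairs U X)) = (\<Sum>u\<in>U. \<Sum>v\<in>U. conn_prob q U u v)"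
    by (simp add: EE_sum conn_prob_def)
  also have "\<dots> \<le> (\<Sum>u\<in>U. 1 / (1 - \<theta>))" using assms by (intro sum_mono sum_conn_prob)
  finally show ?thesis by simp
qed

text \<open>An edge is independent of the graph without it, so it costs an extra factor
  \<open>q\<close> on top of the connection probability. The mean is therefore bounded independently
  of the number of vertices.\<close>

lemma EE_cycle_edges:
  fixes q \<theta> :: real
  assumes "finite U" "0 \<le> q" "q \<le> 1" "q * card U \<le> \<theta>" "\<theta> < 1"
  shows "EE q (all_edges U) (\<lambda>X. card (cycle_edges U X)) \<le> \<theta> / (1 - \<theta>)"
proof -
  let ?A = "all_edges U"
  let ?G = "\<lambda>u v Y. of_bool (reach U Y u v) :: real"
  have fin: "finite ?A" using assms finite_all_edges by blast
  have "EE q ?A (\<lambda>X. card (cycle_edges U X)) \<le>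
      EE q ?A (\<lambda>X. \<Sum>u\<in>U. \<Sum>v\<in>U - {u}. of_bool ({u, v} \<in> X) * ?G u v (X \<inter> (?A - {{u, v}})))"
  proof (rule EE_mono[OF assms(2,3)])
    fix X assume X: "X \<subseteq> ?A"
    \<comment> \<open>Ordered pairs index each edge twice, which is harmless for an upper
      bound.\<close>
    let ?I = "SIGMA u:U. U - {u}"
    define P where "P = {z \<in> ?I. {fst z, snd z} \<in> X \<and> reach U (X - {{fst z, snd z}}) (fst z) (snd z)}"
    have fI: "finite ?I" using assms by auto
    have "cycle_edges U X \<subseteq> (\<lambda>z. {fst z, snd z}) ` P"
    proof
      fix e assume "e \<in> cycle_edges U X"
      then obtain u v where e: "e \<in> X" "e = {u, v}" "reach U (X - {e}) u v"
        unfolding cycle_edges_def by auto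
      have "e \<in> ?A" using X e(1) by blast
      then have "{u, v} \<in> ?A" using e(2) by (simp only:)
      then have "u \<noteq> v" "u \<in> U" "v \<in> U" unfolding all_edges_doubleton by auto
      then have "(u, v) \<in> P" unfolding P_def using e by auto
      then show "e \<in> (\<lambda>z. {fst z, snd z}) ` P" using e(2) by force
    qed
    then have "card (cycle_edges U X) \<le> card P"
      using fI by (intro surj_card_le) (auto simp: P_def)
    then have "real (card (cycle_edges U X)) \<le> real (card P)" by simp
    also have "\<dots> = (\<Sum>z\<in>?I. of_bool ({fst z, snd z} \<in> X \<and> reach U (X - {{fst z, snd z}}) (fst z) (snd z)))"
      using fI by (simp add: P_def Int_def)
    also have "\<dots> = (\<Sum>u\<in>U. \<Sum>v\<in>U - {u}. of_bool ({u, v} \<in> X \<and> reach U (X - {{u, v}}) u v))"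
      using assms(1) by (subst sum.Sigma) (auto simp: case_prod_beta)
    also have "\<dots> = (\<Sum>u\<in>U. \<Sum>v\<in>U - {u}. of_bool ({u, v} \<in> X) * ?G u v (X \<inter> (?A - {{u, v}})))"
    proof (intro sum.cong refl)
      fix u v
      have "X \<inter> (?A - {{u, v}}) = X - {{u, v}}" using X by auto
      then show "of_bool ({u, v} \<in> X \<and> reach U (X - {{u, v}}) u v)
        = of_bool ({u, v} \<in> X) * ?G u v (X \<inter> (?A - {{u, v}}))" by simp
    qed
    finally show "real (card (cycle_edges U X)) \<le>
      (\<Sum>u\<in>U. \<Sum>v\<in>U - {u}. of_bool ({u, v} \<in> X) * ?G u v (X \<inter> (?A - {{u, v}})))" .
  qed
  also have "\<dots> = (\<Sum>u\<in>U. \<Sum>v\<in>U - {u}. q * EE q (?A - {{u, v}}) (?G u v))"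
    unfolding EE_sum using fin by (intro sum.cong EE_edge_indep refl) auto
  also have "\<dots> \<le> (\<Sum>u\<in>U. \<Sum>v\<in>U - {u}. q * conn_prob q U u v)"
  proof (intro sum_mono mult_left_mono assms)
    fix u v
    have "EE q (?A - {{u, v}}) (?G u v) = EE q ?A (\<lambda>X. ?G u v (X \<inter> (?A - {{u, v}})))"
      using fin by (intro EE_restrict[symmetric]) auto
    also have "\<dots> \<le> conn_prob q U u v"
      unfolding conn_prob_def
    proof (rule EE_mono[OF assms(2,3)])
      fix X
      show "?G u v (X \<inter> (?A - {{u, v}})) \<le> ?G u v X"
        using reach_mono[of "X \<inter> (?A - {{u, v}})" X U u v] by auto
    qed
    finally show "EE q (?A - {{u, v}}) (?G u v) \<le> conn_prob q U u v" .
  qed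
  also have "\<dots> \<le> (\<Sum>u\<in>U. q * (1 / (1 - \<theta>)))"
  proof (intro sum_mono)
    fix u assume u: "u \<in> U"
    have "0 \<le> conn_prob q U u u"
      using EE_mono[OF assms(2,3), of ?A "\<lambda>_. 0"] fin by (simp add: conn_prob_def EE_const)
    then have "(\<Sum>v\<in>U - {u}. conn_prob q U u v) \<le> (\<Sum>v\<in>U. conn_prob q U u v)"
      using assms u by (simp add: sum.remove)
    also have "\<dots> \<le> 1 / (1 - \<theta>)" using assms u by (intro sum_conn_prob) auto
    finally show "(\<Sum>v\<in>U - {u}. q * conn_prob q U u v) \<le> q * (1 / (1 - \<theta>))"
      using assms by (simp only: sum_distrib_left[symmetric]) (intro mult_left_mono, auto)
  qed
  also have "\<dots> = (q * card U) / (1 - \<theta>)" by simp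
  also have "\<dots> \<le> \<theta> / (1 - \<theta>)" using assms by (intro divide_right_mono) auto
  finally show ?thesis .
qed

text \<open>Insert the edges one by one. A new bridge joins two different components of the old
  graph, one of which may be flipped as a whole. Old edges that are bridges of the larger graph were
  bridges before, and flipping a whole component keeps them bichromatic.\<close>

lemma bridge_colouring:
  assumes "finite X" "X \<subseteq> all_edges U"
  shows "\<exists>x :: 'a \<Rightarrow> real. (\<forall>v. x v = 1 \<or> x v = -1) \<and>
    (\<forall>u v. {u, v} \<in> X \<and> \<not> reach U (X - {{u, v}}) u v \<longrightarrow> x u \<noteq> x v)"
  using assms
proof (induction X rule: finite_induct)
  case empty
  show ?case by (intro exI[of _ "\<lambda>_. 1"]) auto
next
  case (insert e X)
  then obtain x :: "'a \<Rightarrow> real" where x: "\<And>v. x v = 1 \<or> x v = -1"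
    "\<And>u v. {u, v} \<in> X \<Longrightarrow> \<not> reach U (X - {{u, v}}) u v \<Longrightarrow> x u \<noteq> x v" by blast
  have "e \<in> all_edges U" using insert by auto
  then obtain a b where e: "e = {a, b}" "a \<noteq> b" "a \<in> U" "b \<in> U" by (rule all_edgesE)
  define x' where "x' v = (if x a = x b \<and> reach U X a v then - x v else x v)" for v
  have "x' u \<noteq> x' v" if uv: "{u, v} \<in> insert e X" "\<not> reach U (insert e X - {{u, v}}) u v" for u v
  proof (cases "{u, v} = e")
    case True
    then have "insert e X - {{u, v}} = X" using insert by auto
    then have nr: "\<not> reach U X u v" using uv by simp
    have "(u = a \<and> v = b) \<or> (u = b \<and> v = a)" using True e by (auto simp: doubleton_eq_iff)
    moreover from this have "\<not> reach U X a b" using nr reach_sym by metis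
    then have "x' a = (if x a = x b then - x a else x a)" "x' b = x b" by (simp_all add: x'_def)
    then have "x' a \<noteq> x' b" using x(1)[of a] by (cases "x a = x b") auto
    ultimately show ?thesis by metis
  next
    case False
    then have X: "{u, v} \<in> X" using uv by auto
    then have "u \<in> U" "v \<in> U" using insert.prems by auto
    then have "reach U X a u \<longleftrightarrow> reach U X a v"
      using reach_edge[OF X] reach_trans reach_sym by metis
    moreover have "\<not> reach U (X - {{u, v}}) u v"
      using uv(2) reach_mono[of "X - {{u, v}}" "insert e X - {{u, v}}"] by auto
    ultimately show ?thesis using x(2)[OF X] by (auto simp: x'_def)
  qed
  moreover have "x' v = 1 \<or> x' v = -1" for v using x(1)[of v] by (auto simp: x'_def)
  ultimately show ?case by (intro exI[of _ x']) blast
qed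

text \<open>Choose each sign such that its cross term with the sum so far is nonpositive.\<close>

lemma signs_sum_square_le:
  fixes a :: "'i \<Rightarrow> real"
  assumes "finite I"
  shows "\<exists>g. (\<forall>i. g i = 1 \<or> g i = (-1::real)) \<and> (\<Sum>i\<in>I. g i * a i)\<^sup>2 \<le> (\<Sum>i\<in>I. (a i)\<^sup>2)"
  using assms
proof (induction I rule: finite_induct)
  case empty
  show ?case by (intro exI[of _ "\<lambda>_. 1"]) auto
next
  case (insert j I)
  then obtain g where g: "\<And>i. g i = 1 \<or> g i = (-1::real)" "(\<Sum>i\<in>I. g i * a i)\<^sup>2 \<le> (\<Sum>i\<in>I. (a i)\<^sup>2)"
    by auto
  define S where "S = (\<Sum>i\<in>I. g i * a i)"
  define c :: real where "c = (if S * a j \<le> 0 then 1 else -1)"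
  have "(\<Sum>i\<in>I. (g(j := c)) i * a i) = S"
    unfolding S_def using insert by (intro sum.cong) auto
  then have "(\<Sum>i\<in>insert j I. (g(j := c)) i * a i)\<^sup>2 = (c * a j + S)\<^sup>2" using insert by simp
  also have "\<dots> \<le> (a j)\<^sup>2 + S\<^sup>2" by (auto simp: c_def power2_sum power2_diff mult.commute)
  also have "\<dots> \<le> (\<Sum>i\<in>insert j I. (a i)\<^sup>2)" using insert g(2) by (simp add: S_def)
  finally show ?case using g(1) by (intro exI[of _ "g(j := c)"]) (auto simp: c_def)
qed

text \<open>Flipping a component preserves its bichromatic edges, so the component sums may be given
  the signs from \<open>signs_sum_square_le\<close>. Each of these sums is at most the component's
  size, and the squared sizes count the connected pairs.\<close>

lemma balanced_bridge_colouring: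
  assumes U: "finite U" and X: "X \<subseteq> all_edges U"
  shows "\<exists>x :: 'a \<Rightarrow> real. (\<forall>v. x v = 1 \<or> x v = -1) \<and>
    (\<forall>u v. {u, v} \<in> X - cycle_edges U X \<longrightarrow> x u \<noteq> x v) \<and> (\<Sum>v\<in>U. x v)\<^sup>2 \<le> card (conn_pairs U X)"
proof -
  have "finite X" using U X finite_all_edges finite_subset by blast
  then obtain x :: "'a \<Rightarrow> real" where x: "\<And>v. x v = 1 \<or> x v = -1"
    "\<And>u v. {u, v} \<in> X \<Longrightarrow> \<not> reach U (X - {{u, v}}) u v \<Longrightarrow> x u \<noteq> x v"
    using bridge_colouring[OF _ X] by blast
  define cl where "cl u = {v \<in> U. reach U X u v}" for u
  define K where "K = cl ` U"
  have cl_eq: "cl u = cl v \<longleftrightarrow> reach U X u v" if "u \<in> U" "v \<in> U" for u v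
    using that unfolding cl_def by (auto intro: reach_sym reach_trans)
  have fib: "{u \<in> U. cl u = C} = C" if "C \<in> K" for C
    using that cl_eq unfolding K_def by (auto simp: cl_def intro: reach_sym)
  have grp: "(\<Sum>u\<in>U. f u) = (\<Sum>C\<in>K. \<Sum>u\<in>C. f u)" for f :: "'a \<Rightarrow> real"
    using sum.group[OF U, of K cl f] U fib by (simp add: K_def)
  obtain g where g: "\<And>C. g C = 1 \<or> g C = (-1::real)"
    "(\<Sum>C\<in>K. g C * (\<Sum>u\<in>C. x u))\<^sup>2 \<le> (\<Sum>C\<in>K. (\<Sum>u\<in>C. x u)\<^sup>2)"
    using signs_sum_square_le[of K "\<lambda>C. \<Sum>u\<in>C. x u"] U by (auto simp: K_def)
  define x' where "x' v = g (cl v) * x v" for v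
  have "x' v = 1 \<or> x' v = -1" for v using g(1)[of "cl v"] x(1)[of v] by (auto simp: x'_def)
  moreover have "x' u \<noteq> x' v" if "{u, v} \<in> X - cycle_edges U X" for u v
  proof -
    have uv: "{u, v} \<in> X" "\<not> reach U (X - {{u, v}}) u v" using that by (auto simp: cycle_edges_def)
    moreover have "u \<in> U" "v \<in> U" using uv X by auto
    ultimately have "cl u = cl v" using cl_eq reach_edge by metis
    then show ?thesis using x(2)[OF uv] g(1)[of "cl v"] by (auto simp: x'_def)
  qed
  moreover have "(\<Sum>v\<in>U. x' v)\<^sup>2 \<le> card (conn_pairs U X)"
  proof -
    have "(\<Sum>u\<in>C. x' u) = g C * (\<Sum>u\<in>C. x u)" if "C \<in> K" for C
    proof -
      have "cl u = C" if "u \<in> C" for u using fib[OF \<open>C \<in> K\<close>] that by auto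
      then show ?thesis by (simp add: x'_def sum_distrib_left)
    qed
    then have "(\<Sum>v\<in>U. x' v)\<^sup>2 = (\<Sum>C\<in>K. g C * (\<Sum>u\<in>C. x u))\<^sup>2" unfolding grp by simp
    also have "\<dots> \<le> (\<Sum>C\<in>K. (\<Sum>u\<in>C. x u)\<^sup>2)" by (rule g(2))
    also have "\<dots> \<le> (\<Sum>C\<in>K. (real (card C))\<^sup>2)"
    proof (intro sum_mono)
      fix C
      have "\<bar>\<Sum>u\<in>C. x u\<bar> \<le> (\<Sum>u\<in>C. \<bar>x u\<bar>)" by (rule sum_abs)
      also have "\<dots> \<le> (\<Sum>u\<in>C. 1)" using x(1) by (intro sum_mono) (metis abs_1 abs_minus order_refl)
      finally show "(\<Sum>u\<in>C. x u)\<^sup>2 \<le> (real (card C))\<^sup>2" by (simp add: abs_le_square_iff[symmetric])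
    qed
    also have "\<dots> = (\<Sum>C\<in>K. \<Sum>u\<in>C. real (card (cl u)))"
    proof (intro sum.cong refl)
      fix C assume "C \<in> K"
      then have "cl u = C" if "u \<in> C" for u using fib that by auto
      then show "(real (card C))\<^sup>2 = (\<Sum>u\<in>C. real (card (cl u)))" by (simp add: power2_eq_square)
    qed
    also have "\<dots> = (\<Sum>u\<in>U. real (card (cl u)))" by (rule grp[symmetric])
    also have "\<dots> = card (SIGMA u:U. cl u)" using U by (simp add: card_SigmaI cl_def)
    also have "(SIGMA u:U. cl u) = conn_pairs U X" by (auto simp: conn_pairs_def cl_def)
    finally show ?thesis by simp
  qed
  ultimately show ?thesis by (intro exI[of _ x']) blast
qed

section \<open>Greedy signs\<close>

definition block :: "'a set \<Rightarrow> 'a \<Rightarrow> 'a \<Rightarrow> 'a set set" where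
  "block S a b = (\<lambda>u. {u, a}) ` S \<union> (\<lambda>u. {u, b}) ` S"

text \<open>The \<open>Z\<close> of a pair. If \<open>a\<close> gets a sign and \<open>b\<close> the
  opposite one, the edges from \<open>S\<close> contribute that sign times \<open>zsum\<close> to
  the quadratic form; the centring by \<open>p\<close> cancels between \<open>a\<close> and
  \<open>b\<close>.\<close>

definition zsum :: "'a set \<Rightarrow> ('a \<Rightarrow> real) \<Rightarrow> 'a \<Rightarrow> 'a \<Rightarrow> 'a set set \<Rightarrow> real" where
  "zsum S x a b X = (\<Sum>u\<in>S. x u * (of_bool ({u, a} \<in> X) - of_bool ({u, b} \<in> X)))"

lemma finite_block [simp]: "finite S \<Longrightarrow> finite (block S a b)"
  by (simp add: block_def)

lemma zsum_cong:
  assumes "X \<inter> block S a b = Y \<inter> block S a b"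
  shows "zsum S x a b X = zsum S x a b Y"
proof -
  have "{u, a} \<in> X \<longleftrightarrow> {u, a} \<in> Y" "{u, b} \<in> X \<longleftrightarrow> {u, b} \<in> Y" if "u \<in> S" for u
    using assms that unfolding block_def by blast+
  then show ?thesis unfolding zsum_def by (intro sum.cong) auto
qed

lemma sum_block:
  assumes "finite S" "a \<noteq> b" "a \<notin> S" "b \<notin> S"
  shows "(\<Sum>e\<in>block S a b. f e) = (\<Sum>u\<in>S. f {u, a} + f {u, b})"
proof -
  have "(\<Sum>e\<in>block S a b. f e) = (\<Sum>e\<in>(\<lambda>u. {u, a}) ` S. f e) + (\<Sum>e\<in>(\<lambda>u. {u, b}) ` S. f e)"
    unfolding block_def using assms by (intro sum.union_disjoint) (auto simp: doubleton_eq_iff)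
  also have "inj_on (\<lambda>u. {u, a}) S" "inj_on (\<lambda>u. {u, b}) S" using assms by (auto simp: inj_on_def doubleton_eq_iff)
  then have "(\<Sum>e\<in>(\<lambda>u. {u, a}) ` S. f e) + (\<Sum>e\<in>(\<lambda>u. {u, b}) ` S. f e) = (\<Sum>u\<in>S. f {u, a} + f {u, b})"
    by (simp add: sum.reindex sum.distrib)
  finally show ?thesis .
qed

text \<open>A difference of two independent Bernoulli variables is symmetric, so the signs \<open>x\<close> do not
  influence the law of \<open>zsum\<close>.\<close>

lemma EE_zsum:
  assumes "finite S" "a \<noteq> b" "a \<notin> S" "b \<notin> S" "\<And>u. u \<in> S \<Longrightarrow> x u = 1 \<or> x u = -1"
  shows "EE p (block S a b) (\<lambda>X. f (z + zsum S x a b X)) = walk (2 * p * (1 - p)) (card S) f z"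
  using assms
proof (induction S arbitrary: z rule: finite_induct)
  case empty
  then show ?case by (simp add: block_def zsum_def)
next
  case (insert w S)
  let ?B = "block S a b" and ?r = "2 * p * (1 - p)"
  have nin: "{w, b} \<notin> ?B" "{w, a} \<notin> insert {w, b} ?B" "{w, a} \<notin> ?B"
    using insert by (auto simp: block_def doubleton_eq_iff)
  have blk: "block (insert w S) a b = insert {w, a} (insert {w, b} ?B)"
    unfolding block_def by auto
  have zs: "zsum (insert w S) x a b Y = x w * (of_bool ({w, a} \<in> Y) - of_bool ({w, b} \<in> Y)) + zsum S x a b X"
    if "Y \<inter> ?B = X" "X \<subseteq> ?B" for X Y
  proof -
    have "zsum S x a b Y = zsum S x a b X" by (rule zsum_cong) (use that in auto)
    then show ?thesis using insert.hyps by (simp add: zsum_def)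
  qed
  have IH: "EE p ?B (\<lambda>X. f (z + zsum S x a b X)) = walk ?r (card S) f z" for z
    using insert.IH insert.prems by simp
  \<comment> \<open>Reveal the two edges at \<open>w\<close>. If exactly one is present, with
    probability \<open>p * (1 - p)\<close> for either of them, the walk moves by \<open>x w\<close>
    or \<open>- x w\<close>; otherwise it rests.\<close>
  have "EE p (block (insert w S) a b) (\<lambda>X. f (z + zsum (insert w S) x a b X))
     = p * (p * EE p ?B (\<lambda>X. f (z + zsum (insert w S) x a b (insert {w, a} (insert {w, b} X)))) +
         (1 - p) * EE p ?B (\<lambda>X. f (z + zsum (insert w S) x a b (insert {w, a} X)))) +
       (1 - p) * (p * EE p ?B (\<lambda>X. f (z + zsum (insert w S) x a b (insert {w, b} X))) +
         (1 - p) * EE p ?B (\<lambda>X. f (z + zsum (insert w S) x a b X)))"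
    unfolding blk using nin insert.hyps by (simp add: EE_insert)
  also have "EE p ?B (\<lambda>X. f (z + zsum (insert w S) x a b (insert {w, a} (insert {w, b} X))))
     = EE p ?B (\<lambda>X. f (z + zsum S x a b X))"
    by (intro EE_cong arg_cong[of _ _ f], subst zs) (use nin in auto)
  also have "EE p ?B (\<lambda>X. f (z + zsum (insert w S) x a b (insert {w, a} X)))
     = EE p ?B (\<lambda>X. f ((z + x w) + zsum S x a b X))"
    by (intro EE_cong arg_cong[of _ _ f], subst zs)
      (use nin insert.prems in \<open>auto simp: doubleton_eq_iff\<close>)
  also have "EE p ?B (\<lambda>X. f (z + zsum (insert w S) x a b (insert {w, b} X)))
     = EE p ?B (\<lambda>X. f ((z - x w) + zsum S x a b X))"
    by (intro EE_cong arg_cong[of _ _ f], subst zs)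
      (use nin insert.prems in \<open>auto simp: doubleton_eq_iff\<close>)
  also have "EE p ?B (\<lambda>X. f (z + zsum (insert w S) x a b X)) = EE p ?B (\<lambda>X. f (z + zsum S x a b X))"
    by (intro EE_cong arg_cong[of _ _ f], subst zs) (use nin in auto)
  also have "p * (p * EE p ?B (\<lambda>X. f (z + zsum S x a b X)) + (1 - p) * EE p ?B (\<lambda>X. f ((z + x w) + zsum S x a b X)))
     + (1 - p) * (p * EE p ?B (\<lambda>X. f ((z - x w) + zsum S x a b X)) + (1 - p) * EE p ?B (\<lambda>X. f (z + zsum S x a b X)))
     = walk ?r (Suc (card S)) f z"
    using insert.prems(4)[of w] unfolding IH walk_Suc walk_step_def by (auto simp: field_simps)
  finally show ?case using insert.hyps by simp
qed

text \<open>Unlike \<open>sgn\<close> it is nonzero at 0, because every vertex needs a sign; the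
  price is that it is not odd.\<close>

definition sgn1 :: "real \<Rightarrow> real" where
  "sgn1 z = (if 0 \<le> z then 1 else -1)"

lemma sgn1_cases: "sgn1 z = 1 \<or> sgn1 z = -1"
  by (simp add: sgn1_def)

lemma sgn1_mult [simp]: "sgn1 z * z = \<bar>z\<bar>" "\<bar>sgn1 z\<bar> = 1" "(sgn1 z)\<^sup>2 = 1"
  by (auto simp: sgn1_def)

text \<open>Relabelling vertices permutes the edges. The relabelled graph is written as a
  comprehension, so that membership of an edge unfolds to membership of its image in
  \<open>X\<close>.\<close>

lemma EE_involution:
  assumes "\<And>v. \<pi> (\<pi> v) = v" "\<And>e. e \<in> A \<Longrightarrow> \<pi> ` e \<in> A"
  shows "EE p A (\<lambda>X. F {e \<in> A. \<pi> ` e \<in> X}) = EE p A F"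
proof -
  have inv: "\<pi> ` \<pi> ` e = e" for e using assms(1) by (simp add: image_image)
  have "bij_betw (image \<pi>) A A"
    by (rule bij_betw_byWitness[where f' = "image \<pi>"]) (use assms inv in auto)
  moreover have "image \<pi> ` X = {e \<in> A. \<pi> ` e \<in> X}" if "X \<subseteq> A" for X
  proof (intro equalityI subsetI)
    fix e assume "e \<in> {e \<in> A. \<pi> ` e \<in> X}"
    then show "e \<in> image \<pi> ` X" using inv[of e] by (metis (mono_tags, lifting) image_eqI mem_Collect_eq)
  qed (use that assms inv in auto)
  ultimately show ?thesis using EE_bij[of "image \<pi>" A p F] by (simp cong: EE_cong)
qed

text \<open>Exchanging \<open>a\<close> and \<open>b\<close> negates both sums, whereas \<open>\<rho>\<close> negates the first one and fixes the
  second.\<close>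

lemma EE_sgn1_zsum:
  assumes S: "finite S" "a \<noteq> b" "a \<notin> S" "b \<notin> S"
    and rho: "\<And>v. \<rho> (\<rho> v) = v" "\<And>u. u \<in> S \<Longrightarrow> \<rho> u \<in> S" "\<rho> a = a" "\<rho> b = b"
    and x: "\<And>u. u \<in> S \<Longrightarrow> x (\<rho> u) = - x u"
  shows "EE p (block S a b) (\<lambda>X. sgn1 (zsum S x a b X) * zsum S (\<lambda>_. 1) a b X) = 0" (is "?L = 0")
proof -
  let ?B = "block S a b" and ?one = "\<lambda>_. 1::real"
  \<comment> \<open>As \<open>sgn1 0 = 1\<close>, \<open>\<rho>\<close> alone would not settle the
    event that the first sum vanishes. Each of the two symmetries rewrites \<open>?L\<close> in
    terms of the same \<open>?E\<close>, with opposite signs.\<close>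
  let ?E = "EE p ?B (\<lambda>X. sgn1 (- zsum S x a b X) * zsum S ?one a b X)"
  define \<tau> where "\<tau> v = (if v = a then b else if v = b then a else v)" for v
  have tau: "\<tau> (\<tau> v) = v" "\<tau> a = b" "\<tau> b = a" "u \<in> S \<Longrightarrow> \<tau> u = u" for u v
    using S by (auto simp: \<tau>_def)
  have tB: "\<tau> ` e \<in> ?B" if "e \<in> ?B" for e using that tau by (auto simp: block_def)
  have rB: "\<rho> ` e \<in> ?B" if "e \<in> ?B" for e using that rho by (auto simp: block_def)
  have tz: "zsum S y a b {e \<in> ?B. \<tau> ` e \<in> X} = - zsum S y a b X" for y X
    unfolding zsum_def sum_negf[symmetric]
    by (intro sum.cong) (auto simp: block_def tau)
  have rz: "zsum S y a b {e \<in> ?B. \<rho> ` e \<in> X} = zsum S (y \<circ> \<rho>) a b X" for y X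
  proof -
    have "bij_betw \<rho> S S" by (rule bij_betw_byWitness[where f' = \<rho>]) (use rho in auto)
    then have "zsum S (y \<circ> \<rho>) a b X =
       (\<Sum>u\<in>S. (y \<circ> \<rho>) (\<rho> u) * (of_bool ({\<rho> u, a} \<in> X) - of_bool ({\<rho> u, b} \<in> X)))"
      unfolding zsum_def by (rule sum.reindex_bij_betw[symmetric])
    also have "\<dots> = zsum S y a b {e \<in> ?B. \<rho> ` e \<in> X}"
      unfolding zsum_def by (intro sum.cong) (auto simp: block_def rho)
    finally show ?thesis by simp
  qed
  have xr: "zsum S (x \<circ> \<rho>) a b X = - zsum S x a b X" for X
    unfolding zsum_def sum_negf[symmetric] using x by (intro sum.cong) auto
  have "?L = EE p ?B (\<lambda>X. sgn1 (- zsum S x a b X) * - zsum S ?one a b X)"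
    using EE_involution[OF tau(1) tB, of p "\<lambda>X. sgn1 (zsum S x a b X) * zsum S ?one a b X"] tz by simp
  then have 1: "?L = - ?E" by (simp add: EE_minus)
  have "?L = EE p ?B (\<lambda>X. sgn1 (- zsum S x a b X) * zsum S (?one \<circ> \<rho>) a b X)"
    using EE_involution[OF rho(1) rB, of p "\<lambda>X. sgn1 (zsum S x a b X) * zsum S ?one a b X"] rz xr by simp
  then have 2: "?L = ?E" by (simp add: comp_def)
  show ?thesis using 1 2 by linarith
qed

text \<open>The vertices are split into the core \<open>{1..N}\<close>, the pairs \<open>(v, v + J)\<close> for
  \<open>v \<in> {N+1..N+J}\<close>, and the rest.\<close>

definition mid_edges :: "nat \<Rightarrow> nat \<Rightarrow> nat set set" where
  "mid_edges N J = (\<Union>v\<in>{N+1..N+J}. block {1..N} v (v + J))"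

text \<open>The edges that no sign looks at: given all the others, the signs are fixed and these
  edges are still independent.\<close>

definition late_edges :: "nat \<Rightarrow> nat \<Rightarrow> nat \<Rightarrow> nat set set" where
  "late_edges N J n = all_edges {1..n} - all_edges {1..N} - mid_edges N J"

text \<open>The core signs \<open>x\<close> are a parameter, so that they may themselves be chosen
  from the edges inside the core. In the applications at most one vertex lies beyond
  \<open>N + 2 * J\<close>.\<close>

definition gsign :: "nat \<Rightarrow> nat \<Rightarrow> (nat \<Rightarrow> real) \<Rightarrow> nat set set \<Rightarrow> nat \<Rightarrow> real" where
  "gsign N J x X v = (if v \<le> N then x v
     else if v \<le> N + J then sgn1 (zsum {1..N} x v (v + J) X)
     else if v \<le> N + 2 * J then - sgn1 (zsum {1..N} x (v - J) v X) else 1)"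

lemma gsign_cases:
  assumes "\<And>v. x v = 1 \<or> x v = -1"
  shows "gsign N J x X v = 1 \<or> gsign N J x X v = -1"
  using assms sgn1_cases by (auto simp: gsign_def)

lemma finite_mid_edges [simp]: "finite (mid_edges N J)"
  by (simp add: mid_edges_def)

lemma block_disjoint:
  fixes N J :: nat
  shows "disjoint_family_on (\<lambda>v. block {1..N} v (v + J)) {N+1..N+J}"
  unfolding disjoint_family_on_def block_def by (auto simp: doubleton_eq_iff)

lemma mid_disjoint: "all_edges {1..N} \<inter> mid_edges N J = {}"
  unfolding mid_edges_def block_def by auto

lemma mid_subset: "N + 2 * J \<le> n \<Longrightarrow> mid_edges N J \<subseteq> all_edges {1..n}"
  unfolding mid_edges_def block_def by auto

lemma gsign_cong:
  assumes "X \<inter> mid_edges N J = Y \<inter> mid_edges N J"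
  shows "gsign N J x X = gsign N J x Y"
proof
  fix v
  have z: "zsum {1..N} x w (w + J) X = zsum {1..N} x w (w + J) Y" if "w \<in> {N+1..N+J}" for w
    by (rule zsum_cong) (use assms that in \<open>unfold mid_edges_def, blast\<close>)
  show "gsign N J x X v = gsign N J x Y v"
  proof (cases "N + J < v \<and> v \<le> N + 2 * J")
    case True
    then have "v - J \<in> {N+1..N+J}" "v - J + J = v" by auto
    then show ?thesis using z[of "v - J"] by (simp add: gsign_def)
  qed (use z[of v] in \<open>auto simp: gsign_def\<close>)
qed

lemma sum_split_edges:
  fixes f :: "nat set \<Rightarrow> real"
  assumes "N + 2 * J \<le> n"
  shows "(\<Sum>e\<in>all_edges {1..n}. f e) = (\<Sum>e\<in>all_edges {1..N}. f e) +
    (\<Sum>v\<in>{N+1..N+J}. \<Sum>u\<in>{1..N}. f {u, v} + f {u, v + J}) + (\<Sum>e\<in>late_edges N J n. f e)"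
proof -
  have sub: "all_edges {1..N} \<subseteq> all_edges {1..n}" "mid_edges N J \<subseteq> all_edges {1..n}"
    using assms all_edges_mono[of "{1..N}" "{1..n}"] mid_subset by auto
  have fin: "finite (all_edges {1..n})" "finite (all_edges {1..N})" by (simp_all add: finite_all_edges)
  have "(\<Sum>e\<in>all_edges {1..n}. f e) = (\<Sum>e\<in>late_edges N J n. f e) + (\<Sum>e\<in>all_edges {1..N} \<union> mid_edges N J. f e)"
    unfolding late_edges_def Diff_Diff_Int[symmetric]
    using sum.subset_diff[of "all_edges {1..N} \<union> mid_edges N J" "all_edges {1..n}" f] sub fin
    by (simp add: Diff_eq Int_assoc)
  also have "(\<Sum>e\<in>all_edges {1..N} \<union> mid_edges N J. f e) = (\<Sum>e\<in>all_edges {1..N}. f e) + (\<Sum>e\<in>mid_edges N J. f e)"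
    using fin mid_disjoint by (intro sum.union_disjoint) auto
  also have "(\<Sum>e\<in>mid_edges N J. f e) = (\<Sum>v\<in>{N+1..N+J}. \<Sum>e\<in>block {1..N} v (v + J). f e)"
    unfolding mid_edges_def using block_disjoint[of N J]
    by (intro sum.UNION_disjoint) (auto simp: disjoint_family_on_def)
  also have "\<dots> = (\<Sum>v\<in>{N+1..N+J}. \<Sum>u\<in>{1..N}. f {u, v} + f {u, v + J})"
    by (intro sum.cong sum_block refl) auto
  finally show ?thesis by linarith
qed

lemma gsign_pair:
  assumes "v \<in> {N+1..N+J}"
  shows "gsign N J x X v = sgn1 (zsum {1..N} x v (v + J) X)"
    and "gsign N J x X (v + J) = - sgn1 (zsum {1..N} x v (v + J) X)"
  using assms by (auto simp: gsign_def)

text \<open>The signs at \<open>v\<close> and \<open>v + J\<close> are opposite, so the edges from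
  the core to the pair contribute \<open>sgn1 z * z\<close>, that is, the absolute value of
  \<open>zsum\<close>.\<close>

lemma sum_gsign_prod:
  fixes x :: "nat \<Rightarrow> real" and X :: "nat set set"
  assumes "N + 2 * J \<le> n"
  defines "s \<equiv> gsign N J x X"
  shows "(\<Sum>e\<in>all_edges {1..n}. (\<Prod>v\<in>e. s v) * (of_bool (e \<in> X) - p)) =
    (\<Sum>e\<in>all_edges {1..N}. (\<Prod>v\<in>e. x v) * (of_bool (e \<in> X) - p)) +
    (\<Sum>v\<in>{N+1..N+J}. \<bar>zsum {1..N} x v (v + J) X\<bar>) +
    (\<Sum>e\<in>late_edges N J n. (\<Prod>v\<in>e. s v) * (of_bool (e \<in> X) - p))"
proof -
  have "(\<Sum>e\<in>all_edges {1..N}. (\<Prod>v\<in>e. s v) * (of_bool (e \<in> X) - p)) =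
     (\<Sum>e\<in>all_edges {1..N}. (\<Prod>v\<in>e. x v) * (of_bool (e \<in> X) - p))"
    by (intro sum.cong refl arg_cong2[of _ _ _ _ times] prod.cong)
      (auto simp: s_def gsign_def all_edges_def)
  moreover have "(\<Sum>u\<in>{1..N}. (\<Prod>w\<in>{u, v}. s w) * (of_bool ({u, v} \<in> X) - p) +
      (\<Prod>w\<in>{u, v + J}. s w) * (of_bool ({u, v + J} \<in> X) - p)) = \<bar>zsum {1..N} x v (v + J) X\<bar>"
    if v: "v \<in> {N+1..N+J}" for v
  proof -
    let ?z = "zsum {1..N} x v (v + J) X"
    have "(\<Sum>u\<in>{1..N}. (\<Prod>w\<in>{u, v}. s w) * (of_bool ({u, v} \<in> X) - p) +
      (\<Prod>w\<in>{u, v + J}. s w) * (of_bool ({u, v + J} \<in> X) - p)) =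
      (\<Sum>u\<in>{1..N}. sgn1 ?z * (x u * (of_bool ({u, v} \<in> X) - of_bool ({u, v + J} \<in> X))))"
    proof (intro sum.cong refl)
      fix u assume u: "u \<in> {1..N}"
      then have "u \<noteq> v" "u \<noteq> v + J" "s u = x u" using v by (auto simp: s_def gsign_def)
      then show "(\<Prod>w\<in>{u, v}. s w) * (of_bool ({u, v} \<in> X) - p) +
        (\<Prod>w\<in>{u, v + J}. s w) * (of_bool ({u, v + J} \<in> X) - p) =
        sgn1 ?z * (x u * (of_bool ({u, v} \<in> X) - of_bool ({u, v + J} \<in> X)))"
        using gsign_pair[OF v, of x X, folded s_def] by (simp add: algebra_simps)
    qed
    also have "\<dots> = sgn1 ?z * ?z" by (simp add: zsum_def sum_distrib_left)
    finally show ?thesis by simp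
  qed
  ultimately show ?thesis unfolding sum_split_edges[OF assms(1)] by simp
qed

text \<open>Every pair cancels, so the sum of the signs stays as small as on the core, whatever the
  greedy choices.\<close>

lemma sum_gsign:
  assumes "N + 2 * J \<le> n" "n \<le> N + 2 * J + 1"
  shows "(\<Sum>v\<in>{1..n}. gsign N J x X v) = (\<Sum>v\<in>{1..N}. x v) + (real n - N - 2 * J)"
proof -
  let ?s = "gsign N J x X"
  let ?B = "{N+1..N+J}" and ?D = "{N+2*J+1..n}"
  have un: "(\<Sum>v\<in>A \<union> B. ?s v) = (\<Sum>v\<in>A. ?s v) + (\<Sum>v\<in>B. ?s v)"
    if "finite A" "finite B" "A \<inter> B = {}" for A B using that by (rule sum.union_disjoint)
  have U: "{1..n} = {1..N} \<union> (?B \<union> ((\<lambda>v. v + J) ` ?B \<union> ?D))"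
    using assms by (auto simp: image_add_atLeastAtMost)
  have "(\<Sum>v\<in>{1..n}. ?s v) = (\<Sum>v\<in>{1..N}. ?s v) + (\<Sum>v\<in>?B \<union> ((\<lambda>v. v + J) ` ?B \<union> ?D). ?s v)"
    unfolding U by (rule un) auto
  also have "(\<Sum>v\<in>?B \<union> ((\<lambda>v. v + J) ` ?B \<union> ?D). ?s v) = (\<Sum>v\<in>?B. ?s v) + (\<Sum>v\<in>(\<lambda>v. v + J) ` ?B \<union> ?D. ?s v)"
    by (rule un) auto
  also have "(\<Sum>v\<in>(\<lambda>v. v + J) ` ?B \<union> ?D. ?s v) = (\<Sum>v\<in>(\<lambda>v. v + J) ` ?B. ?s v) + (\<Sum>v\<in>?D. ?s v)"
    by (rule un) auto
  also have "(\<Sum>v\<in>{1..N}. ?s v) = (\<Sum>v\<in>{1..N}. x v)" by (intro sum.cong) (auto simp: gsign_def)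
  also have "(\<Sum>v\<in>(\<lambda>v. v + J) ` {N+1..N+J}. ?s v) = (\<Sum>v\<in>{N+1..N+J}. - ?s v)"
    by (subst sum.reindex) (auto simp: inj_on_def gsign_pair intro!: sum.cong)
  also have "(\<Sum>v\<in>{N+2*J+1..n}. ?s v) = (\<Sum>v\<in>{N+2*J+1..n}. 1)"
    by (intro sum.cong) (auto simp: gsign_def)
  finally show ?thesis using assms by (simp add: sum_negf of_nat_diff)
qed

text \<open>Given the edges outside \<open>mid_edges\<close>, the core signs are fixed, and by
  \<open>EE_zsum\<close> they do not affect the law. The blocks of distinct pairs are disjoint, so
  the variances add, and each is at most the second moment \<open>N * r\<close>.\<close>

lemma EE_sum_abs_zsum:
  fixes x :: "nat set set \<Rightarrow> nat \<Rightarrow> real"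
  assumes "N + 2 * J \<le> n" "0 \<le> p" "p \<le> 1" "\<And>X v. x X v = 1 \<or> x X v = -1"
  defines "r \<equiv> 2 * p * (1 - p)"
  shows "EE p (all_edges {1..n}) (\<lambda>X.
     ((\<Sum>v\<in>{N+1..N+J}. \<bar>zsum {1..N} (x (X \<inter> all_edges {1..N})) v (v + J) X\<bar>) - J * walk r N abs 0)\<^sup>2)
     \<le> J * N * r"
    (is "EE p _ ?G \<le> ?c")
proof (rule EE_cond_le[where F = ?G, OF _ mid_subset[OF assms(1)] assms(2,3)])
  fix Y assume Y: "Y \<subseteq> all_edges {1..n} - mid_edges N J"
  define y where "y = x (Y \<inter> all_edges {1..N})"
  let ?I = "{N+1..N+J}" and ?S = "{1..N}"
  let ?B = "\<lambda>v. block ?S v (v + J)"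
  let ?\<mu> = "walk r N abs 0"
  define F where "F v X = \<bar>zsum ?S y v (v + J) X\<bar> - ?\<mu>" for v X
  have y: "y v = 1 \<or> y v = -1" for v using assms(4) by (simp add: y_def)
  have z: "EE p (?B v) (\<lambda>X. f (zsum ?S y v (v + J) X)) = walk r N f 0" if "v \<in> ?I" for v f
    using EE_zsum[of ?S v "v + J" y p f 0] that y by (simp add: r_def)
  have F0: "EE p (?B v) (F v) = 0" if "v \<in> ?I" for v
    using z[OF that, of abs] by (simp add: F_def[abs_def] EE_diff EE_const)
  have F2: "EE p (?B v) (\<lambda>X. (F v X)\<^sup>2) \<le> N * r" if "v \<in> ?I" for v
  proof -
    have "EE p (?B v) (\<lambda>X. (F v X)\<^sup>2) = walk r N (\<lambda>t. (\<bar>t\<bar> - ?\<mu>)\<^sup>2) 0"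
      using z[OF that] by (simp add: F_def)
    \<comment> \<open>The square is expanded into nested two-term combinations, the shape of
      \<open>walk_linear\<close>.\<close>
    also have "\<dots> = walk r N (\<lambda>t. 1 * t\<^sup>2 + (- 2 * ?\<mu>) * (1 * \<bar>t\<bar> + (- ?\<mu> / 2) * 1)) 0"
      by (intro arg_cong[of _ _ "\<lambda>f. walk r N f 0"]) (auto simp: fun_eq_iff power2_diff algebra_simps power2_eq_square)
    also have "\<dots> = N * r - ?\<mu>\<^sup>2"
      unfolding walk_linear walk_square walk_const by (simp add: power2_eq_square algebra_simps)
    finally show ?thesis by simp
  qed
  have "EE p (mid_edges N J) (\<lambda>X. ((\<Sum>v\<in>?I. \<bar>zsum ?S (x ((X \<union> Y) \<inter> all_edges ?S)) v (v + J) (X \<union> Y)\<bar>) - J * ?\<mu>)\<^sup>2)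
     = EE p (mid_edges N J) (\<lambda>X. (\<Sum>v\<in>?I. F v (X \<inter> ?B v))\<^sup>2)"
  proof (intro EE_cong arg_cong[of _ _ "\<lambda>x. x\<^sup>2"])
    fix X assume X: "X \<subseteq> mid_edges N J"
    have "(X \<union> Y) \<inter> all_edges ?S = Y \<inter> all_edges ?S" using X mid_disjoint[of N J] by blast
    moreover have "zsum ?S y v (v + J) (X \<union> Y) = zsum ?S y v (v + J) (X \<inter> ?B v)" if "v \<in> ?I" for v
      by (rule zsum_cong) (use that Y in \<open>unfold mid_edges_def, blast\<close>)
    ultimately show "(\<Sum>v\<in>?I. \<bar>zsum ?S (x ((X \<union> Y) \<inter> all_edges ?S)) v (v + J) (X \<union> Y)\<bar>) - J * ?\<mu> =
      (\<Sum>v\<in>?I. F v (X \<inter> ?B v))"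
      by (simp add: F_def sum_subtractf y_def)
  qed
  also have "\<dots> = (\<Sum>v\<in>?I. EE p (?B v) (\<lambda>X. (F v X)\<^sup>2))"
    unfolding mid_edges_def using F0 block_disjoint by (intro EE_indep_sum_square) auto
  also have "\<dots> \<le> (\<Sum>v\<in>?I. N * r)" using F2 by (intro sum_mono) auto
  finally show "EE p (mid_edges N J) (\<lambda>X. ?G (X \<union> Y)) \<le> ?c" by simp
qed (simp add: finite_all_edges)

text \<open>The coefficients are functions of \<open>X - late_edges N J n\<close>, so
  \<open>EE_linear_square_le\<close> applies. The weight \<open>h\<close> will be the product or the
  sum of the signs on an edge.\<close>

lemma EE_sum_late:
  fixes x :: "nat set set \<Rightarrow> nat \<Rightarrow> real"
  assumes "N + 2 * J \<le> n" "0 \<le> p" "p \<le> 1" "\<And>s e. (\<And>v. s v = 1 \<or> s v = -1) \<Longrightarrow> e \<in> all_edges {1..n} \<Longrightarrow> \<bar>h s e\<bar> \<le> M"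
    and "\<And>X v. x X v = 1 \<or> x X v = -1"
  shows "EE p (all_edges {1..n}) (\<lambda>X.
     (\<Sum>e\<in>late_edges N J n. h (gsign N J (x (X \<inter> all_edges {1..N})) X) e * (of_bool (e \<in> X) - p))\<^sup>2)
     \<le> M\<^sup>2 * ((real n)\<^sup>2 / 2) * (p * (1 - p))"
proof -
  let ?L = "late_edges N J n" and ?A = "all_edges {1..n}"
  define c where "c X e = (if e \<in> ?A then h (gsign N J (x (X \<inter> all_edges {1..N})) X) e else 0)" for X e
  have fin: "finite ?A" by (simp add: finite_all_edges)
  have sub: "?L \<subseteq> ?A" by (auto simp: late_edges_def)
  have c: "c (X - ?L) e = h (gsign N J (x (X \<inter> all_edges {1..N})) X) e" if "e \<in> ?L" for X e
  proof -
    have "(X - ?L) \<inter> all_edges {1..N} = X \<inter> all_edges {1..N}" by (auto simp: late_edges_def)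
    moreover have "gsign N J y (X - ?L) = gsign N J y X" for y
      by (rule gsign_cong) (auto simp: late_edges_def)
    ultimately show ?thesis using that sub by (auto simp: c_def)
  qed
  have "EE p ?A (\<lambda>X. (\<Sum>e\<in>?L. h (gsign N J (x (X \<inter> all_edges {1..N})) X) e * (of_bool (e \<in> X) - p))\<^sup>2)
    = EE p ?A (\<lambda>X. (\<Sum>e\<in>?L. c (X - ?L) e * (of_bool (e \<in> X) - p))\<^sup>2)"
    by (simp add: c)
  also have "\<dots> \<le> M\<^sup>2 * card ?L * (p * (1 - p))"
  proof (rule EE_linear_square_le[OF fin sub assms(2,3)])
    fix Y e assume "e \<in> ?L"
    then show "\<bar>c Y e\<bar> \<le> M" using sub assms(4)[of "gsign N J (x (Y \<inter> all_edges {1..N})) Y" e]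
        gsign_cases[OF assms(5)] by (auto simp: c_def)
  qed
  also have "\<dots> \<le> M\<^sup>2 * ((real n)\<^sup>2 / 2) * (p * (1 - p))"
  proof -
    have "real (card ?L) \<le> real (card ?A)" using fin sub by (simp add: card_mono)
    also have "\<dots> \<le> (real n)\<^sup>2 / 2" by (simp add: card_all_edges power2_eq_square algebra_simps)
    finally show ?thesis using assms by (intro mult_right_mono mult_left_mono) auto
  qed
  finally show ?thesis .
qed

section \<open>Large complement degree\<close>

lemma EE_tail:
  assumes "0 \<le> p" "p \<le> 1" "EE p A (\<lambda>X. (f X)\<^sup>2) \<le> V" "0 < t" "V / t\<^sup>2 \<le> \<delta>"
  shows "EE p A (\<lambda>X. of_bool (t \<le> \<bar>f X\<bar>)) \<le> \<delta>"
proof -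
  have "EE p A (\<lambda>X. of_bool (t \<le> \<bar>f X\<bar>)) \<le> EE p A (\<lambda>X. of_bool (t\<^sup>2 \<le> (f X)\<^sup>2))"
    using assms by (intro EE_mono) (auto simp: abs_le_square_iff[symmetric])
  also have "\<dots> \<le> EE p A (\<lambda>X. (f X)\<^sup>2) / t\<^sup>2" using assms by (intro EE_markov) auto
  also have "\<dots> \<le> V / t\<^sup>2" using assms by (intro divide_right_mono) auto
  finally show ?thesis using assms by simp
qed

text \<open>Union bound that peels off one bad event at a time.\<close>

lemma of_bool_le_add:
  assumes "\<not> Q \<Longrightarrow> of_bool P \<le> R" "0 \<le> R"
  shows "of_bool P \<le> (of_bool Q + R :: real)"
  using assms by (cases Q; cases P) auto

text \<open>Separates three kinds of randomness: coefficients that are fixed once \<open>x\<close>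
  is, greedy signs multiplied by the very edges that determine them, and edges that no sign depends
  on. Only the middle kind needs the symmetry argument.\<close>

lemma sum_gsign_sum:
  fixes x :: "nat \<Rightarrow> real" and X :: "nat set set"
  assumes "N + 2 * J \<le> n"
  defines "s \<equiv> gsign N J x X"
  shows "(\<Sum>e\<in>all_edges {1..n}. (\<Sum>v\<in>e. s v) * (of_bool (e \<in> X) - p)) =
    (\<Sum>e\<in>all_edges {1..n} - late_edges N J n. (\<Sum>v\<in>e \<inter> {1..N}. x v) * (of_bool (e \<in> X) - p)) +
    (\<Sum>v\<in>{N+1..N+J}. sgn1 (zsum {1..N} x v (v + J) X) * zsum {1..N} (\<lambda>_. 1) v (v + J) X) +
    (\<Sum>e\<in>late_edges N J n. (\<Sum>v\<in>e. s v) * (of_bool (e \<in> X) - p))"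
proof -
  let ?A = "all_edges {1..n}" and ?L = "late_edges N J n" and ?S = "{1..N}" and ?I = "{N+1..N+J}"
  define Y :: "nat set \<Rightarrow> real" where "Y e = of_bool (e \<in> X) - p" for e
  define c where "c e = (\<Sum>v\<in>e \<inter> ?S. x v)" for e
  \<comment> \<open>Extended by zero, so that \<open>sum_split_edges\<close> also covers the sum
    over the complement of the late edges.\<close>
  define f where "f e = (if e \<in> ?L then 0 else c e * Y e)" for e
  have "(\<Sum>e\<in>?A - ?L. c e * Y e) = (\<Sum>e\<in>?A. f e)"
    using finite_all_edges[of "{1..n}"] by (intro sum.mono_neutral_cong_left) (auto simp: f_def)
  also have "\<dots> = (\<Sum>e\<in>all_edges ?S. f e) + (\<Sum>v\<in>?I. \<Sum>u\<in>?S. f {u, v} + f {u, v + J}) + (\<Sum>e\<in>?L. f e)"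
    by (rule sum_split_edges[OF assms(1)])
  also have "(\<Sum>e\<in>?L. f e) = 0" by (simp add: f_def)
  also have "(\<Sum>e\<in>all_edges ?S. f e) = (\<Sum>e\<in>all_edges ?S. (\<Sum>v\<in>e. s v) * Y e)"
  proof (intro sum.cong refl)
    fix e assume e: "e \<in> all_edges ?S"
    then have "e \<subseteq> ?S" "e \<notin> ?L" by (auto simp: all_edges_def late_edges_def)
    moreover from this have "(\<Sum>v\<in>e. s v) = (\<Sum>v\<in>e \<inter> ?S. x v)"
      by (intro sum.cong) (auto simp: s_def gsign_def)
    ultimately show "f e = (\<Sum>v\<in>e. s v) * Y e" by (simp add: f_def c_def)
  qed
  also have "(\<Sum>v\<in>?I. \<Sum>u\<in>?S. f {u, v} + f {u, v + J}) =
     (\<Sum>v\<in>?I. \<Sum>u\<in>?S. x u * Y {u, v} + x u * Y {u, v + J})"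
  proof (intro sum.cong refl arg_cong2[of _ _ _ _ plus])
    fix u v assume uv: "v \<in> ?I" "u \<in> ?S"
    then have "{u, v} \<in> block ?S v (v + J)" "{u, v + J} \<in> block ?S v (v + J)" by (auto simp: block_def)
    then have "{u, v} \<notin> ?L" "{u, v + J} \<notin> ?L"
      using uv(1) unfolding late_edges_def mid_edges_def by blast+
    moreover have "{u, v} \<inter> ?S = {u}" "{u, v + J} \<inter> ?S = {u}" using uv by auto
    ultimately show "f {u, v} = x u * Y {u, v}" "f {u, v + J} = x u * Y {u, v + J}"
      by (simp_all add: f_def c_def)
  qed
  finally have fixed: "(\<Sum>e\<in>?A - ?L. c e * Y e) = (\<Sum>e\<in>all_edges ?S. (\<Sum>v\<in>e. s v) * Y e) +
     (\<Sum>v\<in>?I. \<Sum>u\<in>?S. x u * Y {u, v} + x u * Y {u, v + J})" by simp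
  have "(\<Sum>u\<in>?S. (\<Sum>w\<in>{u, v}. s w) * Y {u, v} + (\<Sum>w\<in>{u, v + J}. s w) * Y {u, v + J}) =
     (\<Sum>u\<in>?S. x u * Y {u, v} + x u * Y {u, v + J}) + sgn1 (zsum ?S x v (v + J) X) * zsum ?S (\<lambda>_. 1) v (v + J) X"
    if v: "v \<in> ?I" for v
  proof -
    have "(\<Sum>u\<in>?S. (\<Sum>w\<in>{u, v}. s w) * Y {u, v} + (\<Sum>w\<in>{u, v + J}. s w) * Y {u, v + J}) =
      (\<Sum>u\<in>?S. (x u * Y {u, v} + x u * Y {u, v + J}) +
         sgn1 (zsum ?S x v (v + J) X) * (1 * (of_bool ({u, v} \<in> X) - of_bool ({u, v + J} \<in> X))))"
    proof (intro sum.cong refl)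
      fix u assume u: "u \<in> ?S"
      then have "u \<noteq> v" "u \<noteq> v + J" "s u = x u" using v by (auto simp: s_def gsign_def)
      then show "(\<Sum>w\<in>{u, v}. s w) * Y {u, v} + (\<Sum>w\<in>{u, v + J}. s w) * Y {u, v + J} =
         (x u * Y {u, v} + x u * Y {u, v + J}) +
         sgn1 (zsum ?S x v (v + J) X) * (1 * (of_bool ({u, v} \<in> X) - of_bool ({u, v + J} \<in> X)))"
        using gsign_pair[OF v, of x X, folded s_def] by (simp add: Y_def algebra_simps)
    qed
    then show ?thesis by (simp add: sum.distrib zsum_def sum_distrib_left)
  qed
  then have "(\<Sum>e\<in>?A. (\<Sum>v\<in>e. s v) * Y e) = (\<Sum>e\<in>all_edges ?S. (\<Sum>v\<in>e. s v) * Y e) +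
     ((\<Sum>v\<in>?I. \<Sum>u\<in>?S. x u * Y {u, v} + x u * Y {u, v + J}) +
      (\<Sum>v\<in>?I. sgn1 (zsum ?S x v (v + J) X) * zsum ?S (\<lambda>_. 1) v (v + J) X)) + (\<Sum>e\<in>?L. (\<Sum>v\<in>e. s v) * Y e)"
    unfolding sum_split_edges[OF assms(1)] by (simp add: sum.distrib)
  then show ?thesis using fixed unfolding Y_def c_def by linarith
qed

definition halves :: "nat \<Rightarrow> nat \<Rightarrow> real" where
  "halves h u = (if u \<le> h then 1 else -1)"

text \<open>The involution that serves as \<open>\<rho>\<close> in \<open>EE_sgn1_zsum\<close>; it
  fixes all vertices outside the core.\<close>

definition swap_halves :: "nat \<Rightarrow> nat \<Rightarrow> nat" where
  "swap_halves h u = (if u = 0 \<or> u > 2 * h then u else if u \<le> h then u + h else u - h)"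

lemma swap_halves:
  "swap_halves h (swap_halves h u) = u"
  "u \<in> {1..2 * h} \<Longrightarrow> swap_halves h u \<in> {1..2 * h}"
  "u > 2 * h \<Longrightarrow> swap_halves h u = u"
  "u \<in> {1..2 * h} \<Longrightarrow> halves h (swap_halves h u) = - halves h u"
  by (auto simp: swap_halves_def halves_def)

lemma sum_halves: "(\<Sum>u\<in>{1..2 * h}. halves h u) = 0"
proof -
  have "bij_betw (swap_halves h) {1..2 * h} {1..2 * h}"
    by (rule bij_betw_byWitness[where f' = "swap_halves h"]) (use swap_halves in auto)
  then have "(\<Sum>u\<in>{1..2 * h}. halves h u) = (\<Sum>u\<in>{1..2 * h}. halves h (swap_halves h u))"
    by (rule sum.reindex_bij_betw[symmetric])
  also have "\<dots> = - (\<Sum>u\<in>{1..2 * h}. halves h u)"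
    unfolding sum_negf[symmetric] by (intro sum.cong refl swap_halves(4))
  finally show ?thesis by simp
qed

text \<open>The means vanish by symmetry, so only the squares remain, and these lose the greedy
  sign: what is left is the variance of the walk.\<close>

lemma EE_sum_sgn1_zsum:
  assumes "2 * h + 2 * J \<le> n" "0 \<le> p" "p \<le> 1"
  shows "EE p (all_edges {1..n}) (\<lambda>X. (\<Sum>v\<in>{2*h+1..2*h+J}.
     sgn1 (zsum {1..2*h} (halves h) v (v + J) X) * zsum {1..2*h} (\<lambda>_. 1) v (v + J) X)\<^sup>2)
     = J * (2 * h) * (2 * p * (1 - p))"
proof -
  let ?S = "{1..2*h}" and ?I = "{2*h+1..2*h+J}"
  let ?B = "\<lambda>v. block ?S v (v + J)" and ?M = "mid_edges (2 * h) J"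
  define F where "F v X = sgn1 (zsum ?S (halves h) v (v + J) X) * zsum ?S (\<lambda>_. 1) v (v + J) X" for v X
  have FB: "F v X = F v (X \<inter> ?B v)" for v X
  proof -
    have "zsum ?S y v (v + J) X = zsum ?S y v (v + J) (X \<inter> ?B v)" for y by (rule zsum_cong) auto
    then show ?thesis unfolding F_def by metis
  qed
  have "F v X = F v (X \<inter> ?M)" if "v \<in> ?I" for v X
  proof -
    have "X \<inter> ?M \<inter> ?B v = X \<inter> ?B v" using that unfolding mid_edges_def by blast
    then show ?thesis using FB[of v X] FB[of v "X \<inter> ?M"] by simp
  qed
  then have "EE p (all_edges {1..n}) (\<lambda>X. (\<Sum>v\<in>?I. F v X)\<^sup>2) = EE p (all_edges {1..n}) (\<lambda>X. (\<Sum>v\<in>?I. F v (X \<inter> ?M))\<^sup>2)"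
    by (intro EE_cong arg_cong[of _ _ "\<lambda>x. x\<^sup>2"] sum.cong refl)
  also have "\<dots> = EE p ?M (\<lambda>X. (\<Sum>v\<in>?I. F v X)\<^sup>2)"
    using mid_subset[OF assms(1)] by (intro EE_restrict) (auto simp: finite_all_edges)
  also have "\<dots> = EE p ?M (\<lambda>X. (\<Sum>v\<in>?I. F v (X \<inter> ?B v))\<^sup>2)"
    by (intro EE_cong arg_cong[of _ _ "\<lambda>x. x\<^sup>2"] sum.cong refl FB)
  also have "\<dots> = (\<Sum>v\<in>?I. EE p (?B v) (\<lambda>X. (F v X)\<^sup>2))"
    unfolding mid_edges_def
  proof (intro EE_indep_sum_square block_disjoint)
    fix v assume v: "v \<in> ?I"
    show "EE p (?B v) (F v) = 0"
      unfolding F_def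
    proof (rule EE_sgn1_zsum[where \<rho> = "swap_halves h"])
      show "u \<in> ?S \<Longrightarrow> swap_halves h u \<in> ?S" "u \<in> ?S \<Longrightarrow> halves h (swap_halves h u) = - halves h u" for u
        by (rule swap_halves; assumption)+
    qed (use v in \<open>auto simp: swap_halves(1,3)\<close>)
  qed auto
  also have "\<dots> = (\<Sum>v\<in>?I. real (2 * h) * (2 * p * (1 - p)))"
  proof (intro sum.cong refl)
    fix v assume v: "v \<in> ?I"
    have "EE p (?B v) (\<lambda>X. (F v X)\<^sup>2) = EE p (?B v) (\<lambda>X. (0 + zsum ?S (\<lambda>_. 1) v (v + J) X)\<^sup>2)"
      by (simp add: F_def power_mult_distrib)
    also have "\<dots> = walk (2 * p * (1 - p)) (card ?S) (\<lambda>z. z\<^sup>2) 0"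
      using v by (intro EE_zsum[where f = "\<lambda>z. z\<^sup>2"]) auto
    finally show "EE p (?B v) (\<lambda>X. (F v X)\<^sup>2) = real (2 * h) * (2 * p * (1 - p))"
      by (simp add: walk_square)
  qed
  finally show ?thesis by (simp add: F_def)
qed

lemma abs_prod_edge_le:
  assumes "\<And>v. s v = 1 \<or> s v = (-1::real)"
  shows "\<bar>\<Prod>v\<in>e. s v\<bar> \<le> 1"
proof -
  have "\<bar>s v\<bar> = 1" for v using assms[of v] by auto
  then show ?thesis by (simp add: abs_prod)
qed

lemma abs_sum_edge_le:
  assumes "\<And>v. s v = 1 \<or> s v = (-1::real)" "e \<in> all_edges V" "A \<subseteq> e"
  shows "\<bar>\<Sum>v\<in>A. s v\<bar> \<le> 2"
proof -
  have e: "card e = 2" using assms by (auto simp: all_edges_def)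
  then have "finite e" using card.infinite by fastforce
  have "\<bar>s v\<bar> = 1" for v using assms(1)[of v] by auto
  then have "\<bar>\<Sum>v\<in>A. s v\<bar> \<le> real (card A)" using sum_abs[of s A] by simp
  also have "real (card A) \<le> 2" using card_mono[OF \<open>finite e\<close> assms(3)] e by simp
  finally show ?thesis .
qed

lemma EE_fixed_linear_square:
  assumes "0 \<le> p" "p \<le> 1" "B \<subseteq> all_edges {1..n}" "\<And>e. e \<in> B \<Longrightarrow> \<bar>c e\<bar> \<le> M"
  shows "EE p (all_edges {1..n}) (\<lambda>X. (\<Sum>e\<in>B. c e * (of_bool (e \<in> X) - p))\<^sup>2)
    \<le> M\<^sup>2 * ((real n)\<^sup>2 / 2) * (p * (1 - p))"
proof -
  have fin: "finite (all_edges {1..n})" by (simp add: finite_all_edges)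
  have "EE p (all_edges {1..n}) (\<lambda>X. (\<Sum>e\<in>B. c e * (of_bool (e \<in> X) - p))\<^sup>2) \<le> M\<^sup>2 * card B * (p * (1 - p))"
    using EE_linear_square_le[OF fin assms(3,1,2), of "\<lambda>_. c"] assms(4) by simp
  also have "\<dots> \<le> M\<^sup>2 * ((real n)\<^sup>2 / 2) * (p * (1 - p))"
  proof -
    have "real (card B) \<le> real (card (all_edges {1..n}))" using fin assms by (simp add: card_mono)
    also have "\<dots> \<le> (real n)\<^sup>2 / 2" by (simp add: card_all_edges power2_eq_square algebra_simps)
    finally show ?thesis using assms by (intro mult_right_mono mult_left_mono) auto
  qed
  finally show ?thesis .
qed

text \<open>Budget in units of \<open>n * g\<close>, where \<open>g\<close> is sqrt(n p (1 - p)):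
  \<open>2 * W\<close> gives 0.116, the deficit \<open>p * n\<close> costs at most 0.02 and the
  degree term at most 0.024. At least 0.06 remains, and 0.06 / (4 * 0.74) exceeds 1/50.\<close>

lemma dense_arith:
  fixes n p g W b \<sigma> m \<mu> :: real
  assumes n: "n \<ge> 1000" and p: "0 < p" "p \<le> 1" and g: "(7 / 10) \<le> g" "50 * p \<le> g"
    and W: "W \<ge> (11 / 125) * n * g - (3 / 100) * n * g"
    and s: "0 \<le> \<sigma>" "\<sigma> \<le> 1" and b: "b\<^sup>2 \<le> (9 / 2000) * p * n ^ 3 * g"
    and m: "(1 / 4) * p * n\<^sup>2 \<le> m" "m \<le> (37 / 50) * p * n\<^sup>2"
  shows "(1 / 50) * (g / (p * n)) \<le> (2 * W + p * (\<sigma>\<^sup>2 - n) - (b + p * (n - 1) * \<sigma>)\<^sup>2 / (2 * m)) / (4 * m)"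
proof -
  have "0 < (1 / 4) * p * n\<^sup>2" using p n by simp
  then have m0: "m > 0" using m(1) by linarith
  have pn: "p * n \<le> (1 / 50) * n * g"
    using mult_right_mono[OF g(2), of n] n by (simp add: algebra_simps)
  have "(p * (n - 1) * \<sigma>)\<^sup>2 \<le> (p * n)\<^sup>2"
  proof (intro power_mono)
    have "p * (n - 1) * \<sigma> \<le> (p * n) * 1" using n p s by (intro mult_mono) auto
    then show "p * (n - 1) * \<sigma> \<le> p * n" by simp
  qed (use n p s in auto)
  moreover have "(b + p * (n - 1) * \<sigma>)\<^sup>2 \<le> 2 * b\<^sup>2 + 2 * (p * (n - 1) * \<sigma>)\<^sup>2"
    using sum_squares_bound[of b "p * (n - 1) * \<sigma>"] by (simp add: power2_sum)
  ultimately have "(b + p * (n - 1) * \<sigma>)\<^sup>2 \<le> (9 / 1000) * p * n ^ 3 * g + 2 * (p * n)\<^sup>2" using b by linarith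
  also have "\<dots> = ((9 / 500) * n * g + 4 * p) * ((1 / 2) * p * n\<^sup>2)"
    by (simp add: power2_eq_square power3_eq_cube algebra_simps)
  also have "\<dots> \<le> ((9 / 500) * n * g + 4 * p) * (2 * m)"
    using m n g p by (intro mult_left_mono) auto
  finally have "(b + p * (n - 1) * \<sigma>)\<^sup>2 / (2 * m) \<le> (9 / 500) * n * g + 4 * p"
    using m0 by (simp add: divide_le_eq)
  also have "4 * p \<le> (3 / 500) * (1000 * (7 / 10))" using p by simp
  also have "\<dots> \<le> (3 / 500) * (n * g)" using n g by (intro mult_left_mono mult_mono) auto
  finally have D: "(b + p * (n - 1) * \<sigma>)\<^sup>2 / (2 * m) \<le> (3 / 125) * (n * g)" by (simp add: mult.commute)
  have "0 \<le> p * \<sigma>\<^sup>2" using p by simp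
  have T: "(3 / 50) * (n * g) \<le> 2 * W + p * (\<sigma>\<^sup>2 - n) - (b + p * (n - 1) * \<sigma>)\<^sup>2 / (2 * m)"
  proof -
    have "58 / 1000 * (n * g) \<le> W" using W by (simp add: algebra_simps)
    moreover have "p * n \<le> 1 / 50 * (n * g)" using pn by (simp add: algebra_simps)
    moreover have "p * (\<sigma>\<^sup>2 - n) = p * \<sigma>\<^sup>2 - p * n" by (simp add: algebra_simps)
    moreover have "0 \<le> n * g" using n g by simp
    ultimately show ?thesis using D \<open>0 \<le> p * \<sigma>\<^sup>2\<close> by linarith
  qed
  have "(1 / 50) * (g / (p * n)) = (1 / 50) * (g * n) / (p * n\<^sup>2)" using n p by (simp add: power2_eq_square)
  also have "\<dots> \<le> (3 / 50) * (n * g) / (4 * ((37 / 50) * p * n\<^sup>2))"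
  proof -
    have "(1 / 50) * (g * n) \<le> (3 / 50) / (4 * (37 / 50)) * (n * g)" using n g by simp
    then have "(1 / 50) * (g * n) / (p * n\<^sup>2) \<le> (3 / 50) / (4 * (37 / 50)) * (n * g) / (p * n\<^sup>2)"
      using p by (intro divide_right_mono) auto
    then show ?thesis by (simp add: mult.commute)
  qed
  also have "\<dots> \<le> (3 / 50) * (n * g) / (4 * m)"
    using m m0 n g by (intro divide_left_mono) auto
  also have "\<dots> \<le> (2 * W + p * (\<sigma>\<^sup>2 - n) - (b + p * (n - 1) * \<sigma>)\<^sup>2 / (2 * m)) / (4 * m)"
    using T m0 by (intro divide_right_mono) auto
  finally show ?thesis .
qed

lemma dense_regime:
  fixes n :: nat and p :: real
  assumes n: "n \<ge> 1000" and p1: "1 / n \<le> p" and q2500: "2500 / n \<le> 1 - p"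
  shows "EE p (all_edges {1..n}) (\<lambda>X. of_bool (\<not> 1 / 50 * sqrt ((1 - p) / (n * p)) \<le> modularity {1..n} X))
    \<le> 60000 / n"
proof -
  let ?A = "all_edges {1..n}"
  define q where "q = 1 - p"
  define g where "g = sqrt (n * p * q)"
  \<comment> \<open>About half of the vertices are paired. The core has the even size
    \<open>2 * h\<close>, so its halves balance exactly, and at most one vertex is left
    over.\<close>
  define J where "J = n div 4"
  define h where "h = (n - 2 * J) div 2"
  define r where "r = 2 * p * q"
  define \<mu> where "\<mu> = walk r (2 * h) abs 0"
  let ?S = "{1..2*h}" and ?I = "{2*h+1..2*h+J}" and ?L = "late_edges (2 * h) J n" and ?x = "halves h"
  define s where "s X = gsign (2 * h) J ?x X" for X
  have hJ: "2 * h + 2 * J \<le> n" "n \<le> 2 * h + 2 * J + 1" by (auto simp: h_def J_def)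
  have n0: "real n \<ge> 1000" using n by simp
  have "4 * J + 3 \<ge> n" "4 * J \<le> n" by (auto simp: J_def)
  then have Jr: "24 / 100 * real n \<le> J" "4 * real J \<le> n" using n0 by linarith+
  have "2 * real h \<ge> n - 2 * real J - 1" using hJ by linarith
  then have hr: "49 / 100 * real n \<le> 2 * real h" "2 * real h \<le> n" using Jr n0 hJ by linarith+
  have q: "2500 \<le> n * q" "q \<le> 1" "q > 0"
  proof -
    show "2500 \<le> n * q" using q2500 n0 by (simp add: q_def field_simps)
    then have "0 < n * q" by linarith
    then show "q > 0" using n0 by (simp add: zero_less_mult_iff)
    have "0 < 1 / real n" using n0 by simp
    then show "q \<le> 1" using p1 unfolding q_def by linarith
  qed
  have p: "1 \<le> n * p" "p > 0" "p \<le> 1"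
  proof -
    show "1 \<le> n * p" using p1 n0 by (simp add: field_simps)
    have "0 < 1 / real n" using n0 by simp
    then show "p > 0" using p1 by linarith
    show "p \<le> 1" using q by (simp add: q_def)
  qed
  have g2: "g\<^sup>2 = n * p * q" using p q by (simp add: g_def)
  have g0: "0 \<le> g" using p q by (simp add: g_def)
  have npq: "1 / 2 \<le> n * p * q"
  proof (cases "p \<le> 1 / 2")
    case True
    then have "1 * (1 / 2) \<le> (n * p) * q" using p by (intro mult_mono) (auto simp: q_def)
    then show ?thesis by simp
  next
    case False
    then have "2500 * (1 / 2) \<le> (n * q) * p" using q by (intro mult_mono) auto
    then show ?thesis by (simp add: mult_ac)
  qed
  have g7: "7 / 10 \<le> g" unfolding g_def by (rule real_le_rsqrt) (use npq in \<open>simp add: power2_eq_square\<close>)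
  \<comment> \<open>Here 2500 = 50^2 enters: the deficit \<open>p * n\<close> becomes at most
    \<open>n * g / 50\<close>.\<close>
  have g50: "50 * p \<le> g"
  proof (unfold g_def, rule real_le_rsqrt)
    have "(50 * p)\<^sup>2 = 2500 * (p * p)" by (simp add: power2_eq_square)
    also have "\<dots> \<le> (n * q) * (p * 1)" using p q by (intro mult_mono) auto
    finally show "(50 * p)\<^sup>2 \<le> n * p * q" by (simp add: mult_ac)
  qed
  have r: "0 \<le> r" "r \<le> 1"
  proof -
    show "0 \<le> r" using p q by (simp add: r_def)
    have "0 \<le> (1 - 2 * p)\<^sup>2" by simp
    then show "r \<le> 1" by (simp add: r_def q_def power2_eq_square algebra_simps)
  qed
  have Nr: "98 / 100 * (n * p * q) \<le> real (2 * h) * r"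
  proof -
    have "(49 / 100 * n) * (2 * p * q) \<le> (2 * real h) * (2 * p * q)" using hr p q by (intro mult_right_mono) auto
    then show ?thesis by (simp add: r_def mult_ac)
  qed
  \<comment> \<open>The constant comes from 0.37^2 < 0.98 / 7.\<close>
  have mu: "37 / 100 * g \<le> \<mu>"
  proof -
    have "37 / 100 * g \<le> sqrt (real (2 * h) * r / 7)"
    proof (rule real_le_rsqrt)
      have "(37 / 100 * g)\<^sup>2 = (37 / 100)\<^sup>2 * (n * p * q)" by (simp only: power_mult_distrib g2)
      also have "\<dots> \<le> (98 / 100 / 7) * (n * p * q)" using p q by (intro mult_right_mono) (auto simp: power2_eq_square)
      also have "\<dots> \<le> real (2 * h) * r / 7" using Nr by simp
      finally show "(37 / 100 * g)\<^sup>2 \<le> real (2 * h) * r / 7" .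
    qed
    also have "\<dots> \<le> \<mu>" unfolding \<mu>_def using Nr npq r by (intro walk_abs_ge_sqrt) auto
    finally show ?thesis .
  qed
  have Jmu: "88 / 1000 * n * g \<le> J * \<mu>"
  proof -
    have "(24 / 100 * n) * (37 / 100 * g) \<le> J * \<mu>" using Jr mu g0 by (intro mult_mono) auto
    moreover have "0 \<le> n * g" using g0 by simp
    ultimately show ?thesis by (simp add: algebra_simps)
  qed
  define Y where "Y X e = of_bool (e \<in> X) - p" for X :: "nat set set" and e
  define f1 where "f1 X = (\<Sum>v\<in>?I. \<bar>zsum ?S ?x v (v + J) X\<bar>) - J * \<mu>" for X
  define f2 where "f2 X = (\<Sum>e\<in>all_edges ?S. (\<Prod>v\<in>e. ?x v) * Y X e)" for X
  define f3 where "f3 X = (\<Sum>e\<in>?L. (\<Prod>v\<in>e. s X v) * Y X e)" for X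
  define f4 where "f4 X = (\<Sum>e\<in>?A - ?L. (\<Sum>v\<in>e \<inter> ?S. ?x v) * Y X e)" for X
  define f5 where "f5 X = (\<Sum>v\<in>?I. sgn1 (zsum ?S ?x v (v + J) X) * zsum ?S (\<lambda>_. 1) v (v + J) X)" for X
  define f6 where "f6 X = (\<Sum>e\<in>?L. (\<Sum>v\<in>e. s X v) * Y X e)" for X
  define f7 where "f7 X = (\<Sum>e\<in>?A. 1 * Y X e)" for X
  \<comment> \<open>Tolerances for the three parts of \<open>W\<close>, the three parts of the
    centred degree sum, and the number of edges. All second moments are at most twice
    \<open>n\<^sup>2 * (p * q)\<close>, so each failure probability is of order
    \<open>1 / n\<close>.\<close>
  define t where "t = 1 / 100 * n * g"
  define u where "u = sqrt (1 / 2000 * p * real n ^ 3 * g)"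
  define w where "w = 24 / 100 * p * (real n)\<^sup>2"
  have x1: "?x v = 1 \<or> ?x v = -1" for v by (simp add: halves_def)
  have s1: "s X v = 1 \<or> s X v = -1" for X v unfolding s_def by (rule gsign_cases[OF x1])
  have pos: "t > 0" "u > 0" "w > 0" using n0 g7 p by (auto simp: t_def u_def w_def)
  have q': "1 - p = q" by (simp add: q_def)
  define B where "B = real n ^ 2 * (p * q)"
  have B0: "0 \<le> B" using p q by (simp add: B_def)
  have JN: "J * (2 * h) * (2 * p * q) \<le> B"
  proof -
    have "real J * (2 * real h) \<le> (n / 4) * n" using Jr hr by (intro mult_mono) auto
    also have "\<dots> \<le> n\<^sup>2 / 2" by (simp add: power2_eq_square)
    finally have "real J * (2 * real h) * (2 * (p * q)) \<le> n\<^sup>2 / 2 * (2 * (p * q))" using p q by (intro mult_right_mono) auto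
    then show ?thesis by (simp add: B_def algebra_simps)
  qed
  have V1: "EE p ?A (\<lambda>X. (f1 X)\<^sup>2) \<le> B"
    using EE_sum_abs_zsum[of "2 * h" J n p "\<lambda>_. ?x"] hJ p x1 JN by (simp add: f1_def \<mu>_def r_def q')
  have V2: "EE p ?A (\<lambda>X. (f2 X)\<^sup>2) \<le> 1\<^sup>2 * ((real n)\<^sup>2 / 2) * (p * (1 - p))"
    unfolding f2_def Y_def using p hJ x1 all_edges_mono[of ?S "{1..n}"]
    by (intro EE_fixed_linear_square abs_prod_edge_le) auto
  have V3: "EE p ?A (\<lambda>X. (f3 X)\<^sup>2) \<le> 1\<^sup>2 * ((real n)\<^sup>2 / 2) * (p * (1 - p))"
    unfolding f3_def Y_def s_def using p x1
    by (intro EE_sum_late[OF hJ(1), where x = "\<lambda>_. ?x" and h = "\<lambda>s e. \<Prod>v\<in>e. s v"] abs_prod_edge_le) auto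
  have V4: "EE p ?A (\<lambda>X. (f4 X)\<^sup>2) \<le> 2\<^sup>2 * ((real n)\<^sup>2 / 2) * (p * (1 - p))"
    unfolding f4_def Y_def using p
    by (intro EE_fixed_linear_square abs_sum_edge_le[OF x1, of _ "{1..n}"]) auto
  have V5: "EE p ?A (\<lambda>X. (f5 X)\<^sup>2) \<le> B"
    using EE_sum_sgn1_zsum[OF hJ(1), of p] p JN by (simp add: f5_def q')
  have V6: "EE p ?A (\<lambda>X. (f6 X)\<^sup>2) \<le> 2\<^sup>2 * ((real n)\<^sup>2 / 2) * (p * (1 - p))"
    unfolding f6_def Y_def s_def using p x1
    by (intro EE_sum_late[OF hJ(1), where x = "\<lambda>_. ?x" and h = "\<lambda>s e. \<Sum>v\<in>e. s v"] abs_sum_edge_le[of _ _ "{1..n}"]) auto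
  have V7: "EE p ?A (\<lambda>X. (f7 X)\<^sup>2) \<le> 1\<^sup>2 * ((real n)\<^sup>2 / 2) * (p * (1 - p))"
    unfolding f7_def Y_def using p by (intro EE_fixed_linear_square) auto
  have Bt: "B / t\<^sup>2 = 10000 / n"
  proof -
    have t2: "t\<^sup>2 = (1 / 10000 * n) * B"
      unfolding t_def B_def power_mult_distrib g2 by (simp add: power2_eq_square)
    have "B > 0" using p q n0 by (simp add: B_def)
    then show ?thesis unfolding t2 using n0 by (simp add: field_simps)
  qed
  have u2: "u\<^sup>2 = 1 / 2000 * p * real n ^ 3 * g" using p g0 by (simp add: u_def)
  have Bu: "2 * B / u\<^sup>2 \<le> 8000 / n"
  proof -
    have "2 * B / u\<^sup>2 = 4000 * q / (n * g)"
      unfolding u2 B_def using p n0 g7 by (simp add: field_simps power2_eq_square power3_eq_cube)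
    also have "\<dots> \<le> 4000 * 1 / (n * (1 / 2))"
      using q n0 g7 by (intro frac_le mult_left_mono) auto
    finally show ?thesis by simp
  qed
  have Bw: "B / w\<^sup>2 \<le> 20 / n"
  proof -
    have "B / w\<^sup>2 = (10000 / 576) * q / (n * (n * p))"
      unfolding w_def B_def using p n0 by (simp add: field_simps power2_eq_square)
    also have "\<dots> \<le> (20 * 1) / (n * 1)"
      using q n0 p by (intro frac_le mult_mono) auto
    finally show ?thesis by simp
  qed
  have half: "1\<^sup>2 * ((real n)\<^sup>2 / 2) * (p * (1 - p)) \<le> B" "2\<^sup>2 * ((real n)\<^sup>2 / 2) * (p * (1 - p)) = 2 * B"
    using B0 by (auto simp: B_def q' mult_ac)
  have tail: "EE p ?A (\<lambda>X. of_bool (c \<le> \<bar>f X\<bar>)) \<le> \<delta>"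
    if "EE p ?A (\<lambda>X. (f X)\<^sup>2) \<le> V" "V \<le> V'" "0 < c" "V' / c\<^sup>2 \<le> \<delta>" for f c \<delta> V V'
    using that p by (intro EE_tail[of p ?A f V']) auto
  have P: "EE p ?A (\<lambda>X. of_bool (t \<le> \<bar>f1 X\<bar>)) \<le> 10000 / n" "EE p ?A (\<lambda>X. of_bool (t \<le> \<bar>f2 X\<bar>)) \<le> 10000 / n"
    "EE p ?A (\<lambda>X. of_bool (t \<le> \<bar>f3 X\<bar>)) \<le> 10000 / n" "EE p ?A (\<lambda>X. of_bool (u \<le> \<bar>f4 X\<bar>)) \<le> 8000 / n"
    "EE p ?A (\<lambda>X. of_bool (u \<le> \<bar>f5 X\<bar>)) \<le> 8000 / n" "EE p ?A (\<lambda>X. of_bool (u \<le> \<bar>f6 X\<bar>)) \<le> 8000 / n"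
    "EE p ?A (\<lambda>X. of_bool (w \<le> \<bar>f7 X\<bar>)) \<le> 20 / n"
    using tail[OF V1 order_refl pos(1) Bt[THEN eq_refl]] tail[OF V2 half(1) pos(1) Bt[THEN eq_refl]]
      tail[OF V3 half(1) pos(1) Bt[THEN eq_refl]] tail[OF V4 half(2)[THEN eq_refl] pos(2) Bu]
      tail[OF V5 _ pos(2) Bu] tail[OF V6 half(2)[THEN eq_refl] pos(2) Bu] tail[OF V7 half(1) pos(3) Bw] B0
    by auto
  have good: "1 / 50 * sqrt (q / (n * p)) \<le> modularity {1..n} X"
    if X: "X \<subseteq> ?A" and ev: "\<bar>f1 X\<bar> < t" "\<bar>f2 X\<bar> < t" "\<bar>f3 X\<bar> < t" "\<bar>f4 X\<bar> < u" "\<bar>f5 X\<bar> < u" "\<bar>f6 X\<bar> < u" "\<bar>f7 X\<bar> < w"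
    for X
  proof -
    define m where "m = real (card X)"
    define \<sigma> where "\<sigma> = (\<Sum>v\<in>{1..n}. s X v)"
    define W where "W = (\<Sum>e\<in>?A. (\<Prod>v\<in>e. s X v) * (of_bool (e \<in> X) - p))"
    define b where "b = (\<Sum>e\<in>?A. (\<Sum>v\<in>e. s X v) * (of_bool (e \<in> X) - p))"
    have "f7 X = m - p * (real n * (real n - 1) / 2)"
    proof -
      have "f7 X = (\<Sum>e\<in>?A. of_bool (e \<in> X)) - p * card ?A"
        by (simp add: f7_def Y_def sum_subtractf)
      also have "(\<Sum>e\<in>?A. of_bool (e \<in> X)) = m"
        using X finite_all_edges[of "{1..n}"] by (simp add: m_def Int_absorb1)
      finally show ?thesis by (simp add: card_all_edges)
    qed
    moreover have "49 / 100 * (p * (real n)\<^sup>2) \<le> p * (real n * (real n - 1) / 2)" "p * (real n * (real n - 1) / 2) \<le> 1 / 2 * (p * (real n)\<^sup>2)"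
    proof -
      have "1000 * (p * n) \<le> n * (p * n)" using n0 p by (intro mult_right_mono) auto
      moreover have "p * (real n * (real n - 1) / 2) = 1 / 2 * (n * (p * n)) - 1 / 2 * (p * n)"
        "p * (real n)\<^sup>2 = n * (p * n)" by (simp_all add: power2_eq_square field_simps)
      moreover have "0 \<le> p * n" using p by simp
      ultimately show "49 / 100 * (p * (real n)\<^sup>2) \<le> p * (real n * (real n - 1) / 2)"
        "p * (real n * (real n - 1) / 2) \<le> 1 / 2 * (p * (real n)\<^sup>2)" by linarith+
    qed
    ultimately have m: "1 / 4 * p * (real n)\<^sup>2 \<le> m" "m \<le> 37 / 50 * p * (real n)\<^sup>2"
      using ev(7) unfolding w_def by linarith+
    have "0 < 1 / 4 * p * (real n)\<^sup>2" using p n0 by simp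
    then have "m > 0" using m(1) by linarith
    then have Xne: "X \<noteq> {}" by (auto simp: m_def)
    have "W = f2 X + (f1 X + J * \<mu>) + f3 X"
      unfolding W_def s_def sum_gsign_prod[OF hJ(1)] by (simp add: f1_def f2_def f3_def Y_def s_def)
    then have W: "88 / 1000 * n * g - 3 / 100 * n * g \<le> W" using ev Jmu unfolding t_def by linarith
    have sg: "0 \<le> \<sigma>" "\<sigma> \<le> 1"
      unfolding \<sigma>_def s_def sum_gsign[OF hJ] sum_halves using hJ by auto
    have "b = f4 X + f5 X + f6 X"
      unfolding b_def s_def sum_gsign_sum[OF hJ(1)] by (simp add: f4_def f5_def f6_def Y_def s_def)
    then have "\<bar>b\<bar> \<le> 3 * u" using ev by linarith
    then have "b\<^sup>2 \<le> (3 * u)\<^sup>2" using abs_le_square_iff[of b "3 * u"] pos by simp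
    then have b: "b\<^sup>2 \<le> 9 / 2000 * p * real n ^ 3 * g" by (simp add: power_mult_distrib u2)
    have "sqrt (q / (n * p)) = g / (p * n)"
    proof (rule real_sqrt_unique)
      show "(g / (p * n))\<^sup>2 = q / (n * p)"
        using p n0 by (simp add: power_divide g2) (simp add: field_simps power2_eq_square)
    qed (use g0 p in auto)
    also have "1 / 50 * (g / (p * n)) \<le> (2 * W + p * (\<sigma>\<^sup>2 - n) - (b + p * (real n - 1) * \<sigma>)\<^sup>2 / (2 * m)) / (4 * m)"
      using dense_arith[OF n0 p(2,3) g7 g50 _ sg b m, of W] W by simp
    also have "\<dots> \<le> modularity {1..n} X"
      using modularity_ge_centered[OF _ X Xne s1[of X], where p = p] by (simp add: W_def b_def m_def \<sigma>_def)
    finally show ?thesis .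
  qed
  have "EE p ?A (\<lambda>X. of_bool (\<not> 1 / 50 * sqrt (q / (n * p)) \<le> modularity {1..n} X)) \<le>
    EE p ?A (\<lambda>X. of_bool (t \<le> \<bar>f1 X\<bar>) + (of_bool (t \<le> \<bar>f2 X\<bar>) + (of_bool (t \<le> \<bar>f3 X\<bar>) +
      (of_bool (u \<le> \<bar>f4 X\<bar>) + (of_bool (u \<le> \<bar>f5 X\<bar>) + (of_bool (u \<le> \<bar>f6 X\<bar>) + of_bool (w \<le> \<bar>f7 X\<bar>)))))))"
  proof (rule EE_mono)
    fix X assume "X \<subseteq> ?A"
    note gX = good[OF this]
    show "of_bool (\<not> 1 / 50 * sqrt (q / (n * p)) \<le> modularity {1..n} X) \<le>
      (of_bool (t \<le> \<bar>f1 X\<bar>) + (of_bool (t \<le> \<bar>f2 X\<bar>) + (of_bool (t \<le> \<bar>f3 X\<bar>) +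
      (of_bool (u \<le> \<bar>f4 X\<bar>) + (of_bool (u \<le> \<bar>f5 X\<bar>) + (of_bool (u \<le> \<bar>f6 X\<bar>) + of_bool (w \<le> \<bar>f7 X\<bar>)))))) :: real)"
      by (intro of_bool_le_add) (use gX in \<open>auto simp: not_le[symmetric]\<close>)
  qed (use p in auto)
  also have "\<dots> \<le> 10000 / n + (10000 / n + (10000 / n + (8000 / n + (8000 / n + (8000 / n + 20 / n)))))"
    unfolding EE_add using P by (intro add_mono)
  also have "\<dots> \<le> 60000 / n" using n0 by (simp add: field_simps)
  finally show ?thesis by (simp add: q_def)
qed

section \<open>Bounded complement degree\<close>

text \<open>The quadratic Taylor bound is too weak at 1.99; it is used at a twentieth of that and
  raised to the power 20.\<close>

lemma exp_neg_199: "exp (- 199 / 100) \<le> (10 / 72 :: real)"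
proof -
  have "(72 / 10 :: real) \<le> (11044 / 10000) ^ 20" by (simp add: power_divide)
  also have "\<dots> \<le> exp (199 / 2000) ^ 20"
    using exp_lower_Taylor_quadratic[of "199 / 2000 :: real"] by (intro power_mono) (auto simp: power2_eq_square)
  also have "\<dots> = exp (199 / 100 :: real)" by (simp add: exp_of_nat_mult[symmetric])
  finally have "72 / 10 \<le> exp (199 / 100 :: real)" .
  moreover have "exp (- 199 / 100) = inverse (exp (199 / 100 :: real))" by (simp add: exp_minus[symmetric])
  ultimately show ?thesis using le_imp_inverse_le[of "72 / 10" "exp (199 / 100 :: real)"] by simp
qed

text \<open>Evaluates \<open>walk_abs_ge\<close> near \<open>N * r = 2\<close>: 3/2 - (10/72) *
  (7/2) - 1/500 is still above 1.01.\<close>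

lemma walk_abs_ge_101:
  assumes r: "0 \<le> r" "r \<le> 1 / 2000" and y: "199 / 100 \<le> N * r" "N * r \<le> 2"
  shows "101 / 100 \<le> walk r N abs 0"
proof -
  define y where "y = N * r"
  have y': "199 / 100 \<le> y" "y \<le> 2" using y by (auto simp: y_def)
  have "(1 - r) ^ N \<le> exp (- r) ^ N" using r exp_ge_add_one_self[of "- r"] by (intro power_mono) auto
  also have "\<dots> = exp (- y)" by (simp add: exp_of_nat_mult[symmetric] y_def)
  also have "\<dots> \<le> exp (- 199 / 100)" using y' by simp
  finally have u: "(1 - r) ^ N \<le> 10 / 72" using exp_neg_199 by linarith
  have y2: "y * y \<le> 2 * 2" using y' by (intro mult_mono) auto
  have "(1 - r) ^ N * (3 / 2 + y / 2 + y\<^sup>2 / 4) \<le> 10 / 72 * (7 / 2)"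
    using u y' y2 r by (intro mult_mono) (auto simp: power2_eq_square)
  moreover have "y * r * (2 + 3 * y) / 4 \<le> 2 / 1000"
  proof -
    have "y * r * (2 + 3 * y) \<le> 2 * (1 / 2000) * 8" using y' r by (intro mult_mono) auto
    then show ?thesis by linarith
  qed
  ultimately show ?thesis
    using walk_abs_ge[of r N] r unfolding y_def by linarith
qed

definition colouring :: "nat \<Rightarrow> nat set set \<Rightarrow> nat \<Rightarrow> real" where
  "colouring N X = (let H = all_edges {1..N} - X in
     SOME x :: nat \<Rightarrow> real. (\<forall>v. x v = 1 \<or> x v = -1) \<and>
      (\<forall>u v. {u, v} \<in> H - cycle_edges {1..N} H \<longrightarrow> x u \<noteq> x v) \<and>
      (\<Sum>v\<in>{1..N}. x v)\<^sup>2 \<le> card (conn_pairs {1..N} H))"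

lemma colouring:
  fixes X :: "nat set set" and N :: nat
  defines "H \<equiv> all_edges {1..N} - X" and "x \<equiv> colouring N X"
  shows "x v = 1 \<or> x v = -1"
    and "{u, v} \<in> H - cycle_edges {1..N} H \<Longrightarrow> x u \<noteq> x v"
    and "(\<Sum>v\<in>{1..N}. x v)\<^sup>2 \<le> card (conn_pairs {1..N} H)"
proof -
  have "\<exists>x :: nat \<Rightarrow> real. (\<forall>v. x v = 1 \<or> x v = -1) \<and>
      (\<forall>u v. {u, v} \<in> H - cycle_edges {1..N} H \<longrightarrow> x u \<noteq> x v) \<and>
      (\<Sum>v\<in>{1..N}. x v)\<^sup>2 \<le> card (conn_pairs {1..N} H)"
    by (rule balanced_bridge_colouring) (auto simp: H_def)
  from someI_ex[OF this] show "x v = 1 \<or> x v = -1"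
    and "{u, v} \<in> H - cycle_edges {1..N} H \<Longrightarrow> x u \<noteq> x v"
    and "(\<Sum>v\<in>{1..N}. x v)\<^sup>2 \<le> card (conn_pairs {1..N} H)"
    unfolding x_def colouring_def Let_def H_def by blast+
qed

text \<open>The choice by \<open>SOME\<close> is made once for each set of missing edges in the
  core, so conditioning on the core edges fixes the colouring.\<close>

lemma colouring_Int: "colouring N (X \<inter> all_edges {1..N}) = colouring N X"
proof -
  have "all_edges {1..N} - X \<inter> all_edges {1..N} = all_edges {1..N} - X" by auto
  then show ?thesis by (simp add: colouring_def)
qed

lemma sum_centered_compl:
  fixes c :: "'a set \<Rightarrow> real"
  assumes "finite V"
  shows "(\<Sum>e\<in>all_edges V. c e * (of_bool (e \<in> X) - p)) =
    (1 - p) * (\<Sum>e\<in>all_edges V. c e) - (\<Sum>e\<in>all_edges V - X. c e)"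
proof -
  have "(\<Sum>e\<in>all_edges V. c e * (of_bool (e \<in> X) - p)) =
     - (\<Sum>e\<in>all_edges V. c e * (of_bool (e \<in> all_edges V - X) - (1 - p)))"
    unfolding sum_negf[symmetric] by (intro sum.cong) (auto simp: algebra_simps)
  then show ?thesis using sum_centered[OF assms, of "all_edges V - X" c "1 - p"] by simp
qed

text \<open>A missing edge that is a bridge has sign product -1 and so counts in favour; the other
  missing edges cost at most 2 each compared to that. The mean part costs at most
  \<open>N / 2\<close>, because the squared sum of the colours is nonnegative.\<close>

lemma sum_colouring_ge:
  fixes X :: "nat set set" and N :: nat and p :: real
  assumes p: "p \<le> 1"
  defines "A \<equiv> all_edges {1..N}" and "H \<equiv> all_edges {1..N} - X"
  shows "real (card H) - 2 * real (card (cycle_edges {1..N} H)) - (1 - p) * N / 2 \<le>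
    (\<Sum>e\<in>A. (\<Prod>v\<in>e. colouring N X v) * (of_bool (e \<in> X) - p))"
proof -
  let ?x = "colouring N X" and ?C = "cycle_edges {1..N} H"
  define w where "w e = (\<Prod>v\<in>e. ?x v)" for e
  have fA: "finite A" by (simp add: A_def finite_all_edges)
  have H: "H \<subseteq> A" "finite H" "?C \<subseteq> H" using fA by (auto simp: H_def A_def cycle_edges_def)
  have x: "?x v = 1 \<or> ?x v = -1" for v by (rule colouring(1))
  have wH: "w e = -1" if "e \<in> H - ?C" for e
  proof -
    have "e \<in> A" using that H by auto
    then obtain a b where e: "e = {a, b}" "a \<noteq> b" unfolding A_def by (rule all_edgesE)
    then have "?x a \<noteq> ?x b" using colouring(2)[of a b N X] that by (auto simp: H_def)
    then show ?thesis using e x[of a] x[of b] by (auto simp: w_def)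
  qed
  have "(\<Sum>e\<in>H. w e) = (\<Sum>e\<in>?C. w e) + (\<Sum>e\<in>H - ?C. w e)"
    using H by (metis add.commute sum.subset_diff)
  also have "(\<Sum>e\<in>H - ?C. w e) = - real (card (H - ?C))" using wH by simp
  also have "(\<Sum>e\<in>?C. w e) \<le> (\<Sum>e\<in>?C. 1)"
    using abs_prod_edge_le[of ?x, OF x] by (intro sum_mono) (auto simp: w_def intro: order_trans[OF abs_ge_self])
  also have "real (card (H - ?C)) = real (card H) - real (card ?C)"
    using H by (simp add: card_Diff_subset finite_subset of_nat_diff card_mono)
  finally have sH: "(\<Sum>e\<in>H. w e) \<le> 2 * real (card ?C) - real (card H)" by simp
  have "(\<Sum>v\<in>{1..N}. (?x v)\<^sup>2) = (\<Sum>v\<in>{1..N}. 1)"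
  proof (rule sum.cong)
    fix v show "(?x v)\<^sup>2 = 1" using x[of v] by auto
  qed simp
  then have "(\<Sum>e\<in>A. w e) = ((\<Sum>v\<in>{1..N}. ?x v)\<^sup>2 - N) / 2"
    unfolding w_def A_def by (subst sum_all_edges_prod) auto
  then have "2 * (\<Sum>e\<in>A. w e) = (\<Sum>v\<in>{1..N}. ?x v)\<^sup>2 - N" by simp
  moreover have "0 \<le> (\<Sum>v\<in>{1..N}. ?x v)\<^sup>2" by simp
  ultimately have "- (1 / 2 * real N) \<le> (\<Sum>e\<in>A. w e)" by linarith
  then have "- real N / 2 \<le> (\<Sum>e\<in>A. w e)" by simp
  then have sA: "(1 - p) * (- real N / 2) \<le> (1 - p) * (\<Sum>e\<in>A. w e)" using p by (intro mult_left_mono) auto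
  have "(\<Sum>e\<in>A. w e * (of_bool (e \<in> X) - p)) = (1 - p) * (\<Sum>e\<in>A. w e) - (\<Sum>e\<in>H. w e)"
    unfolding A_def H_def by (rule sum_centered_compl) simp
  then show ?thesis using sH sA unfolding w_def by (simp add: algebra_simps)
qed

text \<open>Budget for \<open>2 * W - n\<close>: the core breaks even up to
  \<open>\<eta> * n\<close> = \<open>\<delta> * n / 10\<close>, the other vertices give a surplus of
  1/100 each, hence \<open>\<delta> * n\<close> or more, and the fluctuations cost
  \<open>10 * \<zeta> * n\<close>. As \<open>D\<close> is \<open>n * \<sigma>\<close> up to O(n) and
  \<open>2 * m\<close> is close to \<open>n\<^sup>2\<close>, the degree term cancels against
  \<open>(1 - q) * \<sigma>\<^sup>2\<close> up to the remainder \<open>R\<close>.\<close>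

lemma cosparse_arith:
  fixes n N J q \<eta> \<zeta> \<delta> W \<mu> \<sigma> D m :: real
  assumes \<delta>: "0 < \<delta>" "\<delta> \<le> 1 / 100" "\<eta> = \<delta> / 10" "\<zeta> = \<delta> / 1000000" and n: "40000000 / \<delta> \<le> n"
    and q: "0 < q" "q * n \<le> 2500" and N: "0 \<le> N" "N \<le> n" "1 - \<eta> - q \<le> q * N" "q * N \<le> 1" "100 * \<delta> * n \<le> n - N"
    and J: "n - N - 1 \<le> 2 * J" and mu: "101 / 100 \<le> \<mu>"
    and W: "q * N * (N - 2) / 2 + J * \<mu> - 5 * \<zeta> * n \<le> W"
    and s: "\<bar>\<sigma>\<bar> \<le> 2 * \<zeta> * n" and D: "\<bar>D - (n - 1) * \<sigma>\<bar> \<le> 2502 * n"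
    and m: "n\<^sup>2 - 2503 * n \<le> 2 * m" "2 * m \<le> n\<^sup>2"
  shows "\<delta> / (4 * n) \<le> (2 * W + (1 - q) * (\<sigma>\<^sup>2 - n) - D\<^sup>2 / (2 * m)) / (4 * m)"
proof -
  have n9: "4000000000 \<le> n"
  proof -
    have "4000000000 \<le> 40000000 / \<delta>" using \<delta> by (simp add: field_simps)
    then show ?thesis using n by linarith
  qed
  have dn: "40000000 \<le> \<delta> * n" using n \<delta> by (simp add: field_simps)
  have "n * 4000000000 \<le> n * n" using n9 by (intro mult_left_mono) auto
  then have n2: "n\<^sup>2 / 2 \<le> n\<^sup>2 - 2503 * n" "0 < n\<^sup>2" using n9 by (auto simp: power2_eq_square)
  then have m0: "n\<^sup>2 / 2 \<le> 2 * m" "0 < m" using m by linarith+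
  have "(1 - \<eta> - q) * N \<le> (q * N) * N" using N by (intro mult_right_mono) auto
  moreover have "q * N \<le> 2500" using q N by linarith
  moreover have "\<eta> * N \<le> \<eta> * n" using N \<delta> by (intro mult_left_mono) auto
  ultimately have w1: "N - \<eta> * n - 2502 \<le> q * N * (N - 2)" using N(4) by (simp add: algebra_simps)
  have w2: "101 * (n - N - 1) \<le> 100 * (2 * J * \<mu>)"
  proof -
    have "0 \<le> \<delta> * n" using dn by linarith
    then have "0 \<le> 2 * J" using J N dn by (simp add: mult.assoc)
    have "(n - N - 1) * (101 / 100) \<le> (2 * J) * (101 / 100)" using J by (intro mult_right_mono) auto
    also have "\<dots> \<le> (2 * J) * \<mu>" using mu \<open>0 \<le> 2 * J\<close> by (intro mult_left_mono) auto
    finally show ?thesis by simp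
  qed
  have w3: "q * N * (N - 2) + 2 * J * \<mu> - 10 * (\<zeta> * n) \<le> 2 * W" using W by simp
  have w4: "10 * (\<eta> * n) = \<delta> * n" "1000000 * (\<zeta> * n) = \<delta> * n" "100 * (\<delta> * n) \<le> n - N"
    using N(5) by (simp_all add: \<delta>)
  \<comment> \<open>The products are abstracted to variables, which leaves a purely linear
    problem.\<close>
  have lin: "100 * n + 88 * b - 250400 \<le> 200 * W"
    if "N - a - 2502 \<le> A" "101 * (n - N - 1) \<le> 100 * B" "A + B - 10 * c \<le> 2 * W" "10 * a = b"
      "1000000 * c = b" "100 * b \<le> n - N" "40000000 \<le> b" for a b c A B
    using that by (smt (verit))
  have W2: "100 * n + 88 * (\<delta> * n) - 250400 \<le> 200 * W" by (rule lin[OF w1 w2 w3 w4 dn])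
  \<comment> \<open>Even \<open>R * (n\<^sup>2 / 2)\<close> covers the cross term and the constant
    in \<open>D\<^sup>2\<close>, with room for the losses in \<open>1 - q\<close> and in the lower
    bound for \<open>2 * m\<close>.\<close>
  define R where "R = 3 / 100 * (\<delta> * n) + 13000000"
  have z0: "0 \<le> \<zeta>" "\<zeta> \<le> 1 / 100000000" using \<delta> by auto
  have "\<sigma>\<^sup>2 \<le> (2 * \<zeta> * n)\<^sup>2" using s by (simp add: abs_le_square_iff[symmetric])
  then have s2: "\<sigma>\<^sup>2 \<le> \<zeta> * n\<^sup>2 / 10000"
  proof -
    have "(2 * \<zeta> * n)\<^sup>2 = 4 * \<zeta> * (\<zeta> * n\<^sup>2)" by (simp add: power2_eq_square)
    also have "\<dots> \<le> 1 / 10000 * (\<zeta> * n\<^sup>2)" using z0 by (intro mult_right_mono) auto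
    finally show ?thesis using \<open>\<sigma>\<^sup>2 \<le> (2 * \<zeta> * n)\<^sup>2\<close> by simp
  qed
  have "\<bar>D\<bar> \<le> n * \<bar>\<sigma>\<bar> + 2502 * n"
  proof -
    have "\<bar>D\<bar> \<le> \<bar>(n - 1) * \<sigma>\<bar> + 2502 * n" using D by linarith
    also have "\<bar>(n - 1) * \<sigma>\<bar> = (n - 1) * \<bar>\<sigma>\<bar>" using n9 by (simp add: abs_mult)
    also have "\<dots> \<le> n * \<bar>\<sigma>\<bar>" by (intro mult_right_mono) auto
    finally show ?thesis by simp
  qed
  then have "D\<^sup>2 \<le> (n * \<bar>\<sigma>\<bar> + 2502 * n)\<^sup>2" using n9 by (simp add: abs_le_square_iff[symmetric])
  also have "\<dots> = n\<^sup>2 * \<sigma>\<^sup>2 + n\<^sup>2 * (5004 * \<bar>\<sigma>\<bar> + 6260004)"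
    by (simp add: power2_eq_square algebra_simps)
  also have "\<dots> \<le> n\<^sup>2 * \<sigma>\<^sup>2 + n\<^sup>2 * (5004 * (2 * \<zeta> * n) + 6260004)"
    using s by (intro add_mono mult_left_mono order_refl) auto
  also have "\<dots> \<le> ((1 - q) * \<sigma>\<^sup>2 + R) * (n\<^sup>2 - 2503 * n)"
  proof -
    have 1: "10000 * (n * \<sigma>\<^sup>2) \<le> n\<^sup>2 * (\<zeta> * n)"
      using mult_left_mono[OF s2, of "10000 * n"] n9 by (simp add: power2_eq_square mult_ac)
    have 2: "(q * n) * (n * \<sigma>\<^sup>2) \<le> 2500 * (n * \<sigma>\<^sup>2)" using q n9 by (intro mult_right_mono) auto
    have 3: "R * (n\<^sup>2 / 2) \<le> R * (n\<^sup>2 - 2503 * n)"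
      using n2 dn by (intro mult_left_mono) (auto simp: R_def)
    have 4: "0 \<le> n * (q * \<sigma>\<^sup>2)" using q n9 by simp
    have 5: "R * (n\<^sup>2 / 2) = 15000 * (n\<^sup>2 * (\<zeta> * n)) + 6500000 * n\<^sup>2"
      unfolding R_def \<delta>(4) by (simp add: algebra_simps)
    have 6: "0 \<le> n\<^sup>2 * (\<zeta> * n)" using z0 n9 by simp
    have lin: "a + 10008 * z + 6260004 * v \<le> a - t - 2503 * s + 2503 * b + w"
      if "10000 * s \<le> z" "t \<le> 2500 * s" "y \<le> w" "0 \<le> b" "y = 15000 * z + 6500000 * v" "0 \<le> z" "0 < v"
      for a z v t s b w y :: real
      using that by (smt (verit))
    have "n\<^sup>2 * \<sigma>\<^sup>2 + n\<^sup>2 * (5004 * (2 * \<zeta> * n) + 6260004) =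
      n\<^sup>2 * \<sigma>\<^sup>2 + 10008 * (n\<^sup>2 * (\<zeta> * n)) + 6260004 * n\<^sup>2" by (simp add: algebra_simps)
    also have "\<dots> \<le> n\<^sup>2 * \<sigma>\<^sup>2 - (q * n) * (n * \<sigma>\<^sup>2) - 2503 * (n * \<sigma>\<^sup>2) + 2503 * (n * (q * \<sigma>\<^sup>2)) + R * (n\<^sup>2 - 2503 * n)"
      by (rule lin[OF 1 2 3 4 5 6 n2(2)])
    also have "\<dots> = ((1 - q) * \<sigma>\<^sup>2 + R) * (n\<^sup>2 - 2503 * n)"
      by (simp add: algebra_simps power2_eq_square)
    finally show ?thesis .
  qed
  also have "\<dots> \<le> ((1 - q) * \<sigma>\<^sup>2 + R) * (2 * m)"
  proof (intro mult_left_mono m(1))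
    have "q * 2501 \<le> q * n" using q n9 by (intro mult_left_mono) auto
    then have "q \<le> 1" using q by linarith
    then show "0 \<le> (1 - q) * \<sigma>\<^sup>2 + R" using dn by (simp add: R_def)
  qed
  finally have DD: "D\<^sup>2 / (2 * m) \<le> (1 - q) * \<sigma>\<^sup>2 + R" using m0 by (simp add: divide_le_eq)
  have T: "\<delta> * n / 2 \<le> 2 * W + (1 - q) * (\<sigma>\<^sup>2 - n) - D\<^sup>2 / (2 * m)"
  proof -
    have "(1 - q) * (\<sigma>\<^sup>2 - n) = (1 - q) * \<sigma>\<^sup>2 - n + q * n" by (simp add: algebra_simps)
    moreover have "0 \<le> q * n" using q n9 by simp
    ultimately show ?thesis using DD W2 dn unfolding R_def by linarith
  qed
  have "\<delta> / (4 * n) = (\<delta> * n / 2) / (2 * n\<^sup>2)" using n9 by (simp add: power2_eq_square)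
  also have "\<dots> \<le> (\<delta> * n / 2) / (4 * m)" using m m0 dn n2 by (intro divide_left_mono) auto
  also have "\<dots> \<le> (2 * W + (1 - q) * (\<sigma>\<^sup>2 - n) - D\<^sup>2 / (2 * m)) / (4 * m)"
    using T m0 by (intro divide_right_mono) auto
  finally show ?thesis .
qed

lemma cosparse_regime:
  fixes n :: nat and p \<delta> :: real
  assumes \<delta>: "0 < \<delta>" "\<delta> < 1 / 100" and n: "40000000 / \<delta> \<le> n"
    and q1: "1 \<le> (1 - 100 * \<delta>) * (n * (1 - p))" and q2: "n * (1 - p) \<le> 2500"
  shows "EE p (all_edges {1..n}) (\<lambda>X. of_bool (\<not> \<delta> / 300 * sqrt ((1 - p) / (n * p)) \<le> modularity {1..n} X))
    \<le> 10 ^ 18 / \<delta> ^ 3 / n"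
proof -
  let ?A = "all_edges {1..n}"
  define q where "q = 1 - p"
  define \<eta> where "\<eta> = \<delta> / 10"
  define \<zeta> where "\<zeta> = \<delta> / 1000000"
  \<comment> \<open>The largest core with \<open>q * N \<le> 1 - \<eta>\<close>: subcritical, yet so
    close to critical that its missing edges pay for almost all of its deficit
    \<open>N\<close>.\<close>
  define N where "N = nat \<lfloor>(1 - \<eta>) / q\<rfloor>"
  define J where "J = (n - N) div 2"
  define r where "r = 2 * p * q"
  define \<mu> where "\<mu> = walk r N abs 0"
  let ?S = "{1..N}" and ?I = "{N+1..N+J}" and ?L = "late_edges N J n"
  define x where "x = colouring N"
  define s where "s X = gsign N J (x X) X" for X
  define H where "H X = all_edges ?S - X" for X :: "nat set set"
  have p_q: "p = 1 - q" "1 - p = q" by (simp_all add: q_def)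
  have n9: "4000000000 \<le> real n"
  proof -
    have "4000000000 \<le> 40000000 / \<delta>" using \<delta> by (simp add: field_simps)
    then show ?thesis using n by linarith
  qed
  have dn: "40000000 \<le> \<delta> * n" using n \<delta> by (simp add: field_simps)
  have ez: "0 < \<eta>" "\<eta> \<le> 1 / 1000" "0 < \<zeta>" "\<zeta> \<le> 1" using \<delta> by (auto simp: \<eta>_def \<zeta>_def)
  have nq: "1 \<le> (1 - 100 * \<delta>) * (n * q)" "n * q \<le> 2500" using q1 q2 by (simp_all add: q_def)
  have q: "0 < q"
  proof (rule ccontr)
    assume "\<not> 0 < q"
    then have "(1 - 100 * \<delta>) * (n * q) \<le> 0" using \<delta> by (intro mult_nonneg_nonpos) auto
    then show False using nq(1) by linarith
  qed
  have "q * 4000000000 \<le> q * n" using n9 q by (intro mult_left_mono) auto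
  then have qs: "q \<le> 1 / 1000000" using nq(2) by (simp add: mult.commute)
  have p: "999999 / 1000000 \<le> p" "p \<le> 1" "0 \<le> p" using qs q by (auto simp: p_q(1))
  have "0 \<le> (1 - \<eta>) / q" using ez q by simp
  then have "real N \<le> (1 - \<eta>) / q" "(1 - \<eta>) / q < real N + 1" unfolding N_def by linarith+
  then have qN: "q * N \<le> 1 - \<eta>" "1 - \<eta> - q \<le> q * N" using q by (simp_all add: field_simps)
  \<comment> \<open>The hypothesis \<open>q1\<close> leaves a proportion
    \<open>100 * \<delta>\<close> of the vertices outside the core, where the surplus is
    earned.\<close>
  have Nn: "100 * \<delta> * n \<le> n - real N"
  proof -
    have "q * N \<le> 1" using qN ez by linarith
    also have "1 \<le> q * ((1 - 100 * \<delta>) * n)" using nq(1) by (simp add: mult_ac)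
    finally have "real N \<le> (1 - 100 * \<delta>) * n" using q by simp
    then show ?thesis by (simp add: algebra_simps)
  qed
  then have "real N \<le> n" using dn by linarith
  then have NN: "N \<le> n" by simp
  have NJ: "N + 2 * J \<le> n" "n \<le> N + 2 * J + 1" using NN by (auto simp: J_def)
  have r: "0 \<le> r" "r \<le> 1 / 2000"
  proof -
    show "0 \<le> r" using p q by (simp add: r_def)
    have "2 * p * q \<le> 2 * 1 * (1 / 1000000)" using p q qs by (intro mult_mono) auto
    then show "r \<le> 1 / 2000" by (simp add: r_def)
  qed
  have mu: "101 / 100 \<le> \<mu>"
    unfolding \<mu>_def
  proof (rule walk_abs_ge_101[OF r])
    have e: "N * r = 2 * (p * (q * N))" by (simp add: r_def)
    have "p * (q * N) \<le> 1 * 1" using p q qN ez by (intro mult_mono) auto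
    then show "N * r \<le> 2" unfolding e by simp
    have "995 / 1000 \<le> (999999 / 1000000) * (998 / 1000 :: real)" by simp
    also have "\<dots> \<le> p * (q * N)" using p qN qs ez by (intro mult_mono) auto
    finally show "199 / 100 \<le> N * r" unfolding e by simp
  qed
  have x1: "x X v = 1 \<or> x X v = -1" for X v unfolding x_def by (rule colouring(1))
  have s1: "s X v = 1 \<or> s X v = -1" for X v unfolding s_def by (rule gsign_cases[OF x1])
  have xI: "x (X \<inter> all_edges ?S) = x X" for X unfolding x_def by (rule colouring_Int)
  define Y where "Y X e = of_bool (e \<in> X) - p" for X :: "nat set set" and e
  define f1 where "f1 X = (\<Sum>v\<in>?I. \<bar>zsum ?S (x X) v (v + J) X\<bar>) - J * \<mu>" for X
  define f2 where "f2 X = (\<Sum>e\<in>?L. (\<Prod>v\<in>e. s X v) * Y X e)" for X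
  define f3 where "f3 X = (\<Sum>e\<in>all_edges ?S. 1 * Y X e)" for X
  define f4 where "f4 X = (\<Sum>e\<in>?A. 1 * Y X e)" for X
  define c where "c X = real (card (conn_pairs ?S (H X)))" for X
  define d where "d X = real (card (cycle_edges ?S (H X)))" for X
  have SA: "all_edges ?S \<subseteq> ?A" using NN by (intro all_edges_mono) auto
  have B: "(real n)\<^sup>2 * q \<le> 2500 * n"
    using mult_left_mono[OF nq(2), of "real n"] by (simp add: power2_eq_square mult_ac)
  have pq: "p * q \<le> q" using p q by simp
  have V1: "EE p ?A (\<lambda>X. (f1 X)\<^sup>2) \<le> 2500 * n"
  proof -
    have "EE p ?A (\<lambda>X. (f1 X)\<^sup>2) \<le> real J * real N * (2 * p * (1 - p))"
      using EE_sum_abs_zsum[where x = x, OF NJ(1) p(3,2) x1] unfolding xI f1_def \<mu>_def r_def p_q(2) .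
    also have "\<dots> = (2 * real J * N) * (p * q)" by (simp add: p_q(2))
    also have "\<dots> \<le> (real n * real n) * q"
    proof (rule mult_mono[OF _ pq])
      have "2 * real J \<le> n" "real N \<le> n" using NJ NN by linarith+
      then show "2 * real J * N \<le> real n * real n" by (intro mult_mono) auto
    qed (use p q in auto)
    also have "\<dots> \<le> 2500 * n" using B by (simp add: power2_eq_square)
    finally show ?thesis .
  qed
  have half: "1\<^sup>2 * ((real n)\<^sup>2 / 2) * (p * (1 - p)) \<le> 2500 * n"
  proof -
    have "(real n)\<^sup>2 / 2 * (p * q) \<le> (real n)\<^sup>2 * q" using p q by (intro mult_mono pq) auto
    then show ?thesis using B by (simp add: p_q(2))
  qed
  have V2: "EE p ?A (\<lambda>X. (f2 X)\<^sup>2) \<le> 2500 * n"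
  proof -
    have "EE p ?A (\<lambda>X. (\<Sum>e\<in>?L. (\<Prod>v\<in>e. gsign N J (x (X \<inter> all_edges ?S)) X v) * (of_bool (e \<in> X) - p))\<^sup>2)
      \<le> 1\<^sup>2 * ((real n)\<^sup>2 / 2) * (p * (1 - p))"
      using p x1 by (intro EE_sum_late[OF NJ(1), where x = x and h = "\<lambda>s e. \<Prod>v\<in>e. s v"] abs_prod_edge_le) auto
    then show ?thesis using half unfolding f2_def s_def Y_def xI by linarith
  qed
  have V3: "EE p ?A (\<lambda>X. (f3 X)\<^sup>2) \<le> 2500 * n"
    unfolding f3_def Y_def using p SA by (intro order_trans[OF EE_fixed_linear_square half]) auto
  have V4: "EE p ?A (\<lambda>X. (f4 X)\<^sup>2) \<le> 2500 * n"
    unfolding f4_def Y_def using p by (intro order_trans[OF EE_fixed_linear_square half]) auto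
  \<comment> \<open>The missing edges inside the core form a random graph with parameter
    \<open>q\<close>.\<close>
  have E: "EE p ?A (\<lambda>X. G (H X)) = EE q (all_edges ?S) G" for G
  proof -
    have "EE p ?A (\<lambda>X. G (H X)) = EE p ?A (\<lambda>X. G (all_edges ?S - X \<inter> all_edges ?S))"
      unfolding H_def by (intro EE_cong arg_cong[of _ _ G]) auto
    also have "\<dots> = EE p (all_edges ?S) (\<lambda>X. G (all_edges ?S - X))"
      using SA by (intro EE_restrict) (auto simp: finite_all_edges)
    also have "\<dots> = EE q (all_edges ?S) G"
      unfolding q_def by (rule EE_complement) (simp add: finite_all_edges)
    finally show ?thesis .
  qed
  have q01: "0 \<le> q" "q \<le> 1" "q * card ?S \<le> 1 - \<eta>" "1 - \<eta> < 1" using q qs qN ez by auto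
  have Ec: "EE p ?A c \<le> n / \<eta>"
  proof -
    have "EE p ?A c \<le> card ?S / (1 - (1 - \<eta>))"
      unfolding c_def E[of "\<lambda>h. real (card (conn_pairs ?S h))"] using q01 by (intro EE_conn_pairs) auto
    also have "\<dots> \<le> n / \<eta>" using NN ez by (simp add: divide_right_mono)
    finally show ?thesis .
  qed
  have Ed: "EE p ?A d \<le> 1 / \<eta>"
  proof -
    have "EE p ?A d \<le> (1 - \<eta>) / (1 - (1 - \<eta>))"
      unfolding d_def E[of "\<lambda>h. real (card (cycle_edges ?S h))"] using q01 by (intro EE_cycle_edges) auto
    also have "\<dots> \<le> 1 / \<eta>" using ez by (simp add: divide_right_mono)
    finally show ?thesis .
  qed
  define t where "t = \<zeta> * n"
  have t: "0 < t" "40 \<le> t" using dn by (auto simp: t_def \<zeta>_def)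
  have tn: "t \<le> n" using mult_right_mono[OF ez(4), of "real n"] by (simp add: t_def)
  define K1 where "K1 = 2500 / \<zeta>\<^sup>2 / n"
  define K2 where "K2 = 1 / (\<eta> * \<zeta>\<^sup>2) / n"
  have K1: "2500 * n / t\<^sup>2 = K1"
    using ez n9 by (simp add: t_def K1_def power2_eq_square field_simps)
  have P: "EE p ?A (\<lambda>X. of_bool (t \<le> \<bar>f1 X\<bar>)) \<le> K1" "EE p ?A (\<lambda>X. of_bool (t \<le> \<bar>f2 X\<bar>)) \<le> K1"
    "EE p ?A (\<lambda>X. of_bool (t \<le> \<bar>f3 X\<bar>)) \<le> K1" "EE p ?A (\<lambda>X. of_bool (t \<le> \<bar>f4 X\<bar>)) \<le> K1"
    using EE_tail[OF p(3,2) V1 t(1) K1[THEN eq_refl]] EE_tail[OF p(3,2) V2 t(1) K1[THEN eq_refl]]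
      EE_tail[OF p(3,2) V3 t(1) K1[THEN eq_refl]] EE_tail[OF p(3,2) V4 t(1) K1[THEN eq_refl]] by auto
  \<comment> \<open>\<open>c X\<close> bounds the square of the core's colour sum, hence the
    threshold \<open>t\<^sup>2\<close>; its mean is only linear in \<open>n\<close>.\<close>
  have Pc: "EE p ?A (\<lambda>X. of_bool (t\<^sup>2 \<le> c X)) \<le> K2"
  proof -
    have "EE p ?A (\<lambda>X. of_bool (t\<^sup>2 \<le> c X)) \<le> EE p ?A c / t\<^sup>2"
      using t p by (intro EE_markov) (auto simp: c_def)
    also have "\<dots> \<le> (n / \<eta>) / t\<^sup>2" using Ec by (intro divide_right_mono) auto
    also have "\<dots> = K2" using ez n9 by (simp add: t_def K2_def power2_eq_square field_simps)
    finally show ?thesis .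
  qed
  have Pd: "EE p ?A (\<lambda>X. of_bool (t \<le> d X)) \<le> K2"
  proof -
    have "EE p ?A (\<lambda>X. of_bool (t \<le> d X)) \<le> EE p ?A d / t"
      using t p by (intro EE_markov) (auto simp: d_def)
    also have "\<dots> \<le> (1 / \<eta>) / t" using Ed t by (intro divide_right_mono) auto
    also have "\<dots> = 1 / (\<eta> * \<zeta>) / n" by (simp add: t_def)
    also have "\<dots> \<le> K2"
      unfolding K2_def using ez by (intro divide_right_mono divide_left_mono) (auto simp: power2_eq_square mult_left_le)
    finally show ?thesis .
  qed
  have good: "\<delta> / 300 * sqrt (q / (n * p)) \<le> modularity {1..n} X"
    if X: "X \<subseteq> ?A" and ev: "\<bar>f1 X\<bar> < t" "\<bar>f2 X\<bar> < t" "\<bar>f3 X\<bar> < t" "\<bar>f4 X\<bar> < t" "c X < t\<^sup>2" "d X < t" for X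
  proof -
    define m where "m = real (card X)"
    define \<sigma> where "\<sigma> = (\<Sum>v\<in>{1..n}. s X v)"
    define W where "W = (\<Sum>e\<in>?A. (\<Prod>v\<in>e. s X v) * (of_bool (e \<in> X) - p))"
    define b where "b = (\<Sum>e\<in>?A. (\<Sum>v\<in>e. s X v) * (of_bool (e \<in> X) - p))"
    have cardH: "real (card (all_edges V - X)) = q * (real (card V) * (real (card V) - 1) / 2) - (\<Sum>e\<in>all_edges V. 1 * Y X e)"
      if "finite V" for V
      unfolding Y_def using sum_centered_compl[OF that, of "\<lambda>_. 1" X p] card_all_edges[OF that]
      by (simp add: p_q(2))
    have h: "real (card (H X)) = q * (real N * (real N - 1) / 2) - f3 X"
      unfolding H_def f3_def using cardH[of ?S] by simp
    have k: "real (card (?A - X)) = q * (real n * (real n - 1) / 2) - f4 X"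
      unfolding f4_def using cardH[of "{1..n}"] by simp
    have kn: "real (card (?A - X)) \<le> 1251 * n"
    proof -
      have "q * (real n * (real n - 1) / 2) \<le> 1 / 2 * ((real n)\<^sup>2 * q)" using q by (simp add: power2_eq_square algebra_simps)
      then show ?thesis using k ev(4) tn B by linarith
    qed
    have mk: "2 * m = real n * (real n - 1) - 2 * real (card (?A - X))"
    proof -
      have "card X + card (?A - X) = card ?A"
        using X by (simp add: card_Diff_subset finite_subset[OF X] finite_all_edges card_mono)
      then have "m + real (card (?A - X)) = real (card ?A)" unfolding m_def by linarith
      also have "\<dots> = real n * (real n - 1) / 2" by (simp add: card_all_edges)
      finally show ?thesis by simp
    qed
    have m: "(real n)\<^sup>2 - 2503 * real n \<le> 2 * m" "2 * m \<le> (real n)\<^sup>2"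
      using mk kn by (simp_all add: power2_eq_square algebra_simps)
    have "4000000000 * real n \<le> n * real n" using n9 by (intro mult_right_mono) auto
    then have "m > 0" using m(1) n9 unfolding power2_eq_square by linarith
    then have Xne: "X \<noteq> {}" by (auto simp: m_def)
    have "W = (\<Sum>e\<in>all_edges ?S. (\<Prod>v\<in>e. x X v) * (of_bool (e \<in> X) - p)) + (f1 X + J * \<mu>) + f2 X"
      unfolding W_def s_def sum_gsign_prod[OF NJ(1)] by (simp add: f1_def f2_def Y_def s_def)
    moreover have "real (card (H X)) - 2 * d X - q * N / 2 \<le> (\<Sum>e\<in>all_edges ?S. (\<Prod>v\<in>e. x X v) * (of_bool (e \<in> X) - p))"
      using sum_colouring_ge[OF p(2), of N X] by (simp add: H_def d_def x_def p_q(2))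
    moreover have "q * (real N * (real N - 1) / 2) - q * N / 2 = q * real N * (real N - 2) / 2"
      by (simp add: field_simps)
    ultimately have W: "q * real N * (real N - 2) / 2 + J * \<mu> - 5 * \<zeta> * n \<le> W"
      using ev h unfolding t_def by (simp add: algebra_simps)
    have "(\<Sum>v\<in>?S. x X v)\<^sup>2 \<le> c X" unfolding x_def c_def H_def by (rule colouring(3))
    then have "(\<Sum>v\<in>?S. x X v)\<^sup>2 \<le> t\<^sup>2" using ev(5) by linarith
    then have "\<bar>\<Sum>v\<in>?S. x X v\<bar> \<le> t" using t abs_le_square_iff[of "\<Sum>v\<in>?S. x X v" t] by simp
    moreover have "\<sigma> = (\<Sum>v\<in>?S. x X v) + (real n - N - 2 * J)"
      unfolding \<sigma>_def s_def by (rule sum_gsign[OF NJ])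
    moreover have "0 \<le> real n - N - 2 * J" "real n - N - 2 * J \<le> 1" using NJ by linarith+
    ultimately have sg: "\<bar>\<sigma>\<bar> \<le> 2 * \<zeta> * n" using t by (simp add: t_def)
    define D where "D = b + p * (real n - 1) * \<sigma>"
    \<comment> \<open>The degree of a vertex is \<open>n - 1\<close> minus its number of missing
      edges, so the signed degree sum \<open>D\<close> differs from
      \<open>(n - 1) * \<sigma>\<close> by at most 2 for every missing edge.\<close>
    have "b = q * ((real n - 1) * \<sigma>) - (\<Sum>e\<in>?A - X. \<Sum>v\<in>e. s X v)"
      unfolding b_def using sum_centered_compl[of "{1..n}" "\<lambda>e. \<Sum>v\<in>e. s X v" X p]
        sum_all_edges_sum[of "{1..n}" "s X"] by (simp add: p_q(2) \<sigma>_def)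
    then have "D - (real n - 1) * \<sigma> = - (\<Sum>e\<in>?A - X. \<Sum>v\<in>e. s X v)"
      unfolding D_def p_q(1) by (simp add: algebra_simps)
    then have "\<bar>D - (real n - 1) * \<sigma>\<bar> \<le> (\<Sum>e\<in>?A - X. \<bar>\<Sum>v\<in>e. s X v\<bar>)" by simp
    also have "\<dots> \<le> (\<Sum>e\<in>?A - X. 2)" using s1 by (intro sum_mono abs_sum_edge_le[of _ _ "{1..n}"]) auto
    finally have D: "\<bar>D - (real n - 1) * \<sigma>\<bar> \<le> 2502 * real n" using kn by simp
    have J2: "real n - N - 1 \<le> 2 * real J" using NJ by linarith
    \<comment> \<open>As \<open>n * q\<close> is bounded, the target is of order
      \<open>1 / n\<close>. This is why a surplus linear in \<open>n\<close> suffices after division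
      by \<open>4 * m\<close>.\<close>
    have "sqrt (q / (n * p)) \<le> 75 / n"
    proof (rule real_le_lsqrt)
      have "q * n * 2 \<le> 5625 * (999999 / 1000000)" using nq(2) by (simp add: mult.commute)
      also have "\<dots> \<le> 5625 * p" using p by simp
      finally show "q / (n * p) \<le> (75 / n)\<^sup>2" using p n9 q by (simp add: power2_eq_square field_simps)
    qed (use n9 p q in auto)
    then have "\<delta> / 300 * sqrt (q / (n * p)) \<le> \<delta> / 300 * (75 / n)" using \<delta> by (intro mult_left_mono) auto
    also have "\<dots> = \<delta> / (4 * real n)" by simp
    also have "\<dots> \<le> (2 * W + (1 - q) * (\<sigma>\<^sup>2 - n) - D\<^sup>2 / (2 * m)) / (4 * m)"
      using \<delta> n q nq(2) NN qN ez Nn J2 mu W sg D m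
      by (intro cosparse_arith[where \<eta> = \<eta> and \<zeta> = \<zeta> and N = N and J = J and \<mu> = \<mu>])
        (auto simp: \<eta>_def \<zeta>_def mult.commute)
    also have "\<dots> \<le> modularity {1..n} X"
      using modularity_ge_centered[OF _ X Xne s1[of X], where p = p]
      by (simp add: W_def b_def m_def \<sigma>_def D_def p_q(1))
    finally show ?thesis .
  qed
  have "EE p ?A (\<lambda>X. of_bool (\<not> \<delta> / 300 * sqrt (q / (n * p)) \<le> modularity {1..n} X)) \<le>
    EE p ?A (\<lambda>X. of_bool (t \<le> \<bar>f1 X\<bar>) + (of_bool (t \<le> \<bar>f2 X\<bar>) + (of_bool (t \<le> \<bar>f3 X\<bar>) +
      (of_bool (t \<le> \<bar>f4 X\<bar>) + (of_bool (t\<^sup>2 \<le> c X) + of_bool (t \<le> d X))))))"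
  proof (rule EE_mono[OF p(3,2)])
    fix X assume "X \<subseteq> ?A"
    note gX = good[OF this]
    show "of_bool (\<not> \<delta> / 300 * sqrt (q / (n * p)) \<le> modularity {1..n} X) \<le>
      (of_bool (t \<le> \<bar>f1 X\<bar>) + (of_bool (t \<le> \<bar>f2 X\<bar>) + (of_bool (t \<le> \<bar>f3 X\<bar>) +
      (of_bool (t \<le> \<bar>f4 X\<bar>) + (of_bool (t\<^sup>2 \<le> c X) + of_bool (t \<le> d X))))) :: real)"
      by (intro of_bool_le_add) (use gX in \<open>auto simp: not_le[symmetric]\<close>)
  qed
  also have "\<dots> \<le> K1 + (K1 + (K1 + (K1 + (K2 + K2))))"
    unfolding EE_add using P Pc Pd by (intro add_mono)
  also have "\<dots> = (10 ^ 16 * \<delta> + 2 * 10 ^ 13) / \<delta> ^ 3 / n"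
    unfolding K1_def K2_def \<eta>_def \<zeta>_def using \<delta> n9
    by (simp add: power2_eq_square power3_eq_cube field_simps)
  also have "\<dots> \<le> 10 ^ 18 / \<delta> ^ 3 / n" using \<delta> by (intro divide_right_mono) auto
  finally show ?thesis by (simp add: q_def)
qed

section \<open>Combination of the two regimes\<close>

theorem theorem1p5:
  fixes \<epsilon> :: real
  assumes "\<epsilon> > 0"
  shows "\<exists>\<alpha>>0. \<forall>p :: nat \<Rightarrow> real.
    (\<forall>\<^sub>F n in sequentially. 1 / real n \<le> p n \<and> p n \<le> 1 - (1 + \<epsilon>) / real n) \<longrightarrow>
    (\<lambda>n. measure_pmf.prob (binomial_random_graph n (p n))
           {E. modularity {1..n} E \<ge> \<alpha> * sqrt ((1 - p n) / (real n * p n))})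
      \<longlonglongrightarrow> 1"
proof -
  \<comment> \<open>Chosen so that \<open>1 - 100 * \<delta> = 1 / (1 + \<epsilon>)\<close>; the
    factor 100 matches the surplus of 1/100 for each vertex outside the core.\<close>
  define \<delta> where "\<delta> = \<epsilon> / (1 + \<epsilon>) / 100"
  have \<delta>: "0 < \<delta>" "\<delta> < 1 / 100" "(1 - 100 * \<delta>) * (1 + \<epsilon>) = 1"
    using assms by (auto simp: \<delta>_def field_simps)
  define \<alpha> where "\<alpha> = \<delta> / 300"
  define K where "K = 10 ^ 18 / \<delta> ^ 3"
  have \<alpha>: "0 < \<alpha>" "\<alpha> \<le> 1 / 50" using \<delta> by (auto simp: \<alpha>_def)
  have K: "60000 \<le> K"
  proof -
    have "60000 * \<delta> ^ 3 \<le> 60000 * 1 ^ 3" using \<delta> by (intro mult_left_mono power_mono) auto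
    then show ?thesis using \<delta> by (simp add: K_def field_simps)
  qed
  show ?thesis
  proof (intro exI[of _ \<alpha>] conjI allI impI)
    fix p :: "nat \<Rightarrow> real"
    assume p: "\<forall>\<^sub>F n in sequentially. 1 / real n \<le> p n \<and> p n \<le> 1 - (1 + \<epsilon>) / real n"
    let ?Q = "\<lambda>n. {E. modularity {1..n} E \<ge> \<alpha> * sqrt ((1 - p n) / (real n * p n))}"
    let ?P = "\<lambda>n. measure_pmf.prob (binomial_random_graph n (p n)) (?Q n)"
    have "\<forall>\<^sub>F n in sequentially. 1 - K / real n \<le> ?P n"
      using p eventually_ge_at_top[of "nat \<lceil>40000000 / \<delta>\<rceil>"]
    proof eventually_elim
      case (elim n)
      let ?A = "all_edges {1..n}"
      have n: "40000000 / \<delta> \<le> n" using elim by linarith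
      have "1000 \<le> 40000000 / \<delta>" using \<delta> by (simp add: field_simps)
      then have n1: "1000 \<le> real n" using n by linarith
      have p01: "0 \<le> p n" "p n \<le> 1"
      proof -
        have "0 \<le> 1 / real n" "0 \<le> (1 + \<epsilon>) / real n" using assms by auto
        then show "0 \<le> p n" "p n \<le> 1" using elim by linarith+
      qed
      \<comment> \<open>The lower bound on \<open>p n\<close> feeds the case of large complement
        degree, the upper bound that of bounded degree.\<close>
      have bad: "EE (p n) ?A (\<lambda>X. of_bool (X \<notin> ?Q n)) \<le> K / n"
      proof (cases "2500 / n \<le> 1 - p n")
        case True
        have "EE (p n) ?A (\<lambda>X. of_bool (X \<notin> ?Q n)) \<le>
           EE (p n) ?A (\<lambda>X. of_bool (\<not> 1 / 50 * sqrt ((1 - p n) / (n * p n)) \<le> modularity {1..n} X))"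
        proof (rule EE_mono[OF p01])
          fix X
          have "\<alpha> * sqrt ((1 - p n) / (n * p n)) \<le> 1 / 50 * sqrt ((1 - p n) / (n * p n))"
            using \<alpha> p01 by (intro mult_right_mono) auto
          then show "of_bool (X \<notin> ?Q n) \<le>
            (of_bool (\<not> 1 / 50 * sqrt ((1 - p n) / (n * p n)) \<le> modularity {1..n} X) :: real)" by auto
        qed
        also have "\<dots> \<le> 60000 / n" using n1 elim True by (intro dense_regime) auto
        also have "\<dots> \<le> K / n" using K by (intro divide_right_mono) auto
        finally show ?thesis .
      next
        case False
        have "1 + \<epsilon> \<le> n * (1 - p n)" using elim n1 by (simp add: field_simps)
        then have "(1 - 100 * \<delta>) * (1 + \<epsilon>) \<le> (1 - 100 * \<delta>) * (n * (1 - p n))"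
          using \<delta> by (intro mult_left_mono) auto
        then have "1 \<le> (1 - 100 * \<delta>) * (n * (1 - p n))" unfolding \<delta>(3) .
        moreover have "n * (1 - p n) \<le> 2500" using False n1 by (simp add: field_simps)
        ultimately have "EE (p n) ?A (\<lambda>X. of_bool (\<not> \<delta> / 300 * sqrt ((1 - p n) / (n * p n)) \<le> modularity {1..n} X))
          \<le> 10 ^ 18 / \<delta> ^ 3 / n"
          using \<delta> n by (intro cosparse_regime) auto
        then show ?thesis by (simp add: K_def \<alpha>_def)
      qed
      have "?P n = EE (p n) ?A (\<lambda>X. 1 - of_bool (X \<notin> ?Q n))"
        unfolding prob_binomial_random_graph[OF p01] by (intro EE_cong) auto
      also have "\<dots> = 1 - EE (p n) ?A (\<lambda>X. of_bool (X \<notin> ?Q n))"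
        unfolding EE_diff by (simp add: EE_const finite_all_edges)
      finally show ?case using bad by linarith
    qed
    moreover have "\<forall>\<^sub>F n in sequentially. ?P n \<le> 1" by (simp add: measure_pmf.prob_le_1)
    moreover have "(\<lambda>n. 1 - K / real n) \<longlonglongrightarrow> 1 - 0"
      by (intro tendsto_diff tendsto_const lim_const_over_n)
    ultimately show "?P \<longlonglongrightarrow> 1"
      using tendsto_sandwich[of "\<lambda>n. 1 - K / real n" ?P sequentially "\<lambda>_. 1" 1] by simp
  qed (use \<alpha> in auto)
qed

end
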